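(* Let $A=\bigoplus_\lambda^{c_0}K(H_\lambda)$ be a compact C$^*$-algebra, $B$ a Banach algebra, $c\in A$ with $\operatorname{rank}(\pi_\lambda(c))\le\dim(H_\lambda)-2$ for all $\lambda$, and $\varphi:A\to B$ a bounded linear map having the product property at $c$. Then $\varphi$ preserves zero products ($ab=0\Rightarrow\varphi(a)\varphi(b)=0$). Moreover, if $B$ is a C$^*$-algebra and $\varphi$ is bijective, then there exist $h$ in the center $Z(M(B))$ of the multiplier algebra of $B$ and an algebra isomorphism $\rho:A\to B$ such that $\varphi(a)=h\rho(a)$ for all $a\in A$.
   Context: $\bigoplus_\lambda^{c_0}K(H_\lambda)$ is the C$^*$-algebra of families of compact operators $x_\lambda\in K(H_\lambda)$ on complex Hilbert spaces with $\|x_\lambda\|\to0$; $\pi_\lambda$ is the coordinate projection. A linear map $\varphi:A\to B$ has the product property at $c$ if there is a linear $T:A\to B$ with $\varphi(a)\varphi(b)=T(ab)$ for all $a,b\in A$ with $ab=c$. The multiplier algebra of a C$^*$-algebra $B$ is $M(B)=\{x\in B^{**}: xb,bx\in B\ \forall b\in B\}$. *)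

theory Defs
  imports "HOL-Analysis.Analysis" "HOL-Library.Extended_Nat"
begin

class cvector = real_vector +
  fixes scaleC :: "complex \<Rightarrow> 'a \<Rightarrow> 'a"
  assumes scaleC_add_right: "scaleC a (x + y) = scaleC a x + scaleC a y"
    and scaleC_add_left: "scaleC (a + b) x = scaleC a x + scaleC b x"
    and scaleC_scaleC: "scaleC a (scaleC b x) = scaleC (a * b) x"
    and scaleC_one: "scaleC 1 x = x"
    and scaleR_scaleC: "scaleR r x = scaleC (complex_of_real r) x"

class cnormed_vector = cvector + real_normed_vector +
  assumes norm_scaleC: "norm (scaleC a x) = cmod a * norm x"

class cinner_space = cnormed_vector +
  fixes cinner :: "'a \<Rightarrow> 'a \<Rightarrow> complex"
  assumes cinner_cnj_commute: "cinner x y = cnj (cinner y x)"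
    and cinner_add_right: "cinner x (y + z) = cinner x y + cinner x z"
    and cinner_scaleC_right: "cinner x (scaleC a y) = a * cinner x y"
    and cinner_nonneg: "0 \<le> Re (cinner x x)"
    and cinner_norm: "norm x = sqrt (Re (cinner x x))"

class chilbert = cinner_space + complete_space

class cnormed_algebra = cnormed_vector + real_normed_algebra +
  assumes scaleC_mult_left: "scaleC a x * y = scaleC a (x * y)"
    and scaleC_mult_right: "x * scaleC a y = scaleC a (x * y)"

class cbanach_algebra = cnormed_algebra + complete_space

definition is_cstar_involution :: "('b::cbanach_algebra \<Rightarrow> 'b) \<Rightarrow> bool" where
  "is_cstar_involution st \<longleftrightarrow>
     (\<forall>x. st (st x) = x) \<and>
     (\<forall>x y. st (x + y) = st x + st y) \<and>
     (\<forall>a x. st (scaleC a x) = scaleC (cnj a) (st x)) \<and>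
     (\<forall>x y. st (x * y) = st y * st x) \<and>
     (\<forall>x. norm (st x * x) = (norm x)\<^sup>2)"

definition csubspace :: "'h::cvector set \<Rightarrow> bool" where
  "csubspace S \<longleftrightarrow> 0 \<in> S \<and> (\<forall>x\<in>S. \<forall>y\<in>S. x + y \<in> S) \<and> (\<forall>a. \<forall>x\<in>S. scaleC a x \<in> S)"

definition cindependent :: "'h::cvector set \<Rightarrow> bool" where
  "cindependent B \<longleftrightarrow> (\<forall>c. (\<Sum>x\<in>B. scaleC (c x) x) = 0 \<longrightarrow> (\<forall>x\<in>B. c x = 0))"

definition cdim :: "'h::cvector set \<Rightarrow> enat" where
  "cdim S = Sup {enat (card B) | B. finite B \<and> B \<subseteq> S \<and> cindependent B}"

definition clinear_on :: "'h::cvector set \<Rightarrow> ('h \<Rightarrow> 'k::cvector) \<Rightarrow> bool" where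
  "clinear_on S T \<longleftrightarrow> (\<forall>x\<in>S. \<forall>y\<in>S. T (x + y) = T x + T y) \<and>
                       (\<forall>a. \<forall>x\<in>S. T (scaleC a x) = scaleC a (T x))"

text \<open>A compact operator on the (closed) subspace \<open>S\<close> of an ambient Hilbert space,
  represented by a function vanishing off \<open>S\<close>.\<close>
definition compact_op_on :: "'h::chilbert set \<Rightarrow> ('h \<Rightarrow> 'h) \<Rightarrow> bool" where
  "compact_op_on S T \<longleftrightarrow> T ` S \<subseteq> S \<and> clinear_on S T \<and> (\<forall>x. x \<notin> S \<longrightarrow> T x = 0) \<and>
     compact (closure (T ` (S \<inter> cball 0 1)))"

definition opnorm_on :: "'h::chilbert set \<Rightarrow> ('h \<Rightarrow> 'h) \<Rightarrow> real" where
  "opnorm_on S T = Sup ((\<lambda>x. norm (T x)) ` (S \<inter> cball 0 1))"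

definition c0sum :: "('i \<Rightarrow> 'h::chilbert set) \<Rightarrow> ('i \<Rightarrow> 'h \<Rightarrow> 'h) set" where
  "c0sum H = {a. (\<forall>l. compact_op_on (H l) (a l)) \<and>
                 ((\<lambda>l. opnorm_on (H l) (a l)) \<longlongrightarrow> 0) cofinite}"

definition c0norm :: "('i \<Rightarrow> 'h::chilbert set) \<Rightarrow> ('i \<Rightarrow> 'h \<Rightarrow> 'h) \<Rightarrow> real" where
  "c0norm H a = (SUP l. opnorm_on (H l) (a l))"

definition c0mult :: "('i \<Rightarrow> 'h \<Rightarrow> 'h) \<Rightarrow> ('i \<Rightarrow> 'h \<Rightarrow> 'h) \<Rightarrow> ('i \<Rightarrow> 'h \<Rightarrow> 'h)" where
  "c0mult a b = (\<lambda>l. a l \<circ> b l)"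

definition c0scale :: "complex \<Rightarrow> ('i \<Rightarrow> 'h::cvector \<Rightarrow> 'h) \<Rightarrow> ('i \<Rightarrow> 'h \<Rightarrow> 'h)" where
  "c0scale z a = (\<lambda>l x. scaleC z (a l x))"

definition c0linear :: "('i \<Rightarrow> 'h::chilbert set) \<Rightarrow> (('i \<Rightarrow> 'h \<Rightarrow> 'h) \<Rightarrow> 'b::cvector) \<Rightarrow> bool" where
  "c0linear H f \<longleftrightarrow> (\<forall>a\<in>c0sum H. \<forall>b\<in>c0sum H. f (\<lambda>l x. a l x + b l x) = f a + f b) \<and>
                     (\<forall>z. \<forall>a\<in>c0sum H. f (c0scale z a) = scaleC z (f a))"

definition c0bounded :: "('i \<Rightarrow> 'h::chilbert set) \<Rightarrow> (('i \<Rightarrow> 'h \<Rightarrow> 'h) \<Rightarrow> 'b::cnormed_vector) \<Rightarrow> bool" where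
  "c0bounded H f \<longleftrightarrow> (\<exists>K. \<forall>a\<in>c0sum H. norm (f a) \<le> K * c0norm H a)"

definition has_product_property_at ::
  "('i \<Rightarrow> 'h::chilbert set) \<Rightarrow> (('i \<Rightarrow> 'h \<Rightarrow> 'h) \<Rightarrow> 'b::cnormed_algebra) \<Rightarrow> ('i \<Rightarrow> 'h \<Rightarrow> 'h) \<Rightarrow> bool" where
  "has_product_property_at H \<phi> c \<longleftrightarrow>
     (\<exists>T. c0linear H T \<and>
        (\<forall>a\<in>c0sum H. \<forall>b\<in>c0sum H. c0mult a b = c \<longrightarrow> \<phi> a * \<phi> b = T (c0mult a b)))"

definition cdual :: "('b::cnormed_vector \<Rightarrow> complex) set" where
  "cdual = {f. (\<forall>x y. f (x + y) = f x + f y) \<and> (\<forall>a x. f (scaleC a x) = a * f x) \<and>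
               (\<exists>K. \<forall>x. cmod (f x) \<le> K * norm x)}"

definition dual_norm :: "('b::cnormed_vector \<Rightarrow> complex) \<Rightarrow> real" where
  "dual_norm f = (SUP x\<in>cball 0 1. cmod (f x))"

definition cbidual :: "(('b::cnormed_vector \<Rightarrow> complex) \<Rightarrow> complex) set" where
  "cbidual = {F. (\<forall>f\<in>cdual. \<forall>g\<in>cdual. F (\<lambda>x. f x + g x) = F f + F g) \<and>
                 (\<forall>a. \<forall>f\<in>cdual. F (\<lambda>x. a * f x) = a * F f) \<and>
                 (\<exists>K. \<forall>f\<in>cdual. cmod (F f) \<le> K * dual_norm f) \<and>
                 (\<forall>f. f \<notin> cdual \<longrightarrow> F f = 0)}"

definition bembed :: "'b::cnormed_vector \<Rightarrow> (('b \<Rightarrow> complex) \<Rightarrow> complex)" where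
  "bembed b = (\<lambda>f. if f \<in> cdual then f b else 0)"

text \<open>(First) Arens product on \<open>B**\<close>: \<open>(f\<cdot>a)(b) = f(ab)\<close>, \<open>(F\<cdot>f)(a) = F(f\<cdot>a)\<close>,
  \<open>(G\<box>F)(f) = G(F\<cdot>f)\<close>.\<close>
definition arens_mult ::
  "(('b::cnormed_algebra \<Rightarrow> complex) \<Rightarrow> complex) \<Rightarrow> (('b \<Rightarrow> complex) \<Rightarrow> complex) \<Rightarrow> (('b \<Rightarrow> complex) \<Rightarrow> complex)" where
  "arens_mult G F = (\<lambda>f. if f \<in> cdual then G (\<lambda>a. F (\<lambda>b. f (a * b))) else 0)"

definition multiplier_algebra :: "(('b::cnormed_algebra \<Rightarrow> complex) \<Rightarrow> complex) set" where
  "multiplier_algebra = {x \<in> cbidual. \<forall>b. arens_mult x (bembed b) \<in> range bembed \<and>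
                                          arens_mult (bembed b) x \<in> range bembed}"

definition center_multiplier_algebra :: "(('b::cnormed_algebra \<Rightarrow> complex) \<Rightarrow> complex) set" where
  "center_multiplier_algebra = {h \<in> multiplier_algebra. \<forall>m\<in>multiplier_algebra. arens_mult h m = arens_mult m h}"

end

theory Submission
  imports Defs
begin

text \<open>
  Write \<open>E (l, u, y)\<close> for the rank one operator \<open>x \<mapsto> \<langle>y, x\<rangle> u\<close> in block \<open>l\<close>. Because of the rank condition, every
  compact \<open>c\<close> factors as \<open>c = a b\<close> through any orthonormal system of the right size, so for given \<open>y, z\<close> one can achieve
  \<open>a z = 0\<close> and \<open>b x \<bottom> y\<close>. If \<open>y \<bottom> z\<close>, or if \<open>y\<close> and \<open>z\<close> lie in different blocks, then
  \<open>(a + s E (l, u, y)) (b + t E (l', z, w)) = c\<close> for all scalars \<open>s, t\<close>, and comparing coefficients gives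
  \<open>\<phi> (E (l, u, y)) \<phi> (E (l', z, w)) = 0\<close>. Finite sums of such operators are dense, also inside pairs with zero product.

  If \<open>\<phi>\<close> is bijective onto a C*-algebra, vanishing on orthogonal vectors and faithfulness force
  \<open>\<phi> (E (l, u, y)) \<phi> (E (l, u', y')) = \<mu> l \<langle>y, u'\<rangle> \<phi> (E (l, u, y'))\<close>, hence \<open>\<phi> a \<phi> b = \<phi> (\<mu> a b)\<close>. Two sliding hump
  arguments, the second using the C*-identity, bound \<open>\<mu>\<close> away from zero, so \<open>\<rho> a = \<phi> (\<mu>\<inverse> a)\<close> is an isomorphism. The
  element \<open>h\<close> is a weak-* cluster point of \<open>\<phi> p\<close> along an approximate unit of projections \<open>p\<close>; it is central because
  every functional on the range is approximated in norm by functionals \<open>x \<mapsto> f (b x)\<close>.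
\<close>

subsection \<open>Complex inner product spaces\<close>

text \<open>Factors chosen separately in each block must again form elements of \<open>A\<close>, so
  the factorization needs norms: both factors are bounded by a constant times the square root of the
  norm of \<open>c\<close> in that block. It runs along a Gram-Schmidt sequence of the range instead
  of singular vectors, and its weights are square roots of the norms of the remainders, which
  decrease to zero by compactness. The two spare dimensions pay for orthogonality to
  \<open>y\<close> and to \<open>z\<close> and for nothing else, which is why the auxiliary system
  copies the zero pattern of the Gram-Schmidt sequence.

  The lower bound on \<mu> is used twice: it keeps division by \<mu> inside \<open>A\<close>, and it
  yields an explicit inverse estimate for \<open>\<phi>\<close>, through which approximation of
  functionals passes from \<open>A\<close> to its range. Centrality of \<open>h\<close> needs such
  an approximation because the two orders of an Arens product evaluate \<open>h\<close> and another
  multiplier in different orders, which agree at once only on functionals of the form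
  \<open>x \<mapsto> f (b * x)\<close>.\<close>

lemma scaleC_zero_left [simp]: "scaleC 0 (x::'a::cvector) = 0"
  using scaleC_add_left[of 0 0 x] by simp

lemma scaleC_zero_right [simp]: "scaleC a (0::'a::cvector) = 0"
  using scaleC_add_right[of a "0::'a" 0] by simp

declare scaleC_one [simp] scaleC_scaleC [simp]

lemma scaleC_minus_one: "scaleC (-1) (x::'a::cvector) = - x"
  using scaleR_scaleC[of "-1" x] by simp

lemma scaleC_minus_left: "scaleC (- a) (x::'a::cvector) = - scaleC a x"
  using scaleC_scaleC[of "-1" a x] by (simp add: scaleC_minus_one del: scaleC_scaleC)

lemma scaleC_minus_right: "scaleC a (- x) = - scaleC a (x::'a::cvector)"
  using scaleC_scaleC[of a "-1" x] by (simp add: scaleC_minus_one scaleC_minus_left del: scaleC_scaleC)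

lemma scaleC_diff_right: "scaleC a (x - y) = scaleC a x - scaleC a (y::'a::cvector)"
  using scaleC_add_right[of a x "- y"] by (simp add: scaleC_minus_right)

lemma scaleC_diff_left: "scaleC (a - b) x = scaleC a x - scaleC b (x::'a::cvector)"
  using scaleC_add_left[of a "- b" x] by (simp add: scaleC_minus_left)

lemma scaleC_sum_right: "scaleC a (\<Sum>i\<in>I. f i) = (\<Sum>i\<in>I. scaleC a (f i :: 'a::cvector))"
  by (induction I rule: infinite_finite_induct) (auto simp: scaleC_add_right)

lemma scaleC_eq_0_iff: "scaleC a (x::'a::cvector) = 0 \<longleftrightarrow> a = 0 \<or> x = 0"
proof (cases "a = 0")
  case False
  then show ?thesis
    using scaleC_scaleC[of "inverse a" a x] by (auto simp del: scaleC_scaleC)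
qed auto

lemma bounded_linear_scaleC_left: "bounded_linear (\<lambda>z. scaleC z (x::'a::cnormed_vector))"
proof (rule bounded_linear_intro)
  show "scaleC (r *\<^sub>R z) x = r *\<^sub>R scaleC z x" for r z
    by (simp add: scaleR_scaleC[of _ "scaleC z x"] scaleR_conv_of_real)
  show "norm (scaleC z x) \<le> norm z * norm x" for z
    by (simp add: norm_scaleC)
qed (simp add: scaleC_add_left)

lemma bounded_linear_scaleC_right: "bounded_linear (\<lambda>x::'a::cnormed_vector. scaleC z x)"
proof (rule bounded_linear_intro)
  show "scaleC z (r *\<^sub>R x) = r *\<^sub>R scaleC z x" for r and x :: 'a
    by (simp add: scaleR_scaleC mult.commute)
  show "norm (scaleC z x) \<le> norm x * cmod z" for x :: 'a
    by (simp add: norm_scaleC)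
qed (simp add: scaleC_add_right)

lemma cinner_add_left: "cinner (x + y) z = cinner x z + cinner (y::'a::cinner_space) z"
  using cinner_cnj_commute[of "x+y" z] cinner_cnj_commute[of x z] cinner_cnj_commute[of y z]
  by (simp add: cinner_add_right)

lemma cinner_scaleC_left: "cinner (scaleC a x) y = cnj a * cinner (x::'a::cinner_space) y"
  using cinner_cnj_commute[of "scaleC a x" y] cinner_cnj_commute[of x y]
  by (simp add: cinner_scaleC_right)

lemma cinner_zero_right [simp]: "cinner (x::'a::cinner_space) 0 = 0"
  using cinner_add_right[of x 0 0] by simp

lemma cinner_zero_left [simp]: "cinner 0 (x::'a::cinner_space) = 0"
  using cinner_add_left[of 0 0 x] by simp

lemma cinner_minus_right: "cinner x (- y) = - cinner (x::'a::cinner_space) y"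
  using cinner_add_right[of x y "- y"] by (simp add: eq_neg_iff_add_eq_0 add.commute)

lemma cinner_minus_left: "cinner (- x) y = - cinner (x::'a::cinner_space) y"
  using cinner_add_left[of x "- x" y] by (simp add: eq_neg_iff_add_eq_0 add.commute)

lemma cinner_diff_right: "cinner x (y - z) = cinner x y - cinner (x::'a::cinner_space) z"
  using cinner_add_right[of x y "- z"] by (simp add: cinner_minus_right)

lemma cinner_diff_left: "cinner (x - y) z = cinner x z - cinner (y::'a::cinner_space) z"
  using cinner_add_left[of x "- y" z] by (simp add: cinner_minus_left)

lemma cinner_sum_right: "cinner x (\<Sum>i\<in>I. f i) = (\<Sum>i\<in>I. cinner (x::'a::cinner_space) (f i))"
  by (induction I rule: infinite_finite_induct) (auto simp: cinner_add_right)

lemma cinner_self: "cinner x x = of_real ((norm (x::'a::cinner_space))\<^sup>2)"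
proof -
  have "Im (cinner x x) = 0"
    using arg_cong[OF cinner_cnj_commute[of x x], of Im] by simp
  moreover have "(norm x)\<^sup>2 = Re (cinner x x)"
    by (simp add: cinner_norm cinner_nonneg)
  ultimately show ?thesis
    by (simp add: complex_eq_iff)
qed

lemma cinner_swap_eq_0: "cinner x y = 0 \<longleftrightarrow> cinner y (x::'a::cinner_space) = 0"
  using cinner_cnj_commute[of x y] by auto

lemma norm_add_sq_orthogonal:
  assumes "cinner x (y::'a::cinner_space) = 0"
  shows "(norm (x + y))\<^sup>2 = (norm x)\<^sup>2 + (norm y)\<^sup>2"
proof -
  have "complex_of_real ((norm (x + y))\<^sup>2) = of_real ((norm x)\<^sup>2 + (norm y)\<^sup>2)"
    using assms cinner_swap_eq_0[of x y]
    by (simp only: of_real_add flip: cinner_self) (simp add: cinner_add_left cinner_add_right)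
  then show ?thesis
    by (simp only: of_real_eq_iff)
qed

lemma cauchy_schwarz: "cmod (cinner x y) \<le> norm x * norm (y::'a::cinner_space)"
proof (cases "x = 0")
  case False
  define u where "u = scaleC (cinner x y / of_real ((norm x)\<^sup>2)) x"
  have "cinner x (y - u) = 0"
    using False by (simp add: u_def cinner_diff_right cinner_scaleC_right cinner_self)
  then have "cinner u (y - u) = 0"
    by (subst u_def) (simp add: cinner_scaleC_left)
  then have "(norm u)\<^sup>2 + (norm (y - u))\<^sup>2 = (norm y)\<^sup>2"
    using norm_add_sq_orthogonal[of u "y - u"] by simp
  then have "(norm u)\<^sup>2 \<le> (norm y)\<^sup>2"
    using zero_le_power2[of "norm (y - u)"] by linarith
  then have "norm u \<le> norm y"
    by (rule power2_le_imp_le) simp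
  moreover have "norm u * norm x = cmod (cinner x y)"
    using False by (simp add: u_def norm_scaleC norm_divide power2_eq_square norm_mult)
  ultimately show ?thesis
    using mult_right_mono[of "norm u" "norm y" "norm x"] by (simp add: mult.commute)
qed auto

lemma bounded_linear_cinner_right: "bounded_linear (\<lambda>y. cinner (x::'a::cinner_space) y)"
proof (rule bounded_linear_intro)
  show "cinner x (r *\<^sub>R y) = r *\<^sub>R cinner x y" for r y
    by (simp add: scaleR_scaleC cinner_scaleC_right scaleR_conv_of_real)
  show "norm (cinner x y) \<le> norm y * norm x" for y
    using cauchy_schwarz[of x y] by (simp add: mult.commute)
qed (simp add: cinner_add_right)

lemma csubspaceD:
  assumes "csubspace S"
  shows "0 \<in> S" "\<And>x y. x \<in> S \<Longrightarrow> y \<in> S \<Longrightarrow> x + y \<in> S" "\<And>a x. x \<in> S \<Longrightarrow> scaleC a x \<in> S"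
    "\<And>x y. x \<in> S \<Longrightarrow> y \<in> S \<Longrightarrow> x - y \<in> S" "\<And>r x. x \<in> S \<Longrightarrow> r *\<^sub>R x \<in> S"
    "\<And>I f. (\<And>i. i \<in> I \<Longrightarrow> f i \<in> S) \<Longrightarrow> sum f I \<in> S"
proof -
  show 0: "0 \<in> S" and add: "\<And>x y. x \<in> S \<Longrightarrow> y \<in> S \<Longrightarrow> x + y \<in> S" 
    and sc: "\<And>a x. x \<in> S \<Longrightarrow> scaleC a x \<in> S"
    using assms by (auto simp: csubspace_def)
  show "\<And>x y. x \<in> S \<Longrightarrow> y \<in> S \<Longrightarrow> x - y \<in> S"
    using add sc[of _ "-1"] by (metis add_uminus_conv_diff scaleC_minus_one)
  show "\<And>r x. x \<in> S \<Longrightarrow> r *\<^sub>R x \<in> S"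
    using sc by (simp add: scaleR_scaleC)
  show "sum f I \<in> S" if "\<And>i. i \<in> I \<Longrightarrow> f i \<in> S" for I and f :: "'i \<Rightarrow> 'a"
    using that by (induction I rule: infinite_finite_induct) (auto intro: 0 add)
qed

text \<open>Zero vectors are admitted, so that finite and infinite systems need not be distinguished
  and Gram-Schmidt never has to skip a step.\<close>
definition weak_orthonormal :: "(nat \<Rightarrow> 'a::cinner_space) \<Rightarrow> bool" where
  "weak_orthonormal e \<longleftrightarrow> (\<forall>j k. j \<noteq> k \<longrightarrow> cinner (e j) (e k) = 0) \<and> (\<forall>k. norm (e k) = 0 \<or> norm (e k) = 1)"

section \<open>Partial sums of orthogonal expansions and their remainders\<close>

definition partial_proj :: "(nat \<Rightarrow> 'a::cinner_space) \<Rightarrow> nat \<Rightarrow> 'a \<Rightarrow> 'a" where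
  "partial_proj e n x = (\<Sum>k<n. scaleC (cinner (e k) x) (e k))"

lemma partial_proj_Suc: "partial_proj e (Suc n) x = partial_proj e n x + scaleC (cinner (e n) x) (e n)"
  by (simp add: partial_proj_def)

lemma partial_proj_0 [simp]: "partial_proj e 0 x = 0"
  by (simp add: partial_proj_def)

lemma partial_proj_add: "partial_proj e n (x + y) = partial_proj e n x + partial_proj e n y"
  by (simp add: partial_proj_def cinner_add_right scaleC_add_left sum.distrib)

lemma partial_proj_diff: "partial_proj e n (x - y) = partial_proj e n x - partial_proj e n y"
  by (simp add: partial_proj_def cinner_diff_right scaleC_diff_left sum_subtractf)

lemma partial_proj_scaleC: "partial_proj e n (scaleC a x) = scaleC a (partial_proj e n x)"
  by (simp add: partial_proj_def cinner_scaleC_right scaleC_sum_right)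

lemma partial_proj_mem: "csubspace S \<Longrightarrow> (\<And>k. e k \<in> S) \<Longrightarrow> partial_proj e n x \<in> S"
  by (simp add: partial_proj_def csubspaceD)

lemma weak_orthonormal_cinner_scale:
  assumes "weak_orthonormal e"
  shows "cinner (e j) (scaleC a (e k)) = (if j = k then (if e k = 0 then 0 else a) else 0)"
  using assms unfolding weak_orthonormal_def by (auto simp: cinner_scaleC_right cinner_self)

lemma weak_orthonormal_cinner_sum:
  assumes "weak_orthonormal e" "finite I"
  shows "cinner (e j) (\<Sum>k\<in>I. scaleC (a k) (e k)) = (if j \<in> I \<and> e j \<noteq> 0 then a j else 0)"
proof -
  have "cinner (e j) (\<Sum>k\<in>I. scaleC (a k) (e k)) = (\<Sum>k\<in>I. if j = k then (if e k = 0 then 0 else a k) else 0)"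
    by (simp add: cinner_sum_right weak_orthonormal_cinner_scale[OF assms(1)])
  also have "\<dots> = (if j \<in> I \<and> e j \<noteq> 0 then a j else 0)"
    using assms(2) by (subst sum.delta') auto
  finally show ?thesis .
qed

lemma norm_weak_orthonormal_sum:
  assumes "weak_orthonormal e" "finite I"
  shows "(norm (\<Sum>k\<in>I. scaleC (a k) (e k)))\<^sup>2 \<le> (\<Sum>k\<in>I. (cmod (a k))\<^sup>2)"
  using assms(2)
proof (induction I rule: finite_induct)
  case (insert j I)
  have "cinner (scaleC (a j) (e j)) (\<Sum>k\<in>I. scaleC (a k) (e k)) = 0"
    using insert.hyps by (simp add: cinner_scaleC_left weak_orthonormal_cinner_sum[OF assms(1)])
  moreover have "norm (e j) \<le> 1"
    using assms(1) by (auto simp: weak_orthonormal_def dest: spec[of _ j])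
  then have "(norm (scaleC (a j) (e j)))\<^sup>2 \<le> (cmod (a j))\<^sup>2"
    by (auto simp: norm_scaleC intro!: power_mono mult_left_le)
  ultimately show ?case
    using insert by (simp add: norm_add_sq_orthogonal add_mono del: abs_le_square_iff power2_le_iff_abs_le)
qed auto

text \<open>Each step removes the component along \<open>e n\<close>, which is orthogonal to the new
  remainder, so Pythagoras subtracts one squared coefficient at a time. Bessel's inequality, the
  monotonicity of remainders and the coefficient formula of the factorization are read off from this
  identity.\<close>

lemma norm_minus_partial_proj:
  assumes "weak_orthonormal e"
  shows "(norm (x - partial_proj e n x))\<^sup>2 = (norm x)\<^sup>2 - (\<Sum>k<n. (cmod (cinner (e k) x))\<^sup>2)"
proof (induction n)
  case (Suc n)
  let ?r = "x - partial_proj e (Suc n) x" and ?s = "scaleC (cinner (e n) x) (e n)"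
  have "cinner (e n) ?r = 0"
    using weak_orthonormal_cinner_sum[OF assms, of "{..<Suc n}" n "\<lambda>k. cinner (e k) x"]
    by (auto simp: cinner_diff_right partial_proj_def)
  then have "cinner ?s ?r = 0"
    by (simp add: cinner_scaleC_left)
  then have "(norm (?s + ?r))\<^sup>2 = (norm ?s)\<^sup>2 + (norm ?r)\<^sup>2"
    by (rule norm_add_sq_orthogonal)
  \<comment> \<open>For \<open>e n = 0\<close> both sides are 0, so zero vectors do no harm
    here.\<close>
  moreover have "norm ?s = cmod (cinner (e n) x)"
  proof (cases "e n = 0")
    case False
    then show ?thesis using assms by (auto simp: norm_scaleC weak_orthonormal_def)
  qed simp
  moreover have "?s + ?r = x - partial_proj e n x"
    by (simp add: partial_proj_Suc)
  ultimately show ?case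
    using Suc by simp
qed simp

lemma bessel:
  assumes "weak_orthonormal e"
  shows "(\<Sum>k<n. (cmod (cinner (e k) x))\<^sup>2) \<le> (norm x)\<^sup>2"
  using norm_minus_partial_proj[OF assms, of x n] by (metis diff_ge_0_iff_ge zero_le_power2)

lemma norm_minus_partial_proj_le:
  assumes "weak_orthonormal e"
  shows "norm (x - partial_proj e n x) \<le> norm x"
proof (rule power2_le_imp_le)
  show "(norm (x - partial_proj e n x))\<^sup>2 \<le> (norm x)\<^sup>2"
    using norm_minus_partial_proj[OF assms, of x n] by (simp add: sum_nonneg del: abs_le_square_iff)
qed simp

lemma norm_minus_partial_proj_antimono:
  assumes "weak_orthonormal e" "m \<le> n"
  shows "norm (x - partial_proj e n x) \<le> norm (x - partial_proj e m x)"
proof -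
  have "(\<Sum>k<m. (cmod (cinner (e k) x))\<^sup>2) \<le> (\<Sum>k<n. (cmod (cinner (e k) x))\<^sup>2)"
    using assms(2) by (intro sum_mono2) auto
  then have "(norm (x - partial_proj e n x))\<^sup>2 \<le> (norm (x - partial_proj e m x))\<^sup>2"
    using norm_minus_partial_proj[OF assms(1), of x n] norm_minus_partial_proj[OF assms(1), of x m]
    by linarith
  then show ?thesis
    by (rule power2_le_imp_le) simp
qed

lemma cinner_partial_proj_orthogonal:
  assumes "weak_orthonormal e"
  shows "cinner (partial_proj e n x) (y - partial_proj e n y) = 0"
proof -
  have "cinner (y - partial_proj e n y) (e k) = 0" if "k < n" for k
    using weak_orthonormal_cinner_sum[OF assms, of "{..<n}" k "\<lambda>k. cinner (e k) y"] that
    by (subst cinner_swap_eq_0) (auto simp: cinner_diff_right partial_proj_def)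
  then have "cinner (y - partial_proj e n y) (partial_proj e n x) = 0"
    by (simp add: partial_proj_def[of e n x] cinner_sum_right cinner_scaleC_right)
  then show ?thesis
    by (subst cinner_swap_eq_0)
qed

lemma norm_partial_proj_le:
  assumes "weak_orthonormal e"
  shows "norm (partial_proj e n x) \<le> norm x"
proof -
  have "(norm x)\<^sup>2 = (norm (partial_proj e n x))\<^sup>2 + (norm (x - partial_proj e n x))\<^sup>2"
    using norm_add_sq_orthogonal[OF cinner_partial_proj_orthogonal[OF assms, of n x x]] by simp
  then have "(norm (partial_proj e n x))\<^sup>2 \<le> (norm x)\<^sup>2"
    by (metis le_add_same_cancel1 zero_le_power2)
  then show ?thesis
    by (rule power2_le_imp_le) simp
qed

text \<open>Since \<open>sgn 0 = 0\<close>, a vector that depends linearly on its predecessors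
  produces the zero vector and keeps its index.\<close>

fun gram_schmidt :: "(nat \<Rightarrow> 'a::cinner_space) \<Rightarrow> nat \<Rightarrow> 'a" where
  "gram_schmidt x n = sgn (x n - (\<Sum>k<n. scaleC (cinner (gram_schmidt x k) (x n)) (gram_schmidt x k)))"

declare gram_schmidt.simps [simp del]

lemma gram_schmidt_eq: "gram_schmidt x n = sgn (x n - partial_proj (gram_schmidt x) n (x n))"
  by (subst gram_schmidt.simps) (simp add: partial_proj_def)

lemma gram_schmidt_mem:
  assumes "csubspace S" "\<And>k. x k \<in> S"
  shows "gram_schmidt x n \<in> S"
proof (induction n rule: less_induct)
  case (less n)
  then show ?case
    unfolding gram_schmidt.simps[of x n] sgn_div_norm
    by (intro csubspaceD[OF assms(1)] assms(2)) auto
qed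

lemma norm_gram_schmidt: "norm (gram_schmidt x n) = 0 \<or> norm (gram_schmidt x n) = 1"
  by (simp add: gram_schmidt_eq[of x n] norm_sgn)

lemma gram_schmidt_orthogonal_less:
  "j < n \<Longrightarrow> cinner (gram_schmidt x j) (gram_schmidt x n) = 0"
proof (induction n arbitrary: j rule: less_induct)
  case (less n)
  let ?e = "gram_schmidt x"
  have orth: "cinner (?e j) (?e k) = 0" if "j \<noteq> k" "j < n" "k < n" for j k
    using less.IH[of j k] less.IH[of k j] that by (meson cinner_swap_eq_0 linorder_neqE_nat)
  have "cinner (?e j) (partial_proj ?e n (x n)) = (\<Sum>k<n. cinner (?e k) (x n) * cinner (?e j) (?e k))"
    by (simp add: partial_proj_def cinner_sum_right cinner_scaleC_right)
  also have "\<dots> = (\<Sum>k<n. if j = k then cinner (?e k) (x n) * cinner (?e k) (?e k) else 0)"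
    using orth less.prems by (intro sum.cong) auto
  also have "\<dots> = cinner (?e j) (x n) * cinner (?e j) (?e j)"
    using less.prems by simp
  also have "\<dots> = cinner (?e j) (x n)"
    using norm_gram_schmidt[of x j] by (auto simp: cinner_self)
  finally have "cinner (?e j) (x n - partial_proj ?e n (x n)) = 0"
    by (simp add: cinner_diff_right)
  then show ?case
    by (subst gram_schmidt_eq[of x n]) (simp add: sgn_div_norm scaleR_scaleC cinner_scaleC_right)
qed

lemma weak_orthonormal_gram_schmidt: "weak_orthonormal (gram_schmidt x)"
  unfolding weak_orthonormal_def
  using norm_gram_schmidt gram_schmidt_orthogonal_less cinner_swap_eq_0 by (metis linorder_neqE_nat)

text \<open>The remainder of \<open>x k\<close> after \<open>k\<close> steps is a nonnegative
  multiple of \<open>gram_schmidt x k\<close>, so one more step makes it vanish; later steps cannot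
  enlarge a remainder.\<close>

lemma partial_proj_gram_schmidt:
  assumes "k < n"
  shows "partial_proj (gram_schmidt x) n (x k) = x k"
proof -
  let ?e = "gram_schmidt x"
  note wo = weak_orthonormal_gram_schmidt[of x]
  define r where "r = x k - partial_proj ?e k (x k)"
  have r: "r = scaleC (of_real (norm r)) (?e k)"
    by (cases "r = 0") (simp_all add: gram_schmidt_eq[of x k] r_def[symmetric] sgn_div_norm scaleR_scaleC[symmetric])
  have "cinner (?e k) (partial_proj ?e k (x k)) = 0"
    using weak_orthonormal_cinner_sum[OF wo, of "{..<k}" k] by (simp add: partial_proj_def)
  then have "cinner (?e k) (x k) = cinner (?e k) r"
    by (simp add: r_def cinner_diff_right)
  also have "\<dots> = (if ?e k = 0 then 0 else of_real (norm r))"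
    by (subst r) (simp add: weak_orthonormal_cinner_scale[OF wo])
  finally have "scaleC (cinner (?e k) (x k)) (?e k) = r"
    using r by (cases "?e k = 0") auto
  then have "x k - partial_proj ?e (Suc k) (x k) = 0"
    by (simp add: partial_proj_Suc r_def)
  then show ?thesis
    using norm_minus_partial_proj_antimono[OF wo, of "Suc k" n "x k"] assms by simp
qed

subsection \<open>Compact operators\<close>

lemma clinear_onD:
  assumes "csubspace S" "clinear_on S T"
  shows "T 0 = 0" "\<And>x y. x \<in> S \<Longrightarrow> y \<in> S \<Longrightarrow> T (x + y) = T x + T y"
    "\<And>x y. x \<in> S \<Longrightarrow> y \<in> S \<Longrightarrow> T (x - y) = T x - T y"
    "\<And>a x. x \<in> S \<Longrightarrow> T (scaleC a x) = scaleC a (T x)"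
    "\<And>r x. x \<in> S \<Longrightarrow> T (r *\<^sub>R x) = r *\<^sub>R T x"
    "\<And>I f. (\<And>i. i \<in> I \<Longrightarrow> f i \<in> S) \<Longrightarrow> T (sum f I) = (\<Sum>i\<in>I. T (f i))"
proof -
  note S = csubspaceD[OF assms(1)]
  show add: "\<And>x y. x \<in> S \<Longrightarrow> y \<in> S \<Longrightarrow> T (x + y) = T x + T y"
    and sc: "\<And>a x. x \<in> S \<Longrightarrow> T (scaleC a x) = scaleC a (T x)"
    using assms(2) by (auto simp: clinear_on_def)
  show 0: "T 0 = 0"
    using sc[of 0 0] S(1) by simp
  show "T (x - y) = T x - T y" if "x \<in> S" "y \<in> S" for x y
    using add[of "x - y" y] S(4) that by (simp add: eq_diff_eq)
  show "\<And>r x. x \<in> S \<Longrightarrow> T (r *\<^sub>R x) = r *\<^sub>R T x"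
    using sc by (simp add: scaleR_scaleC)
  show "T (sum f I) = (\<Sum>i\<in>I. T (f i))" if "\<And>i. i \<in> I \<Longrightarrow> f i \<in> S" for I and f :: "'i \<Rightarrow> 'a"
    using that
  proof (induction I rule: infinite_finite_induct)
    case (insert i I)
    then show ?case by (simp add: add S(6))
  qed (auto simp: 0)
qed

text \<open>The centres lie in \<open>A\<close> itself, so that for an image of the unit ball they
  can be lifted to arguments. In the converse direction the half radius makes room for closed balls,
  whose finite union is closed and hence contains the closure.\<close>

lemma compact_closure_iff_totally_bounded:
  fixes A :: "'a::complete_space set"
  shows "compact (closure A) \<longleftrightarrow> (\<forall>\<epsilon>>0. \<exists>F. finite F \<and> F \<subseteq> A \<and> A \<subseteq> (\<Union>x\<in>F. ball x \<epsilon>))"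
proof (intro iffI allI impI)
  fix \<epsilon> :: real
  assume "compact (closure A)" and "0 < \<epsilon>"
  note this(1)
  moreover have "closure A \<subseteq> (\<Union>x\<in>A. ball x \<epsilon>)"
    using \<open>0 < \<epsilon>\<close> by (auto simp: closure_approachable)
  ultimately obtain F where "F \<subseteq> A" "finite F" "closure A \<subseteq> (\<Union>x\<in>F. ball x \<epsilon>)"
    using compactE_image[of "closure A" A "\<lambda>x. ball x \<epsilon>"] by (metis open_ball)
  then show "\<exists>F. finite F \<and> F \<subseteq> A \<and> A \<subseteq> (\<Union>x\<in>F. ball x \<epsilon>)"
    using closure_subset[of A] by blast
next
  assume tb: "\<forall>\<epsilon>>0. \<exists>F. finite F \<and> F \<subseteq> A \<and> A \<subseteq> (\<Union>x\<in>F. ball x \<epsilon>)"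
  have "\<exists>F. finite F \<and> closure A \<subseteq> (\<Union>x\<in>F. ball x \<epsilon>)" if "\<epsilon> > 0" for \<epsilon>
  proof -
    obtain F where F: "finite F" "A \<subseteq> (\<Union>x\<in>F. ball x (\<epsilon>/2))"
      using tb[rule_format, of "\<epsilon>/2"] \<open>\<epsilon> > 0\<close> half_gt_zero by blast
    have "A \<subseteq> (\<Union>x\<in>F. cball x (\<epsilon>/2))"
      using F(2) ball_subset_cball by blast
    then have "closure A \<subseteq> (\<Union>x\<in>F. cball x (\<epsilon>/2))"
      using F(1) by (intro closure_minimal) auto
    also have "\<dots> \<subseteq> (\<Union>x\<in>F. ball x \<epsilon>)"
      using cball_subset_ball_iff[of _ "\<epsilon>/2" _ \<epsilon>] \<open>\<epsilon> > 0\<close> by (intro UN_mono) (auto simp: dist_norm)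
    finally show ?thesis
      using F(1) by blast
  qed
  then show "compact (closure A)"
    by (simp add: compact_eq_totally_bounded complete_eq_closed)
qed

text \<open>With a finite net of arguments instead of values, compactness is expressed by norms of
  differences of values, a form that survives composition with a bounded map and uniform
  limits.\<close>

lemma compact_op_on_altdef:
  "compact_op_on S T \<longleftrightarrow> T ` S \<subseteq> S \<and> clinear_on S T \<and> (\<forall>x. x \<notin> S \<longrightarrow> T x = 0) \<and>
    (\<forall>\<epsilon>>0. \<exists>F. finite F \<and> F \<subseteq> S \<inter> cball 0 1 \<and> (\<forall>x\<in>S \<inter> cball 0 1. \<exists>y\<in>F. norm (T x - T y) < \<epsilon>))"
proof -
  have "(\<exists>F. finite F \<and> F \<subseteq> T ` (S \<inter> cball 0 1) \<and> T ` (S \<inter> cball 0 1) \<subseteq> (\<Union>x\<in>F. ball x \<epsilon>)) \<longleftrightarrow>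
    (\<exists>F. finite F \<and> F \<subseteq> S \<inter> cball 0 1 \<and> (\<forall>x\<in>S \<inter> cball 0 1. \<exists>y\<in>F. norm (T x - T y) < \<epsilon>))"
    (is "?L \<longleftrightarrow> ?R") for \<epsilon>
  proof
    assume ?L
    then obtain F where F: "finite F" "F \<subseteq> T ` (S \<inter> cball 0 1)" "T ` (S \<inter> cball 0 1) \<subseteq> (\<Union>x\<in>F. ball x \<epsilon>)"
      by blast
    obtain G where "G \<subseteq> S \<inter> cball 0 1" "finite G" "F = T ` G"
      using F(1,2) finite_subset_image by meson
    then show ?R
      using F(3) by (intro exI[of _ G]) (fastforce simp: dist_norm norm_minus_commute)
  next
    assume ?R
    then obtain F where "finite F" "F \<subseteq> S \<inter> cball 0 1" "\<forall>x\<in>S \<inter> cball 0 1. \<exists>y\<in>F. norm (T x - T y) < \<epsilon>"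
      by blast
    then show ?L
      by (intro exI[of _ "T ` F"]) (force simp: dist_norm norm_minus_commute)
  qed
  then show ?thesis
    by (simp add: compact_op_on_def compact_closure_iff_totally_bounded)
qed

lemma compact_op_onD:
  assumes "compact_op_on S T"
  shows "clinear_on S T" "\<And>x. x \<in> S \<Longrightarrow> T x \<in> S" "\<And>x. x \<notin> S \<Longrightarrow> T x = 0"
  using assms by (auto simp: compact_op_on_def)

lemma compact_op_on_net:
  assumes "compact_op_on S T" "\<epsilon> > 0"
  obtains F where "finite F" "F \<subseteq> S \<inter> cball 0 1"
    "\<And>x. x \<in> S \<inter> cball 0 1 \<Longrightarrow> \<exists>y\<in>F. norm (T x - T y) < \<epsilon>"
proof -
  have "\<exists>F. finite F \<and> F \<subseteq> S \<inter> cball 0 1 \<and> (\<forall>x\<in>S \<inter> cball 0 1. \<exists>y\<in>F. norm (T x - T y) < \<epsilon>)"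
    using assms unfolding compact_op_on_altdef by simp
  then show ?thesis
    by (elim exE conjE) (rule that, blast+)
qed

lemma compact_closure_subset:
  fixes A :: "'a::metric_space set"
  assumes "compact C" "A \<subseteq> C"
  shows "compact (closure A)"
proof -
  have "closure A \<subseteq> C"
    by (intro closure_minimal assms compact_imp_closed)
  then have "C \<inter> closure A = closure A"
    by blast
  then show ?thesis
    using compact_Int_closed[OF assms(1) closed_closure[of A]] by simp
qed

text \<open>An inequality rather than a supremum: it can be used for differences and compositions
  before their suprema are known to be finite.\<close>

definition bounded_by :: "'h::real_normed_vector set \<Rightarrow> ('h \<Rightarrow> 'k::real_normed_vector) \<Rightarrow> real \<Rightarrow> bool" where
  "bounded_by S T M \<longleftrightarrow> (\<forall>x\<in>S. norm (T x) \<le> M * norm x)"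

lemma bounded_byD: "bounded_by S T M \<Longrightarrow> x \<in> S \<Longrightarrow> norm (T x) \<le> M * norm x"
  by (simp add: bounded_by_def)

lemma bounded_by_mono: "bounded_by S T M \<Longrightarrow> M \<le> N \<Longrightarrow> bounded_by S T N"
  unfolding bounded_by_def by (meson mult_right_mono norm_ge_zero order_trans)

lemma bounded_by_add:
  "bounded_by S T M \<Longrightarrow> bounded_by S U N \<Longrightarrow> bounded_by S (\<lambda>x. T x + U x) (M + N)"
  unfolding bounded_by_def distrib_right by (meson add_mono norm_triangle_ineq order_trans)

lemma bounded_by_comp:
  "bounded_by S T M \<Longrightarrow> bounded_by S U N \<Longrightarrow> U ` S \<subseteq> S \<Longrightarrow> 0 \<le> M \<Longrightarrow> bounded_by S (T \<circ> U) (M * N)"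
  unfolding bounded_by_def
  by (auto simp: image_subset_iff) (metis mult.assoc mult_left_mono order_trans)

lemma bounded_by_unit_ball:
  assumes "csubspace S" "clinear_on S T" "\<And>x. x \<in> S \<Longrightarrow> norm x \<le> 1 \<Longrightarrow> norm (T x) \<le> M"
  shows "bounded_by S T M"
  unfolding bounded_by_def
proof
  fix x assume x: "x \<in> S"
  show "norm (T x) \<le> M * norm x"
  proof (cases "x = 0")
    case True
    then show ?thesis using clinear_onD(1)[OF assms(1,2)] by simp
  next
    case False
    have "norm (T ((1 / norm x) *\<^sub>R x)) \<le> M"
      using False x by (intro assms(3) csubspaceD[OF assms(1)]) auto
    then show ?thesis
      using False x by (simp add: clinear_onD[OF assms(1,2)] field_simps)
  qed
qed

lemma compact_op_on_bdd:
  assumes "compact_op_on S T"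
  shows "bdd_above ((\<lambda>x. norm (T x)) ` (S \<inter> cball 0 1))"
proof -
  have "bounded (T ` (S \<inter> cball 0 1))"
    using assms bounded_subset[OF compact_imp_bounded closure_subset] by (auto simp: compact_op_on_def)
  then show ?thesis
    by (auto simp: bounded_iff bdd_above_def)
qed

lemma bounded_by_opnorm:
  assumes "csubspace S" "compact_op_on S T"
  shows "bounded_by S T (opnorm_on S T)"
  unfolding opnorm_on_def
  by (rule bounded_by_unit_ball[OF assms(1) compact_op_onD(1)[OF assms(2)]])
    (rule cSup_upper[OF _ compact_op_on_bdd[OF assms(2)]], auto)

lemma opnorm_le:
  assumes "csubspace S" "bounded_by S T M" "0 \<le> M"
  shows "opnorm_on S T \<le> M"
  unfolding opnorm_on_def
proof (rule cSup_least)
  show "(\<lambda>x. norm (T x)) ` (S \<inter> cball 0 1) \<noteq> {}"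
    using csubspaceD(1)[OF assms(1)] by auto
  show "\<And>y. y \<in> (\<lambda>x. norm (T x)) ` (S \<inter> cball 0 1) \<Longrightarrow> y \<le> M"
    using bounded_byD[OF assms(2)] mult_left_le[OF _ assms(3)] by fastforce
qed

lemma opnorm_nonneg:
  assumes "csubspace S" "compact_op_on S T"
  shows "0 \<le> opnorm_on S T"
proof -
  have "norm (T 0) \<le> opnorm_on S T"
    unfolding opnorm_on_def
    by (intro cSup_upper compact_op_on_bdd assms) (use csubspaceD(1)[OF assms(1)] in auto)
  then show ?thesis
    by (meson norm_ge_zero order_trans)
qed

lemma compact_op_on_limit:
  assumes "T ` S \<subseteq> S" "clinear_on S T" "\<And>x. x \<notin> S \<Longrightarrow> T x = 0"
    and approx: "\<And>\<epsilon>. \<epsilon> > 0 \<Longrightarrow> \<exists>U. compact_op_on S U \<and> bounded_by S (\<lambda>x. T x - U x) \<epsilon>"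
  shows "compact_op_on S T"
  unfolding compact_op_on_altdef
proof (intro conjI allI impI)
  fix \<epsilon> :: real assume "\<epsilon> > 0"
  \<comment> \<open>One quarter for the net and two quarters for replacing \<open>T\<close> by
    \<open>U\<close> at both points leave a strict inequality.\<close>
  then obtain U where U: "compact_op_on S U" "bounded_by S (\<lambda>x. T x - U x) (\<epsilon>/4)"
    using approx[of "\<epsilon>/4"] by auto
  obtain F where F: "finite F" "F \<subseteq> S \<inter> cball 0 1"
      "\<And>x. x \<in> S \<inter> cball 0 1 \<Longrightarrow> \<exists>y\<in>F. norm (U x - U y) < \<epsilon>/4"
    using compact_op_on_net[OF U(1), of "\<epsilon>/4"] \<open>\<epsilon> > 0\<close> by auto
  have near: "norm (T x - U x) \<le> \<epsilon>/4" if "x \<in> S \<inter> cball 0 1" for x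
    using bounded_byD[OF U(2), of x] that \<open>\<epsilon> > 0\<close> mult_left_mono[of "norm x" 1 "\<epsilon>/4"]
    by (auto intro: order_trans)
  have "\<exists>y\<in>F. norm (T x - T y) < \<epsilon>" if x: "x \<in> S \<inter> cball 0 1" for x
  proof -
    obtain y where y: "y \<in> F" "norm (U x - U y) < \<epsilon>/4"
      using F(3)[OF x] by blast
    have "norm (T x - T y) \<le> norm (T x - U x) + norm (U x - U y) + norm (T y - U y)"
      using norm_triangle_ineq4[of "(T x - U x) + (U x - U y)" "T y - U y"]
        norm_triangle_ineq[of "T x - U x" "U x - U y"] by (simp add: algebra_simps)
    moreover have "y \<in> S \<inter> cball 0 1"
      using y(1) F(2) by blast
    ultimately have "norm (T x - T y) < \<epsilon>"
      using near[OF x] near[of y] y(2) \<open>\<epsilon> > 0\<close> by linarith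
    then show ?thesis
      using y(1) by blast
  qed
  then show "\<exists>F. finite F \<and> F \<subseteq> S \<inter> cball 0 1 \<and> (\<forall>x\<in>S \<inter> cball 0 1. \<exists>y\<in>F. norm (T x - T y) < \<epsilon>)"
    using F(1,2) by blast
qed (use assms in auto)

lemma compact_op_on_comp:
  assumes S: "csubspace S" and T: "T ` S \<subseteq> S" "clinear_on S T" "bounded_by S T M" and U: "compact_op_on S U"
  shows "compact_op_on S (T \<circ> U)"
  unfolding compact_op_on_altdef
proof (intro conjI allI impI)
  show "(T \<circ> U) ` S \<subseteq> S"
    using T(1) compact_op_onD[OF U] by auto
  show "clinear_on S (T \<circ> U)"
    using clinear_onD[OF S T(2)] clinear_onD[OF S compact_op_onD(1)[OF U]] compact_op_onD(2)[OF U]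
    by (auto simp: clinear_on_def)
  show "(T \<circ> U) x = 0" if "x \<notin> S" for x
    using that compact_op_onD(3)[OF U] clinear_onD(1)[OF S T(2)] by simp
  fix \<epsilon> :: real assume "\<epsilon> > 0"
  \<comment> \<open>Positive whatever the sign of \<open>M\<close>, so that
    \<open>\<epsilon>/N\<close> is a legitimate net radius.\<close>
  define N where "N = \<bar>M\<bar> + 1"
  have N: "N > 0" "bounded_by S T N"
    using bounded_by_mono[OF T(3), of N] by (auto simp: N_def)
  obtain F where F: "finite F" "F \<subseteq> S \<inter> cball 0 1"
      "\<And>x. x \<in> S \<inter> cball 0 1 \<Longrightarrow> \<exists>y\<in>F. norm (U x - U y) < \<epsilon>/N"
    using compact_op_on_net[OF U, of "\<epsilon>/N"] \<open>\<epsilon> > 0\<close> N(1) by auto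
  have "\<exists>y\<in>F. norm ((T \<circ> U) x - (T \<circ> U) y) < \<epsilon>" if x: "x \<in> S \<inter> cball 0 1" for x
  proof -
    obtain y where y: "y \<in> F" "norm (U x - U y) < \<epsilon>/N"
      using F(3)[OF x] by blast
    have US: "U x \<in> S" "U y \<in> S"
      using x y F(2) compact_op_onD(2)[OF U] by auto
    have "norm (T (U x) - T (U y)) = norm (T (U x - U y))"
      by (simp add: clinear_onD[OF S T(2)] US)
    also have "\<dots> \<le> N * norm (U x - U y)"
      using N(2) US csubspaceD(4)[OF S] by (simp add: bounded_by_def)
    also have "\<dots> < \<epsilon>"
      using y(2) N(1) by (simp add: field_simps)
    finally show ?thesis
      using y(1) by auto
  qed
  then show "\<exists>F. finite F \<and> F \<subseteq> S \<inter> cball 0 1 \<and> (\<forall>x\<in>S \<inter> cball 0 1. \<exists>y\<in>F. norm ((T \<circ> U) x - (T \<circ> U) y) < \<epsilon>)"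
    using F(1,2) by blast
qed

lemma compact_op_on_scale:
  assumes "csubspace S" "compact_op_on S T"
  shows "compact_op_on S (\<lambda>x. scaleC a (T x))"
proof -
  have "compact_op_on S (scaleC a \<circ> T)"
    using assms by (intro compact_op_on_comp[where M = "cmod a"])
      (auto simp: clinear_on_def bounded_by_def norm_scaleC scaleC_add_right csubspaceD mult.commute)
  then show ?thesis
    by (simp add: comp_def)
qed

lemma compact_op_on_add:
  assumes S: "csubspace S" and T: "compact_op_on S T" and U: "compact_op_on S U"
  shows "compact_op_on S (\<lambda>x. T x + U x)"
  unfolding compact_op_on_def
proof (intro conjI allI impI)
  note TD = compact_op_onD[OF T] and UD = compact_op_onD[OF U]
  show "(\<lambda>x. T x + U x) ` S \<subseteq> S"
    using TD(2) UD(2) csubspaceD(2)[OF S] by auto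
  show "clinear_on S (\<lambda>x. T x + U x)"
    using TD(1) UD(1) by (auto simp: clinear_on_def scaleC_add_right)
  show "T x + U x = 0" if "x \<notin> S" for x
    using TD(3) UD(3) that by simp
  define C where "C = {x + y | x y. x \<in> closure (T ` (S \<inter> cball 0 1)) \<and> y \<in> closure (U ` (S \<inter> cball 0 1))}"
  have "compact C"
    unfolding C_def using T U by (intro compact_sums) (auto simp: compact_op_on_def)
  moreover have "(\<lambda>x. T x + U x) ` (S \<inter> cball 0 1) \<subseteq> C"
    unfolding C_def using closure_subset[of "T ` (S \<inter> cball 0 1)"] closure_subset[of "U ` (S \<inter> cball 0 1)"] by blast
  ultimately show "compact (closure ((\<lambda>x. T x + U x) ` (S \<inter> cball 0 1)))"
    by (rule compact_closure_subset)
qed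

lemma compact_op_on_zero: "csubspace S \<Longrightarrow> compact_op_on S (\<lambda>x. 0)"
  unfolding compact_op_on_def clinear_on_def using csubspaceD(1)[of S] by (auto simp: image_constant_conv)

lemma compact_op_on_sum:
  assumes "csubspace S" "\<And>i. i \<in> I \<Longrightarrow> compact_op_on S (T i)"
  shows "compact_op_on S (\<lambda>x. \<Sum>i\<in>I. T i x)"
  using assms(2)
  by (induction I rule: infinite_finite_induct) (auto intro!: compact_op_on_add compact_op_on_zero assms(1))

text \<open>The values on the unit ball lie in the image of a closed disc under
  \<open>z \<mapsto> scaleC z u\<close>, which is compact.\<close>

lemma compact_op_on_rank_one:
  assumes S: "csubspace S" and u: "u \<in> S"
    and g: "\<And>x y. x \<in> S \<Longrightarrow> y \<in> S \<Longrightarrow> g (x + y) = g x + g y"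
      "\<And>a x. x \<in> S \<Longrightarrow> g (scaleC a x) = a * g x" "\<And>x. x \<in> S \<Longrightarrow> cmod (g x) \<le> M * norm x"
  shows "compact_op_on S (\<lambda>x. if x \<in> S then scaleC (g x) u else 0)"
  unfolding compact_op_on_def
proof (intro conjI allI impI)
  let ?T = "\<lambda>x. if x \<in> S then scaleC (g x) u else 0"
  show "?T ` S \<subseteq> S"
    using u csubspaceD(3)[OF S] by auto
  show "clinear_on S ?T"
    using csubspaceD(2,3)[OF S] by (simp add: clinear_on_def g scaleC_add_left)
  have "cmod (g x) \<le> \<bar>M\<bar>" if "x \<in> S" "norm x \<le> 1" for x
    using g(3)[OF that(1)] mult_mono[of M "\<bar>M\<bar>" "norm x" 1] that(2) abs_ge_self[of M]
    by (metis abs_ge_zero mult.right_neutral norm_ge_zero order_trans)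
  then have "?T ` (S \<inter> cball 0 1) \<subseteq> (\<lambda>z. scaleC z u) ` cball 0 \<bar>M\<bar>"
    by auto
  moreover have "compact ((\<lambda>z. scaleC z u) ` cball 0 \<bar>M\<bar>)"
    by (intro compact_continuous_image compact_cball linear_continuous_on bounded_linear_scaleC_left)
  ultimately show "compact (closure (?T ` (S \<inter> cball 0 1)))"
    using compact_closure_subset by blast
qed auto

subsection \<open>Gram-Schmidt bases, Riesz representation and dimension\<close>

lemma csubspace_image:
  assumes "csubspace S" "clinear_on S T"
  shows "csubspace (T ` S)"
  unfolding csubspace_def
proof (intro conjI ballI allI)
  note S = csubspaceD[OF assms(1)] and T = clinear_onD[OF assms]
  show "0 \<in> T ` S"
    using S(1) T(1) by (metis imageI)
  show "x + y \<in> T ` S" if "x \<in> T ` S" "y \<in> T ` S" for x y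
    using that S(2) T(2) by (auto simp: image_iff) (metis)
  show "scaleC a x \<in> T ` S" if "x \<in> T ` S" for a x
    using that S(3) T(4) by (auto simp: image_iff) (metis)
qed

text \<open>Gram-Schmidt is applied to the images of a countable union of finite nets of mesh
  \<open>1 / Suc m\<close>. The vectors \<open>e k\<close> lie in the range itself, not just in its
  closure, which later bounds the number of nonzero ones by the dimension of the range.\<close>

lemma compact_op_on_gram_schmidt:
  assumes S: "csubspace S" and T: "compact_op_on S T"
  obtains e where "weak_orthonormal e" "\<And>k. e k \<in> T ` S"
    "\<And>\<epsilon>. \<epsilon> > 0 \<Longrightarrow> \<exists>N. \<forall>n\<ge>N. bounded_by S (\<lambda>x. T x - partial_proj e n (T x)) \<epsilon>"
proof -
  note TD = compact_op_onD[OF T]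
  have "\<forall>m. \<exists>F. finite F \<and> F \<subseteq> S \<inter> cball 0 1 \<and>
      (\<forall>x\<in>S \<inter> cball 0 1. \<exists>y\<in>F. norm (T x - T y) < 1 / real (Suc m))"
    using T unfolding compact_op_on_altdef by simp
  then obtain F where F: "\<And>m. finite (F m)" "\<And>m. F m \<subseteq> S \<inter> cball 0 1"
    "\<And>m x. x \<in> S \<inter> cball 0 1 \<Longrightarrow> \<exists>y\<in>F m. norm (T x - T y) < 1 / real (Suc m)"
    by metis
  \<comment> \<open>The extra 0 keeps \<open>D\<close> nonempty for the enumeration by
    \<open>from_nat_into\<close>.\<close>
  define D where "D = insert 0 (\<Union>m. F m)"
  have D: "countable D" "D \<noteq> {}" "D \<subseteq> S"
    using F(1,2) csubspaceD(1)[OF S] by (auto simp: D_def intro: countable_finite)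
  define s where "s = from_nat_into D"
  have s: "range s = D"
    using D by (simp add: s_def range_from_nat_into)
  define e where "e = gram_schmidt (\<lambda>k. T (s k))"
  have wo: "weak_orthonormal e"
    by (simp add: e_def weak_orthonormal_gram_schmidt)
  have "e k \<in> T ` S" for k
    unfolding e_def using s D(3) by (intro gram_schmidt_mem csubspace_image S TD(1)) auto
  moreover have "\<exists>N. \<forall>n\<ge>N. bounded_by S (\<lambda>x. T x - partial_proj e n (T x)) \<epsilon>" if "\<epsilon> > 0" for \<epsilon>
  proof -
    obtain m where m: "1 / real (Suc m) < \<epsilon>"
      using nat_approx_posE[OF \<open>\<epsilon> > 0\<close>] by metis
    have "F m \<subseteq> range s"
      by (auto simp: s D_def)
    then obtain I where I: "finite I" "F m = s ` I"
      using finite_subset_image[OF F(1)[of m], of s UNIV] by metis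
    obtain N where N: "\<forall>i\<in>I. i < N"
      using I(1) unfolding finite_nat_set_iff_bounded by metis
    have "bounded_by S (\<lambda>x. T x - partial_proj e n (T x)) \<epsilon>" if n: "n \<ge> N" for n
    proof (rule bounded_by_unit_ball[OF S])
      show "clinear_on S (\<lambda>x. T x - partial_proj e n (T x))"
        using TD(1) by (simp add: clinear_on_def partial_proj_add partial_proj_scaleC scaleC_diff_right)
      fix x assume "x \<in> S" "norm x \<le> 1"
      then obtain y where y: "y \<in> F m" "norm (T x - T y) < 1 / real (Suc m)"
        using F(3)[of x m] by auto
      then obtain k where k: "k \<in> I" "y = s k"
        using I(2) by blast
      have "partial_proj e n (T y) = T y"
        using N[rule_format, OF k(1)] n partial_proj_gram_schmidt[of k n "\<lambda>k. T (s k)"] by (simp add: k(2) e_def)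
      \<comment> \<open>The net value \<open>T y\<close> is reproduced exactly, so only the small
        vector \<open>T x - T y\<close> contributes to the remainder.\<close>
      then have "T x - partial_proj e n (T x) = (T x - T y) - partial_proj e n (T x - T y)"
        by (simp add: partial_proj_diff)
      then have "norm (T x - partial_proj e n (T x)) \<le> norm (T x - T y)"
        using norm_minus_partial_proj_le[OF wo, of "T x - T y" n] by (simp only:)
      then show "norm (T x - partial_proj e n (T x)) \<le> \<epsilon>"
        using y(2) m by linarith
    qed
    then show ?thesis
      by blast
  qed
  ultimately show thesis
    using that wo by blast
qed

text \<open>A vector \<open>y0\<close> of the unit ball at which \<open>g\<close> is nearly maximal
  almost determines \<open>g\<close>: if \<open>g\<close> were large somewhere on the orthogonal
  complement of \<open>y0\<close>, a combination of the two vectors would exceed the norm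
  \<open>N\<close> of \<open>g\<close>.\<close>

lemma functional_approx_riesz:
  fixes S :: "'h::cinner_space set"
  assumes S: "csubspace S"
    and add: "\<And>x y. x \<in> S \<Longrightarrow> y \<in> S \<Longrightarrow> g (x + y) = g x + g y"
    and sc: "\<And>a x. x \<in> S \<Longrightarrow> g (scaleC a x) = a * g x"
    and bd: "\<And>x. x \<in> S \<Longrightarrow> cmod (g x) \<le> M * norm x"
    and "\<epsilon> > 0"
  shows "\<exists>y\<in>S. \<forall>x\<in>S. cmod (g x - cinner y x) \<le> \<epsilon> * norm x"
proof -
  note SD = csubspaceD[OF S]
  define N where "N = (SUP x\<in>S \<inter> cball 0 1. cmod (g x))"
  have "cmod (g x) \<le> \<bar>M\<bar>" if "x \<in> S" "norm x \<le> 1" for x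
    using bd[OF that(1)] mult_mono[of M "\<bar>M\<bar>" "norm x" 1] that(2) by (auto intro: order_trans)
  then have bdd: "bdd_above ((\<lambda>x. cmod (g x)) ` (S \<inter> cball 0 1))"
    unfolding bdd_above_def by (intro exI[of _ "\<bar>M\<bar>"]) auto
  have g0: "g 0 = 0"
    using sc[of 0 0] SD(1) by simp
  have N: "cmod (g x) \<le> N * norm x" if "x \<in> S" for x
  proof (cases "x = 0")
    case False
    have "cmod (g ((1 / norm x) *\<^sub>R x)) \<le> N"
      unfolding N_def using False that SD(5) by (intro cSUP_upper bdd) auto
    then show ?thesis
      using False that by (simp add: scaleR_scaleC sc norm_mult norm_divide field_simps)
  qed (use g0 in simp)
  have "\<exists>y\<in>S \<inter> cball 0 1. (cmod (g y))\<^sup>2 > N\<^sup>2 - \<epsilon>\<^sup>2"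
  proof (rule ccontr)
    assume "\<not> ?thesis"
    then have le: "(cmod (g y))\<^sup>2 \<le> N\<^sup>2 - \<epsilon>\<^sup>2" if "y \<in> S \<inter> cball 0 1" for y
      using that by force
    have nn: "0 \<le> N\<^sup>2 - \<epsilon>\<^sup>2"
      using le[of 0] SD(1) g0 by simp
    have "N \<le> sqrt (N\<^sup>2 - \<epsilon>\<^sup>2)"
      unfolding N_def
    proof (rule cSUP_least)
      show "S \<inter> cball 0 1 \<noteq> {}"
        using SD(1) by auto
      show "cmod (g x) \<le> sqrt ((SUP x\<in>S \<inter> cball 0 1. cmod (g x))\<^sup>2 - \<epsilon>\<^sup>2)" if "x \<in> S \<inter> cball 0 1" for x
        using le[OF that] by (simp add: real_le_rsqrt N_def)
    qed
    moreover have "0 \<le> N"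
      unfolding N_def using SD(1) g0 by (intro cSUP_upper2[OF bdd, of 0]) auto
    ultimately have "N\<^sup>2 \<le> N\<^sup>2 - \<epsilon>\<^sup>2"
      using nn by (metis power_mono real_sqrt_pow2)
    then show False
      using \<open>\<epsilon> > 0\<close> by simp
  qed
  then obtain y0 where y0: "y0 \<in> S" "norm y0 \<le> 1" "(cmod (g y0))\<^sup>2 > N\<^sup>2 - \<epsilon>\<^sup>2"
    by auto
  have small: "cmod (g v) \<le> \<epsilon> * norm v" if v: "v \<in> S" "cinner y0 v = 0" for v
  proof (cases "v = 0")
    case False
    \<comment> \<open>The coefficients of \<open>w\<close> are the optimal ones:
      \<open>g w = t\<close> while \<open>(norm w)\<^sup>2 \<le> t\<close>. Hence
      \<open>t \<le> N\<^sup>2\<close>, and the deficit \<open>\<epsilon>\<^sup>2\<close> of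
      \<open>y0\<close> bounds the share of \<open>v\<close>.\<close>
    define t where "t = (cmod (g y0))\<^sup>2 + (cmod (g v))\<^sup>2 / (norm v)\<^sup>2"
    define w where "w = scaleC (cnj (g y0)) y0 + scaleC (cnj (g v) / of_real ((norm v)\<^sup>2)) v"
    have "g w = cnj (g y0) * g y0 + (cnj (g v) / of_real ((norm v)\<^sup>2)) * g v"
      unfolding w_def using v(1) y0(1) SD(3) by (simp add: add sc)
    also have "\<dots> = of_real t"
      unfolding t_def of_real_add of_real_divide complex_norm_square by (simp add: mult.commute)
    finally have gw: "g w = of_real t" .
    have "cinner (scaleC (cnj (g y0)) y0) (scaleC (cnj (g v) / of_real ((norm v)\<^sup>2)) v) = 0"
      using v(2) by (simp add: cinner_scaleC_left cinner_scaleC_right)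
    then have "(norm w)\<^sup>2 = (norm (scaleC (cnj (g y0)) y0))\<^sup>2 + (norm (scaleC (cnj (g v) / of_real ((norm v)\<^sup>2)) v))\<^sup>2"
      unfolding w_def by (rule norm_add_sq_orthogonal)
    also have "\<dots> = (cmod (g y0) * norm y0)\<^sup>2 + (cmod (g v) / norm v)\<^sup>2"
      using False by (simp add: norm_scaleC norm_divide norm_mult power2_eq_square)
    also have "(cmod (g y0) * norm y0)\<^sup>2 \<le> (cmod (g y0))\<^sup>2"
      using y0(2) by (intro power_mono) (auto intro: mult_left_le)
    finally have w: "(norm w)\<^sup>2 \<le> t"
      by (simp add: t_def power_divide)
    have tpos: "0 \<le> t"
      by (simp add: t_def)
    have "w \<in> S"
      unfolding w_def using v(1) y0(1) SD(2,3) by blast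
    then have "t \<le> N * norm w"
      using N[of w] tpos by (simp add: gw)
    then have "t\<^sup>2 \<le> (N * norm w)\<^sup>2"
      using tpos by (intro power_mono) auto
    also have "\<dots> \<le> N\<^sup>2 * t"
      using w by (simp add: power_mult_distrib mult_left_mono)
    finally have "t * t \<le> N\<^sup>2 * t"
      by (simp add: power2_eq_square)
    then have "t \<le> N\<^sup>2"
      using tpos by (cases "t = 0") auto
    then have "(cmod (g v))\<^sup>2 / (norm v)\<^sup>2 \<le> \<epsilon>\<^sup>2"
      using y0(3) by (simp add: t_def)
    then have "(cmod (g v))\<^sup>2 \<le> (\<epsilon> * norm v)\<^sup>2"
      using False by (simp add: field_simps power_mult_distrib)
    then show ?thesis
      using \<open>\<epsilon> > 0\<close> by (intro power2_le_imp_le[of "cmod (g v)"]) auto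
  qed (use g0 in simp)
  define y where "y = scaleC (cnj (g y0) / of_real ((norm y0)\<^sup>2)) y0"
  have "cmod (g x - cinner y x) \<le> \<epsilon> * norm x" if x: "x \<in> S" for x
  proof -
    define p where "p = scaleC (cinner y0 x / of_real ((norm y0)\<^sup>2)) y0"
    define v where "v = x - p"
    have vS: "p \<in> S" "v \<in> S"
      using x y0(1) SD(3,4) by (auto simp: v_def p_def)
    have orth: "cinner y0 v = 0"
      by (cases "y0 = 0") (simp_all add: v_def p_def cinner_diff_right cinner_scaleC_right cinner_self)
    then have "cinner p v = 0"
      by (simp add: p_def cinner_scaleC_left)
    then have "(norm x)\<^sup>2 = (norm p)\<^sup>2 + (norm v)\<^sup>2"
      using norm_add_sq_orthogonal[of p v] by (simp add: v_def)
    then have "(norm v)\<^sup>2 \<le> (norm x)\<^sup>2"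
      using zero_le_power2[of "norm p"] by linarith
    then have "norm v \<le> norm x"
      by (rule power2_le_imp_le) simp
    have "g x = g p + g v"
      using add[OF vS] by (simp add: v_def)
    moreover have "g p = cinner y x"
      unfolding p_def y_def using y0(1) by (simp add: sc cinner_scaleC_left)
    ultimately have "cmod (g x - cinner y x) = cmod (g v)"
      by simp
    also have "\<dots> \<le> \<epsilon> * norm v"
      by (rule small[OF vS(2) orth])
    also have "\<dots> \<le> \<epsilon> * norm x"
      using \<open>norm v \<le> norm x\<close> \<open>\<epsilon> > 0\<close> by simp
    finally show ?thesis .
  qed
  moreover have "y \<in> S"
    using y0(1) SD(3) by (simp add: y_def)
  ultimately show ?thesis
    by blast
qed

text \<open>Approximate representatives form a Cauchy sequence: inner products with
  \<open>y m\<close> and with \<open>y n\<close> are both close to \<open>g\<close>, and evaluation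
  at \<open>y m - y n\<close> turns this into a bound on its norm. Closedness keeps the limit in
  \<open>S\<close>.\<close>

lemma riesz_representation:
  fixes S :: "'h::chilbert set"
  assumes S: "csubspace S" "closed S"
    and g: "\<And>x y. x \<in> S \<Longrightarrow> y \<in> S \<Longrightarrow> g (x + y) = g x + g y"
      "\<And>a x. x \<in> S \<Longrightarrow> g (scaleC a x) = a * g x" "\<And>x. x \<in> S \<Longrightarrow> cmod (g x) \<le> M * norm x"
  shows "\<exists>y\<in>S. \<forall>x\<in>S. g x = cinner y x"
proof -
  have "\<forall>n. \<exists>y\<in>S. \<forall>x\<in>S. cmod (g x - cinner y x) \<le> 1 / real (Suc n) * norm x"
    by (intro allI functional_approx_riesz[OF S(1) g]) auto
  then obtain y where y: "\<And>n. y n \<in> S" "\<And>n x. x \<in> S \<Longrightarrow> cmod (g x - cinner (y n) x) \<le> 1 / real (Suc n) * norm x"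
    by metis
  have close: "norm (y m - y n) \<le> 1 / real (Suc m) + 1 / real (Suc n)" for m n
  proof (cases "y m = y n")
    case False
    let ?d = "y m - y n"
    have d: "?d \<in> S"
      using y(1) csubspaceD(4)[OF S(1)] by blast
    have "cinner ?d ?d = (g ?d - cinner (y n) ?d) - (g ?d - cinner (y m) ?d)"
      by (simp add: cinner_diff_left)
    then have "cmod (cinner ?d ?d) \<le> cmod (g ?d - cinner (y n) ?d) + cmod (g ?d - cinner (y m) ?d)"
      by (metis norm_triangle_ineq4)
    also have "\<dots> \<le> 1 / real (Suc n) * norm ?d + 1 / real (Suc m) * norm ?d"
      by (intro add_mono y(2) d)
    finally have "norm ?d * norm ?d \<le> (1 / real (Suc m) + 1 / real (Suc n)) * norm ?d"
      by (simp add: cinner_self power2_eq_square norm_mult algebra_simps)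
    then show ?thesis
      using False by (simp only: mult_le_cancel_right) auto
  qed auto
  have "Cauchy y"
  proof (rule metric_CauchyI)
    fix \<epsilon> :: real assume "\<epsilon> > 0"
    then obtain M where M: "1 / real (Suc M) < \<epsilon>/2"
      by (metis half_gt_zero nat_approx_posE)
    have "1 / real (Suc n) < \<epsilon>/2" if "n \<ge> M" for n
      using M that by (meson frac_le le_less_trans of_nat_0_less_iff of_nat_le_iff Suc_le_mono order_refl zero_le_one zero_less_Suc)
    then show "\<exists>M. \<forall>m\<ge>M. \<forall>n\<ge>M. dist (y m) (y n) < \<epsilon>"
      using close unfolding dist_norm
      by (intro exI[of _ M] allI impI) (smt (verit, best) field_sum_of_halves)
  qed
  then obtain L where L: "y \<longlonglongrightarrow> L"
    using Cauchy_convergent convergent_def by blast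
  have "L \<in> S"
    using closed_sequentially[OF S(2) y(1) L] .
  moreover have "g x = cinner L x" if x: "x \<in> S" for x
  proof -
    have "(\<lambda>n. 1 / real (Suc n) * norm x) \<longlonglongrightarrow> 0"
      using tendsto_mult_left_zero[OF LIMSEQ_inverse_real_of_nat, of "norm x"] by (simp add: field_simps)
    then have "(\<lambda>n. g x - cinner (y n) x) \<longlonglongrightarrow> 0"
      by (rule Lim_null_comparison[rotated]) (use y(2)[OF x] in auto)
    moreover have "(\<lambda>n. cnj (cinner x (y n))) \<longlonglongrightarrow> cnj (cinner x L)"
      by (intro tendsto_cnj bounded_linear.tendsto[OF bounded_linear_cinner_right] L)
    then have "(\<lambda>n. g x - cinner (y n) x) \<longlonglongrightarrow> g x - cinner L x"
      by (intro tendsto_intros) (simp flip: cinner_cnj_commute)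
    ultimately show ?thesis
      using LIMSEQ_unique by fastforce
  qed
  ultimately show ?thesis
    by blast
qed

text \<open>Gaussian elimination, one equation at a time: an unknown \<open>b0\<close> with nonzero
  coefficient in equation \<open>g\<close> is eliminated from the others, and the reduced system
  still has more unknowns than equations.\<close>

lemma homogeneous_system_nontrivial:
  fixes A :: "'g \<Rightarrow> 'b \<Rightarrow> 'c::field"
  assumes "finite G" "finite B" "card G < card B"
  shows "\<exists>c. (\<exists>b\<in>B. c b \<noteq> 0) \<and> (\<forall>g\<in>G. (\<Sum>b\<in>B. A g b * c b) = 0)"
  using assms
proof (induction G arbitrary: A B rule: finite_induct)
  case empty
  then show ?case
    by (intro exI[of _ "\<lambda>_. 1"]) (auto simp: card_gt_0_iff)
next
  case (insert g G)
  show ?case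
  proof (cases "\<forall>b\<in>B. A g b = 0")
    case True
    obtain c where "\<exists>b\<in>B. c b \<noteq> 0" "\<forall>g\<in>G. (\<Sum>b\<in>B. A g b * c b) = 0"
      using insert.IH[of B A] insert.prems insert.hyps by auto
    then show ?thesis
      using True by (intro exI[of _ c]) auto
  next
    case False
    then obtain b0 where b0: "b0 \<in> B" "A g b0 \<noteq> 0"
      by blast
    let ?B = "B - {b0}"
    have "finite ?B" "card G < card ?B"
      using insert.prems insert.hyps b0(1) by auto
    note IH = insert.IH[OF this, of "\<lambda>h b. A h b - A g b / A g b0 * A h b0"]
    obtain c where c: "\<exists>b\<in>?B. c b \<noteq> 0"
        "\<And>h. h \<in> G \<Longrightarrow> (\<Sum>b\<in>?B. (A h b - A g b / A g b0 * A h b0) * c b) = 0"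
      using IH by blast
    define s where "s = (\<Sum>b\<in>?B. A g b / A g b0 * c b)"
    \<comment> \<open>The pivot value that solves equation \<open>g\<close>; the modified
      coefficients of the other equations already account for it.\<close>
    define d where "d = c(b0 := - s)"
    have split: "(\<Sum>b\<in>B. A h b * d b) = (\<Sum>b\<in>?B. A h b * c b) - A h b0 * s" for h
      using insert.prems(1) b0(1) by (subst sum.remove[of B b0]) (auto simp: d_def)
    have "(\<Sum>b\<in>B. A h b * d b) = 0" if "h \<in> insert g G" for h
    proof (cases "h = g")
      case True
      then show ?thesis
        using b0(2) by (simp add: split s_def sum_distrib_left)
    next
      case False
      then have "(\<Sum>b\<in>?B. A h b * c b) - (\<Sum>b\<in>?B. A h b0 * (A g b / A g b0 * c b)) = 0"
        using c(2)[of h] that by (simp add: left_diff_distrib sum_subtractf) (simp add: mult_ac)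
      then show ?thesis
        by (simp add: split s_def sum_distrib_left)
    qed
    moreover have "\<exists>b\<in>B. d b \<noteq> 0"
      using c(1) by (auto simp: d_def)
    ultimately show ?thesis
      by blast
  qed
qed

text \<open>Orthogonality to \<open>Y\<close> is a homogeneous linear system for the coefficients
  with respect to an independent set of more than \<open>card Y\<close> vectors. A nontrivial
  solution gives a nonzero vector by independence.\<close>

lemma exists_unit_orthogonal:
  fixes S :: "'h::cinner_space set"
  assumes S: "csubspace S" and Y: "finite Y" and dim: "enat (card Y + 1) \<le> cdim S"
  shows "\<exists>x\<in>S. norm x = 1 \<and> (\<forall>y\<in>Y. cinner y x = 0)"
proof -
  have "\<exists>B. finite B \<and> B \<subseteq> S \<and> cindependent B \<and> card Y < card B"
  proof (rule ccontr)
    assume "\<not> ?thesis"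
    then have "cdim S \<le> enat (card Y)"
      unfolding cdim_def by (intro Sup_least) (auto simp: not_less)
    then have "enat (card Y + 1) \<le> enat (card Y)"
      using dim order_trans by blast
    then show False
      by simp
  qed
  then obtain B where B: "finite B" "B \<subseteq> S" "cindependent B" "card Y < card B"
    by blast
  obtain c where c: "\<exists>b\<in>B. c b \<noteq> 0" "\<And>y. y \<in> Y \<Longrightarrow> (\<Sum>b\<in>B. cinner y b * c b) = 0"
    using homogeneous_system_nontrivial[OF Y B(1,4), of cinner] by blast
  define x where "x = (\<Sum>b\<in>B. scaleC (c b) b)"
  have "x \<noteq> 0"
    using B(3) c(1) unfolding cindependent_def x_def by blast
  have "x \<in> S"
    unfolding x_def using B(2) csubspaceD(3)[OF S] by (intro csubspaceD(6)[OF S]) auto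
  then have "(1 / norm x) *\<^sub>R x \<in> S"
    by (rule csubspaceD(5)[OF S])
  moreover have "cinner y ((1 / norm x) *\<^sub>R x) = 0" if "y \<in> Y" for y
    using c(2)[OF that] by (simp add: x_def scaleR_scaleC cinner_scaleC_right cinner_sum_right mult.commute)
  ultimately show ?thesis
    using \<open>x \<noteq> 0\<close> by (intro bexI[of _ "(1 / norm x) *\<^sub>R x"]) auto
qed

lemma card_weak_orthonormal_le_cdim:
  assumes e: "weak_orthonormal e" "\<And>k. e k \<in> R"
  shows "enat (card {k. k < n \<and> e k \<noteq> 0}) \<le> cdim R"
proof -
  let ?I = "{k. k < n \<and> e k \<noteq> 0}"
  have inj: "inj_on e ?I"
  proof (rule inj_onI, rule ccontr)
    fix j k assume "j \<in> ?I" "k \<in> ?I" "e j = e k" "j \<noteq> k"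
    then have "cinner (e k) (e k) = 0"
      using e(1) unfolding weak_orthonormal_def by metis
    then show False
      using \<open>k \<in> ?I\<close> by (simp add: cinner_self)
  qed
  have "c (e j) = 0" if "(\<Sum>x\<in>e ` ?I. scaleC (c x) x) = 0" "j \<in> ?I" for c j
  proof -
    have "(\<Sum>k\<in>?I. scaleC (c (e k)) (e k)) = 0"
      using that(1) by (simp add: sum.reindex[OF inj])
    then show ?thesis
      using weak_orthonormal_cinner_sum[OF e(1), of ?I j "\<lambda>k. c (e k)"] that(2) by simp
  qed
  then have "cindependent (e ` ?I)"
    by (auto simp: cindependent_def)
  moreover have "finite (e ` ?I)" "e ` ?I \<subseteq> R"
    using e(2) by auto
  ultimately have "enat (card (e ` ?I)) \<le> cdim R"
    unfolding cdim_def by (intro Sup_upper) blast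
  then show ?thesis
    by (simp add: card_image[OF inj])
qed

subsection \<open>Factorization of compact operators\<close>

instance chilbert \<subseteq> banach ..

instance cbanach_algebra \<subseteq> banach ..

text \<open>If \<open>e k\<close> is nonzero, then it and its nonzero predecessors, say
  \<open>n\<close> of them, fit into \<open>R\<close>, so \<open>cdim S\<close> is at least
  \<open>n + 3\<close>. This leaves room for a unit vector orthogonal to \<open>y\<close>,
  \<open>z\<close> and the \<open>n\<close> earlier nonzero vectors \<open>f j\<close>. At the other
  indices there may be no room, and \<open>f k\<close> is 0.\<close>

lemma orthonormal_in_complement:
  fixes S :: "'h::cinner_space set"
  assumes S: "csubspace S" and e: "weak_orthonormal e" "\<And>k. e k \<in> R" and dim: "cdim R + 2 \<le> cdim S"
  obtains f where "weak_orthonormal f" "\<And>k. f k \<in> S" "\<And>k. f k = 0 \<longleftrightarrow> e k = 0"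
    "\<And>k. cinner y (f k) = 0" "\<And>k. cinner z (f k) = 0"
proof -
  define P where "P f k r \<longleftrightarrow> r \<in> S \<and> (if e k = 0 then r = 0 else norm r = 1) \<and>
     (\<forall>w\<in>insert y (insert z (f ` {..<k})). cinner w r = 0)" for f :: "nat \<Rightarrow> 'h" and k r
  have "\<exists>f. \<forall>k. P f k (f k)"
  \<comment> \<open>Recursive choice: \<open>P\<close> consults \<open>f\<close> only below
    \<open>k\<close>.\<close>
  proof (rule dependent_wellorder_choice)
    fix r :: 'h and f g :: "nat \<Rightarrow> 'h" and k :: nat
    assume "\<And>j. j < k \<Longrightarrow> f j = g j"
    then have "f ` {..<k} = g ` {..<k}"
      by auto
    then show "P f k r = P g k r"
      by (simp only: P_def)
  next
    fix k :: nat and f :: "nat \<Rightarrow> 'h"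
    assume IH: "\<And>j. j < k \<Longrightarrow> P f j (f j)"
    show "\<exists>r. P f k r"
    proof (cases "e k = 0")
      case True
      then show ?thesis
        using csubspaceD(1)[OF S] by (intro exI[of _ 0]) (auto simp: P_def)
    next
      case False
      let ?I = "{j. j < k \<and> e j \<noteq> 0}"
      let ?Y = "insert y (insert z (f ` ?I))"
      have "card ?Y \<le> Suc (Suc (card (f ` ?I)))"
        using card_insert_le_m1 by (simp add: card_insert_if)
      moreover have "card (f ` ?I) \<le> card ?I"
        by (simp add: card_image_le)
      ultimately have "card ?Y + 1 \<le> Suc (card ?I) + 2"
        by linarith
      moreover have "{j. j < Suc k \<and> e j \<noteq> 0} = insert k ?I"
        using False by (auto simp: less_Suc_eq)
      then have "enat (Suc (card ?I)) \<le> cdim R"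
        using card_weak_orthonormal_le_cdim[OF e, of "Suc k"] by simp
      then have "enat (Suc (card ?I)) + 2 \<le> cdim S"
        using dim by (meson add_right_mono order_trans)
      then have "enat (Suc (card ?I) + 2) \<le> cdim S"
        by (metis numeral_eq_enat plus_enat_simps(1))
      ultimately have "enat (card ?Y + 1) \<le> cdim S"
        by (meson enat_ord_simps(1) order_trans)
      then obtain r where r: "r \<in> S" "norm r = 1" "\<forall>w\<in>?Y. cinner w r = 0"
        using exists_unit_orthogonal[OF S, of ?Y] by auto
      have "f j = 0" if "j < k" "j \<notin> ?I" for j
        using IH[OF that(1)] that by (auto simp: P_def)
      then have "cinner (f j) r = 0" if "j < k" for j
        using r(3) that by (cases "j \<in> ?I") auto
      then have "P f k r"
        using r False by (auto simp: P_def)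
      then show ?thesis
        by blast
    qed
  qed
  then obtain f where f: "\<And>k. P f k (f k)"
    by blast
  have "cinner (f j) (f k) = 0" if "j < k" for j k
    using f[of k] that by (auto simp: P_def)
  then have "cinner (f j) (f k) = 0" if "j \<noteq> k" for j k
    using that by (metis cinner_swap_eq_0 linorder_neqE_nat)
  moreover have "norm (f k) = 0 \<or> norm (f k) = 1" for k
    using f[of k] by (auto simp: P_def split: if_splits)
  ultimately have "weak_orthonormal f"
    by (simp add: weak_orthonormal_def)
  moreover have "f k \<in> S" "f k = 0 \<longleftrightarrow> e k = 0" "cinner y (f k) = 0" "cinner z (f k) = 0" for k
    using f[of k] by (auto simp: P_def split: if_splits)
  ultimately show thesis
    using that by blast
qed

section \<open>Operators given by series along an orthonormal system\<close>

context
  fixes S :: "'h::chilbert set" and f :: "nat \<Rightarrow> 'h" and \<alpha> :: "nat \<Rightarrow> 'h \<Rightarrow> complex" and \<beta> :: "nat \<Rightarrow> real"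
  assumes S: "csubspace S" "closed S" and f: "weak_orthonormal f" "\<And>k. f k \<in> S"
    and add: "\<And>k x y. x \<in> S \<Longrightarrow> y \<in> S \<Longrightarrow> \<alpha> k (x + y) = \<alpha> k x + \<alpha> k y"
    and sc: "\<And>k a x. x \<in> S \<Longrightarrow> \<alpha> k (scaleC a x) = a * \<alpha> k x"
    and bd: "\<And>m n x. x \<in> S \<Longrightarrow> m \<le> n \<Longrightarrow> (\<Sum>k=m..<n. (cmod (\<alpha> k x))\<^sup>2) \<le> (\<beta> m * norm x)\<^sup>2"
    and \<beta>: "\<And>m. 0 \<le> \<beta> m" "\<beta> \<longlonglongrightarrow> 0"
begin

lemma series_partial_sum_bound:
  assumes "x \<in> S"
  shows "norm (\<Sum>k=m..<n. scaleC (\<alpha> k x) (f k)) \<le> \<beta> m * norm x"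
proof (cases "m \<le> n")
  case True
  have "(norm (\<Sum>k=m..<n. scaleC (\<alpha> k x) (f k)))\<^sup>2 \<le> (\<beta> m * norm x)\<^sup>2"
    using norm_weak_orthonormal_sum[OF f(1), of "{m..<n}" "\<lambda>k. \<alpha> k x"] bd[OF assms True] by simp
  then show ?thesis
    by (rule power2_le_imp_le) (simp add: \<beta>(1))
qed (simp add: \<beta>(1))

lemma summable_series:
  assumes "x \<in> S"
  shows "summable (\<lambda>k. scaleC (\<alpha> k x) (f k))"
  unfolding summable_Cauchy
proof (intro allI impI)
  fix \<epsilon> :: real assume "\<epsilon> > 0"
  have "(\<lambda>m. \<beta> m * norm x) \<longlonglongrightarrow> 0"
    using tendsto_mult_left_zero[OF \<beta>(2)] .
  then obtain N where N: "\<And>m. m \<ge> N \<Longrightarrow> \<beta> m * norm x < \<epsilon>"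
    using order_tendstoD(2)[OF _ \<open>\<epsilon> > 0\<close>] by (force simp: eventually_sequentially)
  have "norm (\<Sum>k=m..<n. scaleC (\<alpha> k x) (f k)) < \<epsilon>" if "m \<ge> N" for m n
    using series_partial_sum_bound[OF assms, of m n] N[OF that] by linarith
  then show "\<exists>N. \<forall>m\<ge>N. \<forall>n. norm (\<Sum>k=m..<n. scaleC (\<alpha> k x) (f k)) < \<epsilon>"
    by blast
qed

lemma series_tail_bound:
  assumes "x \<in> S"
  shows "norm ((\<Sum>k. scaleC (\<alpha> k x) (f k)) - (\<Sum>k<m. scaleC (\<alpha> k x) (f k))) \<le> \<beta> m * norm x"
proof (rule tendsto_upperbound)
  show "(\<lambda>n. norm ((\<Sum>k<n. scaleC (\<alpha> k x) (f k)) - (\<Sum>k<m. scaleC (\<alpha> k x) (f k))))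
      \<longlonglongrightarrow> norm ((\<Sum>k. scaleC (\<alpha> k x) (f k)) - (\<Sum>k<m. scaleC (\<alpha> k x) (f k)))"
    by (intro tendsto_intros summable_LIMSEQ summable_series assms)
  have "norm ((\<Sum>k<n. scaleC (\<alpha> k x) (f k)) - (\<Sum>k<m. scaleC (\<alpha> k x) (f k))) \<le> \<beta> m * norm x" if "m \<le> n" for n
  proof -
    have "(\<Sum>k<n. scaleC (\<alpha> k x) (f k)) - (\<Sum>k<m. scaleC (\<alpha> k x) (f k)) = (\<Sum>k=m..<n. scaleC (\<alpha> k x) (f k))"
      using that sum_diff_nat_ivl[of 0 m n "\<lambda>k. scaleC (\<alpha> k x) (f k)"] by (simp add: atLeast0LessThan)
    then show ?thesis
      using series_partial_sum_bound[OF assms, of m n] by (simp only:)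
  qed
  then show "eventually (\<lambda>n. norm ((\<Sum>k<n. scaleC (\<alpha> k x) (f k)) - (\<Sum>k<m. scaleC (\<alpha> k x) (f k))) \<le> \<beta> m * norm x) sequentially"
    unfolding eventually_sequentially by blast
qed auto

text \<open>The tail bound is uniform over the unit ball of \<open>S\<close>, so the partial sums
  are finite rank operators converging in norm. The case \<open>m = 0\<close> of the tail bound is
  the norm estimate.\<close>

lemma compact_op_on_series:
  defines "T \<equiv> \<lambda>x. if x \<in> S then (\<Sum>k. scaleC (\<alpha> k x) (f k)) else 0"
  shows "compact_op_on S T" "bounded_by S T (\<beta> 0)"
proof -
  show "bounded_by S T (\<beta> 0)"
    using series_tail_bound[of _ 0] by (simp add: bounded_by_def T_def)
  show "compact_op_on S T"
  proof (rule compact_op_on_limit)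
    have "T x \<in> S" if x: "x \<in> S" for x
    proof -
      have "(\<Sum>k<n. scaleC (\<alpha> k x) (f k)) \<in> S" for n
        using f(2) csubspaceD(3)[OF S(1)] by (intro csubspaceD(6)[OF S(1)]) auto
      then have "(\<Sum>k. scaleC (\<alpha> k x) (f k)) \<in> S"
        using closed_sequentially[OF S(2) _ summable_LIMSEQ[OF summable_series[OF x]]] by blast
      then show ?thesis
        using x by (simp add: T_def)
    qed
    then show "T ` S \<subseteq> S"
      by blast
    show "clinear_on S T"
      unfolding clinear_on_def
    proof (intro conjI ballI allI)
      fix x y assume xy: "x \<in> S" "y \<in> S"
      show "T (x + y) = T x + T y"
        using xy csubspaceD(2)[OF S(1) xy] suminf_add[OF summable_series[OF xy(1)] summable_series[OF xy(2)]]
        by (simp add: T_def add scaleC_add_left)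
    next
      fix a x assume x: "x \<in> S"
      show "T (scaleC a x) = scaleC a (T x)"
        using x csubspaceD(3)[OF S(1) x] bounded_linear.suminf[OF bounded_linear_scaleC_right summable_series[OF x], of a]
        by (simp add: T_def sc)
    qed
    show "T x = 0" if "x \<notin> S" for x
      using that by (simp add: T_def)
    fix \<epsilon> :: real assume "\<epsilon> > 0"
    then obtain m where m: "\<beta> m < \<epsilon>"
      using order_tendstoD(2)[OF \<beta>(2)] by (force simp: eventually_sequentially)
    define U where "U x = (\<Sum>k<m. if x \<in> S then scaleC (\<alpha> k x) (f k) else 0)" for x
    have \<alpha>: "cmod (\<alpha> k x) \<le> \<beta> k * norm x" if "x \<in> S" for k x
      using bd[OF that, of k "Suc k"] by (intro power2_le_imp_le[of "cmod (\<alpha> k x)"]) (auto simp: \<beta>(1))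
    have "compact_op_on S U"
      unfolding U_def using \<alpha> by (intro compact_op_on_sum compact_op_on_rank_one S f(2)) (auto simp: add sc)
    moreover have "bounded_by S (\<lambda>x. T x - U x) \<epsilon>"
      using series_tail_bound[of _ m] bounded_by_mono[of S "\<lambda>x. T x - U x" "\<beta> m" \<epsilon>] m
      by (simp add: bounded_by_def T_def U_def)
    ultimately show "\<exists>U. compact_op_on S U \<and> bounded_by S (\<lambda>x. T x - U x) \<epsilon>"
      by blast
  qed
qed

end

text \<open>With \<open>c x\<close> expanded along \<open>e\<close>, the factor \<open>b\<close>
  sends the coefficient of \<open>e k\<close>, divided by \<open>sqrt (q k)\<close>, to
  \<open>f k\<close>, and \<open>a\<close> sends \<open>f k\<close> to \<open>sqrt (q k)\<close>
  times \<open>e k\<close>. Here \<open>q k\<close> is the norm of the \<open>k\<close>-th remainder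
  of \<open>c\<close>: it tends to 0, which makes \<open>a\<close> compact, and it dominates the
  remaining coefficients well enough for \<open>b\<close> to be compact too. The square root bounds
  let blockwise factors of an element of \<open>c0sum\<close> vanish at infinity.\<close>

lemma compact_factorization:
  fixes S :: "'h::chilbert set"
  assumes S: "csubspace S" "closed S" and c: "compact_op_on S c" and dim: "cdim (c ` S) + 2 \<le> cdim S"
  obtains a b where "compact_op_on S a" "compact_op_on S b" "a \<circ> b = c" "a z = 0" "\<And>x. cinner y (b x) = 0"
    "bounded_by S a (sqrt (opnorm_on S c))" "bounded_by S b (sqrt (2 * opnorm_on S c))"
proof -
  note cD = compact_op_onD[OF c]
  obtain e where e: "weak_orthonormal e" "\<And>k. e k \<in> c ` S"
      "\<And>\<epsilon>. \<epsilon> > 0 \<Longrightarrow> \<exists>N. \<forall>n\<ge>N. bounded_by S (\<lambda>x. c x - partial_proj e n (c x)) \<epsilon>"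
    using compact_op_on_gram_schmidt[OF S(1) c] by metis
  obtain f where f: "weak_orthonormal f" "\<And>k. f k \<in> S" "\<And>k. f k = 0 \<longleftrightarrow> e k = 0"
    "\<And>k. cinner y (f k) = 0" "\<And>k. cinner z (f k) = 0"
    using orthonormal_in_complement[OF S(1) e(1,2) dim] by metis
  have eS: "e k \<in> S" for k
    using e(2)[of k] cD(2) by auto
  define r where "r k x = norm (c x - partial_proj e k (c x))" for k x
  define q where "q k = opnorm_on S (\<lambda>x. c x - partial_proj e k (c x))" for k
  have comp: "compact_op_on S (\<lambda>x. c x - partial_proj e k (c x))" for k
  proof -
    have "compact_op_on S ((\<lambda>x. x - partial_proj e k x) \<circ> c)"
    proof (rule compact_op_on_comp[OF S(1) _ _ _ c])
      show "(\<lambda>x. x - partial_proj e k x) ` S \<subseteq> S"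
        by (intro image_subsetI csubspaceD(4)[OF S(1)] partial_proj_mem[OF S(1) eS])
      show "clinear_on S (\<lambda>x. x - partial_proj e k x)"
        by (simp add: clinear_on_def partial_proj_add partial_proj_scaleC scaleC_diff_right)
      show "bounded_by S (\<lambda>x. x - partial_proj e k x) 1"
        by (simp add: bounded_by_def norm_minus_partial_proj_le[OF e(1)])
    qed
    then show ?thesis
      by (simp add: comp_def)
  qed
  have rq: "r k x \<le> q k * norm x" if "x \<in> S" for k x
    using bounded_byD[OF bounded_by_opnorm[OF S(1) comp] that] by (simp add: r_def q_def)
  have q0: "0 \<le> q k" for k
    unfolding q_def by (rule opnorm_nonneg[OF S(1) comp])
  have rdec: "r n x \<le> r m x" if "m \<le> n" for m n x
    unfolding r_def by (rule norm_minus_partial_proj_antimono[OF e(1) that])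
  have qdec: "q n \<le> q m" if "m \<le> n" for m n
  proof -
    have "bounded_by S (\<lambda>x. c x - partial_proj e n (c x)) (q m)"
      using rq[of _ m] rdec[OF that] unfolding bounded_by_def r_def[symmetric] by (meson order_trans)
    then show ?thesis
      using opnorm_le[OF S(1)] q0 by (simp add: q_def[of n])
  qed
  have qlim: "q \<longlonglongrightarrow> 0"
  proof (rule LIMSEQ_I)
    fix \<epsilon> :: real assume "\<epsilon> > 0"
    then obtain N where N: "\<And>n. n \<ge> N \<Longrightarrow> bounded_by S (\<lambda>x. c x - partial_proj e n (c x)) (\<epsilon>/2)"
      using e(3)[of "\<epsilon>/2"] by (metis half_gt_zero)
    have "q n \<le> \<epsilon>/2" if "n \<ge> N" for n
      unfolding q_def using N[OF that] \<open>\<epsilon> > 0\<close> by (intro opnorm_le[OF S(1)]) auto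
    then show "\<exists>N. \<forall>n\<ge>N. norm (q n - 0) < \<epsilon>"
      using q0 \<open>\<epsilon> > 0\<close> by (intro exI[of _ N]) (force simp: abs_of_nonneg)
  qed
  have qc: "q 0 = opnorm_on S c"
    by (simp add: q_def)
  have coeff: "(cmod (cinner (e k) (c x)))\<^sup>2 = (r k x)\<^sup>2 - (r (Suc k) x)\<^sup>2" for k x
    by (simp add: r_def norm_minus_partial_proj[OF e(1)])
  \<comment> \<open>If \<open>q k = 0\<close>, division by zero makes \<open>\<beta> k x\<close>
    equal to 0; for \<open>x\<close> in \<open>S\<close> the coefficient it should carry is then 0
    as well.\<close>
  define \<beta> where "\<beta> k x = cinner (e k) (c x) / of_real (sqrt (q k))" for k x
  define \<alpha> where "\<alpha> k x = of_real (sqrt (q k)) * cinner (f k) x" for k x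
  define a where "a x = (if x \<in> S then (\<Sum>k. scaleC (\<alpha> k x) (e k)) else 0)" for x
  define b where "b x = (if x \<in> S then (\<Sum>k. scaleC (\<beta> k x) (f k)) else 0)" for x
  have \<alpha>lin: "\<alpha> k (x + x') = \<alpha> k x + \<alpha> k x'" "\<alpha> k (scaleC s x) = s * \<alpha> k x" for k x x' s
    by (simp_all add: \<alpha>_def cinner_add_right cinner_scaleC_right algebra_simps)
  have \<beta>lin: "x \<in> S \<Longrightarrow> x' \<in> S \<Longrightarrow> \<beta> k (x + x') = \<beta> k x + \<beta> k x'" "x \<in> S \<Longrightarrow> \<beta> k (scaleC s x) = s * \<beta> k x" for k x x' s
    by (simp_all add: \<beta>_def clinear_onD[OF S(1) cD(1)] cinner_add_right cinner_scaleC_right add_divide_distrib)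
  have \<alpha>bd: "(\<Sum>k=m..<n. (cmod (\<alpha> k x))\<^sup>2) \<le> (sqrt (q m) * norm x)\<^sup>2" for m n x
  proof -
    have "(\<Sum>k=m..<n. (cmod (\<alpha> k x))\<^sup>2) = (\<Sum>k=m..<n. q k * (cmod (cinner (f k) x))\<^sup>2)"
      by (simp add: \<alpha>_def norm_mult power_mult_distrib q0)
    also have "\<dots> \<le> (\<Sum>k=m..<n. q m * (cmod (cinner (f k) x))\<^sup>2)"
      using qdec by (intro sum_mono mult_right_mono) auto
    also have "\<dots> = q m * (\<Sum>k=m..<n. (cmod (cinner (f k) x))\<^sup>2)"
      by (simp add: sum_distrib_left)
    also have "\<dots> \<le> q m * (\<Sum>k<n. (cmod (cinner (f k) x))\<^sup>2)"
      by (intro mult_left_mono sum_mono2 q0) auto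
    also have "\<dots> \<le> q m * (norm x)\<^sup>2"
      by (intro mult_left_mono bessel f(1) q0)
    finally show ?thesis
      by (simp add: power_mult_distrib q0)
  qed
  \<comment> \<open>The coefficients are dominated by the telescoping sum of \<open>2 * norm x * (r k x - r (Suc k) x)\<close>.\<close>
  have \<beta>bd: "(\<Sum>k=m..<n. (cmod (\<beta> k x))\<^sup>2) \<le> (sqrt (2 * q m) * norm x)\<^sup>2" if x: "x \<in> S" and mn: "m \<le> n" for m n x
  proof -
    have "(cmod (\<beta> k x))\<^sup>2 \<le> 2 * norm x * (r k x - r (Suc k) x)" for k
    proof (cases "q k = 0")
      case True
      then show ?thesis
        using rdec[of k "Suc k" x] by (simp add: \<beta>_def)
    next
      case False
      then have "q k > 0"
        using q0[of k] by simp
      have "(cmod (\<beta> k x))\<^sup>2 = ((r k x)\<^sup>2 - (r (Suc k) x)\<^sup>2) / q k"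
        by (simp add: \<beta>_def norm_divide power_divide q0 coeff)
      \<comment> \<open>Difference of two squares: the sum of consecutive remainders is at most
        \<open>2 * q k * norm x\<close>, which cancels the weight and is the origin of the factor 2
        in the bound for \<open>b\<close>.\<close>
      also have "\<dots> = (r k x - r (Suc k) x) * ((r k x + r (Suc k) x) / q k)"
        by (simp add: power2_eq_square algebra_simps)
      also have "\<dots> \<le> (r k x - r (Suc k) x) * (2 * norm x)"
      proof (rule mult_left_mono)
        show "(r k x + r (Suc k) x) / q k \<le> 2 * norm x"
          using rq[OF x, of k] rdec[of k "Suc k" x] \<open>q k > 0\<close> by (simp add: divide_le_eq mult_ac)
        show "0 \<le> r k x - r (Suc k) x"
          using rdec[of k "Suc k" x] by simp
      qed
      finally show ?thesis
        by (simp add: mult_ac)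
    qed
    then have "(\<Sum>k=m..<n. (cmod (\<beta> k x))\<^sup>2) \<le> (\<Sum>k=m..<n. 2 * norm x * (r k x - r (Suc k) x))"
      by (rule sum_mono)
    also have "\<dots> = 2 * norm x * (r m x - r n x)"
      using sum_Suc_diff'[OF mn, of "\<lambda>k. - r k x"] by (simp add: sum_distrib_left[symmetric])
    also have "\<dots> \<le> 2 * norm x * (q m * norm x)"
      using rq[OF x, of m] by (intro mult_left_mono) (auto simp: r_def intro: order_trans[OF _ rq[OF x, of m]])
    also have "\<dots> = (sqrt (2 * q m) * norm x)\<^sup>2"
      by (simp add: power_mult_distrib q0 power2_eq_square)
    finally show ?thesis .
  qed
  have lim\<alpha>: "(\<lambda>m. sqrt (q m)) \<longlonglongrightarrow> 0"
    using tendsto_real_sqrt[OF qlim] by simp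
  have lim\<beta>: "(\<lambda>m. sqrt (2 * q m)) \<longlonglongrightarrow> 0"
    using tendsto_real_sqrt[OF tendsto_mult_right_zero[OF qlim, of 2]] by simp
  have a_eq: "a = (\<lambda>x. if x \<in> S then (\<Sum>k. scaleC (\<alpha> k x) (e k)) else 0)"
    and b_eq: "b = (\<lambda>x. if x \<in> S then (\<Sum>k. scaleC (\<beta> k x) (f k)) else 0)"
    by (auto simp: a_def b_def)
  have a: "compact_op_on S a" "bounded_by S a (sqrt (q 0))"
    unfolding a_eq
    by (rule compact_op_on_series[OF S e(1) eS \<alpha>lin \<alpha>bd _ lim\<alpha>]; simp add: q0)+
  have b: "compact_op_on S b" "bounded_by S b (sqrt (2 * q 0))"
    unfolding b_eq
    by (rule compact_op_on_series[OF S f(1,2) \<beta>lin \<beta>bd _ lim\<beta>]; simp add: q0)+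
  have bsum: "summable (\<lambda>k. scaleC (\<beta> k x) (f k))" if "x \<in> S" for x
    by (rule summable_series[OF S f(1,2) \<beta>lin \<beta>bd _ lim\<beta> that]) (simp_all add: q0)
  have inner_b: "cinner w (b x) = (\<Sum>k. \<beta> k x * cinner w (f k))" if "x \<in> S" for w x
    using bounded_linear.suminf[OF bounded_linear_cinner_right bsum[OF that], of w] that
    by (simp add: b_def cinner_scaleC_right)
  have "cinner y (b x) = 0" for x
    using inner_b[of x y] by (cases "x \<in> S") (auto simp: f(4) b_def)
  moreover have "a z = 0"
  proof -
    have "cinner (f k) z = 0" for k
      using f(5)[of k] by (simp add: cinner_swap_eq_0[of _ z])
    then show ?thesis
      by (simp add: a_def \<alpha>_def)
  qed
  moreover have "a \<circ> b = c"
  proof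
    fix x
    show "(a \<circ> b) x = c x"
    proof (cases "x \<in> S")
      case False
      then show ?thesis
        using cD(3) clinear_onD(1)[OF S(1) compact_op_onD(1)[OF a(1)]] by (simp add: b_def)
    next
      case x: True
      \<comment> \<open>\<open>f j\<close> vanishes exactly where \<open>e j\<close> does, so a
        coefficient lost at a zero vector of \<open>f\<close> would have multiplied a zero vector of
        \<open>e\<close>.\<close>
      have "cinner (f j) (b x) = (if e j = 0 then 0 else \<beta> j x)" for j
      proof -
        have "\<beta> k x * cinner (f j) (f k) = (if k = j then (if e j = 0 then 0 else \<beta> j x) else 0)" for k
          using weak_orthonormal_cinner_scale[OF f(1), of j 1 k] f(3) by auto
        then have "cinner (f j) (b x) = (\<Sum>k. if k = j then (if e j = 0 then 0 else \<beta> j x) else 0)"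
          by (simp only: inner_b[OF x])
        then show ?thesis
          using sums_unique[OF sums_single[of j "\<lambda>_. if e j = 0 then 0 else \<beta> j x"]] by metis
      qed
      moreover have "of_real (sqrt (q k)) * \<beta> k x = cinner (e k) (c x)" for k
      proof (cases "q k = 0")
        case True
        then have "r k x = 0" "r (Suc k) x = 0"
          using rq[OF x, of k] rdec[of k "Suc k" x] by (auto simp: r_def intro: antisym)
        then show ?thesis
          using coeff[of k x] True by simp
      qed (use q0[of k] in \<open>simp add: \<beta>_def\<close>)
      ultimately have "scaleC (\<alpha> k (b x)) (e k) = scaleC (cinner (e k) (c x)) (e k)" for k
        by (auto simp: \<alpha>_def)
      then have "a (b x) = (\<Sum>k. scaleC (cinner (e k) (c x)) (e k))"
        using compact_op_onD(2)[OF b(1) x] by (simp add: a_def)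
      moreover have "(\<lambda>k. scaleC (cinner (e k) (c x)) (e k)) sums c x"
        unfolding sums_def partial_proj_def[symmetric]
      proof (rule LIM_zero_cancel, rule Lim_null_comparison)
        show "(\<lambda>n. q n * norm x) \<longlonglongrightarrow> 0"
          by (rule tendsto_mult_left_zero[OF qlim])
        show "eventually (\<lambda>n. norm (partial_proj e n (c x) - c x) \<le> q n * norm x) sequentially"
          using rq[OF x] by (simp add: r_def norm_minus_commute)
      qed
      ultimately show ?thesis
        by (simp add: sums_unique[symmetric])
    qed
  qed
  ultimately show thesis
    using that a b by (simp add: qc)
qed

subsection \<open>The algebra of block operators\<close>

lemma cinner_partial_proj_commute:
  assumes "weak_orthonormal e"
  shows "cinner (partial_proj e n x) y = cinner x (partial_proj e n y)"
proof -
  have "cinner (partial_proj e n x) y = cinner (partial_proj e n x) (partial_proj e n y)"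
    using cinner_partial_proj_orthogonal[OF assms, of n x y] by (simp add: cinner_diff_right)
  moreover have "cinner (x - partial_proj e n x) (partial_proj e n y) = 0"
    using cinner_partial_proj_orthogonal[OF assms, of n y x] by (subst cinner_swap_eq_0)
  ultimately show ?thesis
    by (simp add: cinner_diff_left)
qed

text \<open>The data come as one triple so that a finite family of rank one operators is a function
  \<open>g\<close> into triples.\<close>

definition elem_op :: "('i \<Rightarrow> 'h::chilbert set) \<Rightarrow> 'i \<times> 'h \<times> 'h \<Rightarrow> 'i \<Rightarrow> 'h \<Rightarrow> 'h" where
  "elem_op H = (\<lambda>(l, u, y) l' x. if l' = l \<and> x \<in> H l then scaleC (cinner y x) u else 0)"

lemma elem_op_apply [simp]:
  "elem_op H (l, u, y) l' x = (if l' = l \<and> x \<in> H l then scaleC (cinner y x) u else 0)"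
  by (simp add: elem_op_def)

locale hilbert_blocks =
  fixes H :: "'i \<Rightarrow> 'h::chilbert set"
  assumes sub: "csubspace (H l)" and closed_H: "closed (H l)"
begin

abbreviation A where "A \<equiv> c0sum H"
abbreviation E where "E \<equiv> elem_op H"

definition bdd_by :: "('i \<Rightarrow> 'h \<Rightarrow> 'h) \<Rightarrow> real \<Rightarrow> bool" where
  "bdd_by a M \<longleftrightarrow> (\<forall>l. bounded_by (H l) (a l) M)"

lemma bdd_byD: "bdd_by a M \<Longrightarrow> x \<in> H l \<Longrightarrow> norm (a l x) \<le> M * norm x"
  by (simp add: bdd_by_def bounded_by_def)

lemma bdd_byI: "(\<And>l x. x \<in> H l \<Longrightarrow> norm (a l x) \<le> M * norm x) \<Longrightarrow> bdd_by a M"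
  by (simp add: bdd_by_def bounded_by_def)

text \<open>The limit along the cofinite filter is unfolded once, so that later membership proofs
  compare finite sets of exceptional blocks. Halving \<open>\<epsilon>\<close> mediates between the
  strict inequality of the limit and the weak one of \<open>bounded_by\<close>.\<close>

lemma c0sum_iff:
  "a \<in> A \<longleftrightarrow> (\<forall>l. compact_op_on (H l) (a l)) \<and> (\<forall>\<epsilon>>0. finite {l. \<not> bounded_by (H l) (a l) \<epsilon>})"
proof (cases "\<forall>l. compact_op_on (H l) (a l)")
  case True
  then have comp: "compact_op_on (H l) (a l)" for l
    by blast
  have bb: "bounded_by (H l) (a l) \<epsilon> \<longleftrightarrow> opnorm_on (H l) (a l) \<le> \<epsilon>" if "\<epsilon> > 0" for l \<epsilon>
    using opnorm_le[OF sub, of l "a l" \<epsilon>] bounded_by_mono[OF bounded_by_opnorm[OF sub comp], of l \<epsilon>] that by auto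
  have nn: "0 \<le> opnorm_on (H l) (a l)" for l
    by (rule opnorm_nonneg[OF sub comp])
  have "((\<lambda>l. opnorm_on (H l) (a l)) \<longlongrightarrow> 0) cofinite \<longleftrightarrow> (\<forall>\<epsilon>>0. finite {l. \<not> opnorm_on (H l) (a l) < \<epsilon>})"
    unfolding tendsto_iff eventually_cofinite using nn by simp
  also have "\<dots> \<longleftrightarrow> (\<forall>\<epsilon>>0. finite {l. \<not> opnorm_on (H l) (a l) \<le> \<epsilon>})"
  proof (intro iffI allI impI)
    fix \<epsilon> :: real assume *: "\<forall>\<epsilon>>0. finite {l. \<not> opnorm_on (H l) (a l) < \<epsilon>}" and "\<epsilon> > 0"
    then have "finite {l. \<not> opnorm_on (H l) (a l) < \<epsilon>}"
      by blast
    then show "finite {l. \<not> opnorm_on (H l) (a l) \<le> \<epsilon>}"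
      by (rule rev_finite_subset) auto
  next
    fix \<epsilon> :: real assume *: "\<forall>\<epsilon>>0. finite {l. \<not> opnorm_on (H l) (a l) \<le> \<epsilon>}" and "\<epsilon> > 0"
    then have "finite {l. \<not> opnorm_on (H l) (a l) \<le> \<epsilon>/2}"
      by (metis half_gt_zero)
    then show "finite {l. \<not> opnorm_on (H l) (a l) < \<epsilon>}"
      by (rule rev_finite_subset) (use \<open>\<epsilon> > 0\<close> in auto)
  qed
  also have "\<dots> \<longleftrightarrow> (\<forall>\<epsilon>>0. finite {l. \<not> bounded_by (H l) (a l) \<epsilon>})"
    by (simp add: bb)
  finally show ?thesis
    using True by (simp add: c0sum_def)
next
  case False
  then show ?thesis
    unfolding c0sum_def by blast
qed

lemma c0sum_compact: "a \<in> A \<Longrightarrow> compact_op_on (H l) (a l)"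
  by (simp add: c0sum_def)

lemma c0sum_linear: "a \<in> A \<Longrightarrow> clinear_on (H l) (a l)"
  using c0sum_compact compact_op_onD(1) by blast

lemma c0sum_mem: "a \<in> A \<Longrightarrow> x \<in> H l \<Longrightarrow> a l x \<in> H l"
  using c0sum_compact compact_op_onD(2) by blast

lemma c0sum_outside: "a \<in> A \<Longrightarrow> x \<notin> H l \<Longrightarrow> a l x = 0"
  using c0sum_compact compact_op_onD(3) by blast

lemma c0sum_at_0: "a \<in> A \<Longrightarrow> a l 0 = 0"
  using clinear_onD(1)[OF sub c0sum_linear] .

lemma c0sum_eqI:
  assumes "a \<in> A" "b \<in> A" "\<And>l x. x \<in> H l \<Longrightarrow> a l x = b l x"
  shows "a = b"
proof (intro ext)
  fix l x
  show "a l x = b l x"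
    using assms(3)[of x l] c0sum_outside[OF assms(1), of x l] c0sum_outside[OF assms(2), of x l]
    by (cases "x \<in> H l") auto
qed

text \<open>Only finitely many blocks exceed the bound 1, and the sum of their operator norms covers
  each of them.\<close>

lemma c0sum_bounded:
  assumes "a \<in> A"
  obtains M where "0 \<le> M" "bdd_by a M"
proof -
  let ?F = "{l. \<not> bounded_by (H l) (a l) 1}"
  have fin: "finite ?F"
    using assms c0sum_iff by auto
  have nn: "0 \<le> opnorm_on (H l) (a l)" for l
    by (rule opnorm_nonneg[OF sub c0sum_compact[OF assms]])
  define M where "M = 1 + (\<Sum>l\<in>?F. opnorm_on (H l) (a l))"
  have M: "1 \<le> M"
    unfolding M_def using nn by (simp add: sum_nonneg)
  have "bounded_by (H l) (a l) M" for l
  proof (cases "l \<in> ?F")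
    case True
    then have "opnorm_on (H l) (a l) \<le> (\<Sum>l\<in>?F. opnorm_on (H l) (a l))"
      using member_le_sum[OF True _ fin, of "\<lambda>l. opnorm_on (H l) (a l)"] nn by blast
    then have "opnorm_on (H l) (a l) \<le> M"
      by (simp add: M_def)
    then show ?thesis
      by (rule bounded_by_mono[OF bounded_by_opnorm[OF sub c0sum_compact[OF assms]]])
  qed (use M bounded_by_mono in blast)
  then show thesis
    using that[of M] M by (simp add: bdd_by_def)
qed

lemma c0norm_le:
  assumes "bdd_by a M" "0 \<le> M"
  shows "c0norm H a \<le> M"
  unfolding c0norm_def using assms by (intro cSUP_least opnorm_le sub) (auto simp: bdd_by_def)

lemma c0norm_nonneg:
  assumes "a \<in> A"
  shows "0 \<le> c0norm H a"
proof -
  obtain M where M: "0 \<le> M" "bdd_by a M"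
    using c0sum_bounded[OF assms] .
  have "bdd_above (range (\<lambda>l. opnorm_on (H l) (a l)))"
    unfolding bdd_above_def using opnorm_le[OF sub] M by (auto simp: bdd_by_def intro!: exI[of _ M])
  then show ?thesis
    unfolding c0norm_def using opnorm_nonneg[OF sub c0sum_compact[OF assms]] by (intro cSUP_upper2) auto
qed

section \<open>Closure of \<open>A\<close> under the algebra operations and block scalars\<close>

lemma c0sum_zero: "(\<lambda>l x. 0) \<in> A"
  by (simp add: c0sum_iff compact_op_on_zero sub bounded_by_def)

lemma c0sum_add:
  assumes "a \<in> A" "b \<in> A"
  shows "(\<lambda>l x. a l x + b l x) \<in> A"
  unfolding c0sum_iff
proof (intro conjI allI impI)
  show "compact_op_on (H l) (\<lambda>x. a l x + b l x)" for l
    by (intro compact_op_on_add sub c0sum_compact assms)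
  fix \<epsilon> :: real assume "\<epsilon> > 0"
  then have "finite ({l. \<not> bounded_by (H l) (a l) (\<epsilon>/2)} \<union> {l. \<not> bounded_by (H l) (b l) (\<epsilon>/2)})"
    using assms c0sum_iff by simp
  then show "finite {l. \<not> bounded_by (H l) (\<lambda>x. a l x + b l x) \<epsilon>}"
  proof (rule rev_finite_subset)
    show "{l. \<not> bounded_by (H l) (\<lambda>x. a l x + b l x) \<epsilon>}
      \<subseteq> {l. \<not> bounded_by (H l) (a l) (\<epsilon>/2)} \<union> {l. \<not> bounded_by (H l) (b l) (\<epsilon>/2)}"
      using bounded_by_add[of _ _ "\<epsilon>/2" _ "\<epsilon>/2"] by (auto simp: field_sum_of_halves)
  qed
qed

text \<open>Block scalars act as central multipliers; constant families give \<open>c0scale\<close>,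
  and the families \<mu> and 1/\<mu> describe the twist that separates \<open>\<phi>\<close> from a
  homomorphism.\<close>

definition diag :: "('i \<Rightarrow> complex) \<Rightarrow> ('i \<Rightarrow> 'h \<Rightarrow> 'h) \<Rightarrow> 'i \<Rightarrow> 'h \<Rightarrow> 'h" where
  "diag m a = (\<lambda>l x. scaleC (m l) (a l x))"

lemma diag_apply [simp]: "diag m a l x = scaleC (m l) (a l x)"
  by (simp add: diag_def)

lemma bdd_by_diag:
  assumes "bdd_by a N" "\<And>l. cmod (m l) \<le> M"
  shows "bdd_by (diag m a) (M * N)"
proof (rule bdd_byI)
  fix l x assume "x \<in> H l"
  then show "norm (diag m a l x) \<le> M * N * norm x"
    using mult_mono[OF assms(2)[of l] bdd_byD[OF assms(1)]] order_trans[OF norm_ge_zero assms(2)]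
    by (simp add: norm_scaleC mult.assoc)
qed

lemma c0sum_diag:
  assumes "a \<in> A" "\<And>l. cmod (m l) \<le> M"
  shows "diag m a \<in> A"
  unfolding c0sum_iff
proof (intro conjI allI impI)
  show "compact_op_on (H l) (diag m a l)" for l
    using compact_op_on_scale[OF sub c0sum_compact[OF assms(1)], of l "m l"] by (simp add: diag_def)
  fix \<epsilon> :: real assume "\<epsilon> > 0"
  define N where "N = M + 1"
  have N: "N > 0" "\<And>l. cmod (m l) \<le> N"
    using assms(2) order_trans[OF norm_ge_zero assms(2)] by (auto simp: N_def add_increasing2 intro: add_nonneg_pos)
  then have "finite {l. \<not> bounded_by (H l) (a l) (\<epsilon>/N)}"
    using assms(1) \<open>\<epsilon> > 0\<close> c0sum_iff by simp
  then show "finite {l. \<not> bounded_by (H l) (diag m a l) \<epsilon>}"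
  proof (rule rev_finite_subset)
    have "bounded_by (H l) (diag m a l) \<epsilon>" if "bounded_by (H l) (a l) (\<epsilon>/N)" for l
      unfolding bounded_by_def
    proof
      fix x assume "x \<in> H l"
      then have "cmod (m l) * norm (a l x) \<le> N * (\<epsilon>/N * norm x)"
        using that N by (intro mult_mono) (auto simp: bounded_by_def)
      then show "norm (diag m a l x) \<le> \<epsilon> * norm x"
        using N(1) by (simp add: norm_scaleC)
    qed
    then show "{l. \<not> bounded_by (H l) (diag m a l) \<epsilon>} \<subseteq> {l. \<not> bounded_by (H l) (a l) (\<epsilon>/N)}"
      by blast
  qed
qed

lemma c0scale_eq_diag: "c0scale z a = diag (\<lambda>_. z) a"
  by (simp add: c0scale_def diag_def)

lemma c0sum_scale: "a \<in> A \<Longrightarrow> c0scale z a \<in> A"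
  unfolding c0scale_eq_diag by (rule c0sum_diag[where M = "cmod z"]) auto

lemma c0sum_diff:
  assumes "a \<in> A" "b \<in> A"
  shows "(\<lambda>l x. a l x - b l x) \<in> A"
  using c0sum_add[OF assms(1) c0sum_scale[OF assms(2), of "-1"]] by (simp add: c0scale_def scaleC_minus_one)

lemma c0sum_mult:
  assumes "a \<in> A" "b \<in> A"
  shows "c0mult a b \<in> A"
proof -
  obtain M where M: "0 \<le> M" "bdd_by a M"
    using c0sum_bounded[OF assms(1)] .
  have bH: "b l ` H l \<subseteq> H l" "a l ` H l \<subseteq> H l" for l
    using c0sum_mem assms by auto
  have aM: "bounded_by (H l) (a l) (M + 1)" for l
    using bounded_by_mono[of "H l" "a l" M "M + 1"] M(2) by (simp add: bdd_by_def)
  show ?thesis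
    unfolding c0sum_iff c0mult_def
  proof (intro conjI allI impI)
    show "compact_op_on (H l) (a l \<circ> b l)" for l
      by (intro compact_op_on_comp[OF sub bH(2) c0sum_linear aM c0sum_compact] assms)
    fix \<epsilon> :: real assume "\<epsilon> > 0"
    then have "finite {l. \<not> bounded_by (H l) (b l) (\<epsilon>/(M + 1))}"
      using assms(2) M(1) c0sum_iff by simp
    then show "finite {l. \<not> bounded_by (H l) (a l \<circ> b l) \<epsilon>}"
    proof (rule rev_finite_subset)
      have "bounded_by (H l) (a l \<circ> b l) \<epsilon>" if "bounded_by (H l) (b l) (\<epsilon>/(M + 1))" for l
        using bounded_by_comp[OF aM that bH(1)] M(1) by simp
      then show "{l. \<not> bounded_by (H l) (a l \<circ> b l) \<epsilon>} \<subseteq> {l. \<not> bounded_by (H l) (b l) (\<epsilon>/(M + 1))}"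
        by blast
    qed
  qed
qed

lemma c0sum_finite_support:
  assumes "\<And>l. compact_op_on (H l) (a l)" "finite F" "\<And>l x. l \<notin> F \<Longrightarrow> a l x = 0"
  shows "a \<in> A"
  unfolding c0sum_iff
proof (intro conjI allI impI)
  fix \<epsilon> :: real assume "\<epsilon> > 0"
  then have "bounded_by (H l) (a l) \<epsilon>" if "l \<notin> F" for l
    by (simp add: bounded_by_def assms(3)[OF that])
  then have "{l. \<not> bounded_by (H l) (a l) \<epsilon>} \<subseteq> F"
    by blast
  then show "finite {l. \<not> bounded_by (H l) (a l) \<epsilon>}"
    using assms(2) finite_subset by blast
qed (rule assms(1))

section \<open>Rank one operators and finite rank approximation\<close>

lemma elem_op_mem:
  assumes "u \<in> H l"
  shows "E (l, u, y) \<in> A"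
proof (rule c0sum_finite_support)
  show "compact_op_on (H l') (E (l, u, y) l')" for l'
  proof (cases "l' = l")
    case True
    have "compact_op_on (H l) (\<lambda>x. if x \<in> H l then scaleC (cinner y x) u else 0)"
      using cauchy_schwarz[of y] by (intro compact_op_on_rank_one[where M = "norm y"] sub assms)
        (auto simp: cinner_add_right cinner_scaleC_right)
    then show ?thesis
      using True by (simp add: elem_op_def)
  qed (simp add: elem_op_def compact_op_on_zero sub)
  show "\<And>l' x. l' \<notin> {l} \<Longrightarrow> E (l, u, y) l' x = 0"
    by simp
qed simp

lemma bdd_by_elem_op: "bdd_by (E (l, u, y)) (norm u * norm y)"
proof (rule bdd_byI)
  fix l' x assume "x \<in> H l'"
  show "norm (E (l, u, y) l' x) \<le> norm u * norm y * norm x"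
    using mult_right_mono[OF cauchy_schwarz[of y x], of "norm u"] by (auto simp: norm_scaleC mult_ac)
qed

text \<open>Indices are pairs of a block and a position in it, since each exceptional block
  contributes its own number of summands.\<close>

abbreviation elem_sum :: "('i \<times> nat) set \<Rightarrow> ('i \<times> nat \<Rightarrow> 'i \<times> 'h \<times> 'h) \<Rightarrow> 'i \<Rightarrow> 'h \<Rightarrow> 'h" where
  "elem_sum I g \<equiv> \<lambda>l x. \<Sum>i\<in>I. E (g i) l x"

lemma c0sum_sum_elem:
  assumes "finite I" "\<And>i. i \<in> I \<Longrightarrow> case g i of (l, u, y) \<Rightarrow> u \<in> H l"
  shows "elem_sum I g \<in> A"
  using assms
proof (induction I rule: finite_induct)
  case (insert i I)
  obtain l u y where g: "g i = (l, u, y)"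
    by (cases "g i") auto
  then have "E (g i) \<in> A"
    using insert.prems[of i] elem_op_mem[of u l y] by simp
  then show ?case
    using c0sum_add[of "E (g i)"] insert by simp
qed (simp add: c0sum_zero)

text \<open>The range and kernel conditions let zero products descend to summands: when
  \<open>a b = 0\<close>, the range of \<open>b\<close> lies in the kernel of \<open>a\<close>, so
  in a common block each \<open>y\<close> from a family for \<open>a\<close> is orthogonal to each
  \<open>u\<close> from a family for \<open>b\<close>.\<close>

definition elem_family :: "('i \<Rightarrow> 'h \<Rightarrow> 'h) \<Rightarrow> ('i \<times> nat) set \<Rightarrow> ('i \<times> nat \<Rightarrow> 'i \<times> 'h \<times> 'h) \<Rightarrow> bool" where
  "elem_family a I g \<longleftrightarrow> finite I \<and> (\<forall>i\<in>I. \<forall>l u y. g i = (l, u, y) \<longrightarrow>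
     u \<in> a l ` H l \<and> y \<in> H l \<and> (\<forall>x\<in>H l. a l x = 0 \<longrightarrow> cinner y x = 0))"

lemma elem_familyD:
  assumes "elem_family a I g" "i \<in> I" "g i = (l, u, y)"
  shows "u \<in> a l ` H l" "y \<in> H l" "\<And>x. x \<in> H l \<Longrightarrow> a l x = 0 \<Longrightarrow> cinner y x = 0" "a \<in> A \<Longrightarrow> u \<in> H l"
proof -
  show "u \<in> a l ` H l" "y \<in> H l" "\<And>x. x \<in> H l \<Longrightarrow> a l x = 0 \<Longrightarrow> cinner y x = 0"
    using assms by (auto simp: elem_family_def)
  then show "u \<in> H l" if "a \<in> A"
    using c0sum_mem[OF that] by blast
qed

lemma elem_family_case:
  assumes "elem_family a I g" "a \<in> A" "i \<in> I"
  shows "case g i of (l, u, y) \<Rightarrow> u \<in> H l"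
  using elem_familyD(4)[OF assms(1,3) _ assms(2)] by (auto split: prod.splits)

lemma elem_family_finite: "elem_family a I g \<Longrightarrow> finite I"
  by (simp add: elem_family_def)

lemma elem_sum_mem: "elem_family a I g \<Longrightarrow> a \<in> A \<Longrightarrow> elem_sum I g \<in> A"
  by (rule c0sum_sum_elem[OF elem_family_finite elem_family_case])

text \<open>Blocks in which \<open>a\<close> is bounded by \<open>\<epsilon>\<close> are dropped; in
  the finitely many others \<open>a\<close> is followed by a partial projection along a Gram-Schmidt
  sequence of its range. The \<open>k\<close>-th term has \<open>u = e l k\<close>, and its
  \<open>y\<close> is the adjoint of \<open>a l\<close> at \<open>e l k\<close>, which comes from
  Riesz representation and is orthogonal to the kernel of \<open>a l\<close>.\<close>

lemma c0sum_approx: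
  assumes a: "a \<in> A" and "\<epsilon> > 0"
  shows "\<exists>I g. elem_family a I g \<and> bdd_by (\<lambda>l x. a l x - elem_sum I g l x) \<epsilon>"
proof -
  note lin = clinear_onD[OF sub c0sum_linear[OF a]]
  have "\<exists>e n. weak_orthonormal e \<and> (\<forall>k. e k \<in> a l ` H l) \<and>
      bounded_by (H l) (\<lambda>x. a l x - partial_proj e n (a l x)) \<epsilon>" for l
    using compact_op_on_gram_schmidt[OF sub c0sum_compact[OF a], of l] \<open>\<epsilon> > 0\<close> by (metis order_refl)
  then obtain e N where e: "\<And>l. weak_orthonormal (e l)" "\<And>l k. e l k \<in> a l ` H l"
      "\<And>l. bounded_by (H l) (\<lambda>x. a l x - partial_proj (e l) (N l) (a l x)) \<epsilon>"
    by metis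
  obtain M where M: "0 \<le> M" "bdd_by a M"
    using c0sum_bounded[OF a] .
  have "\<exists>y\<in>H l. \<forall>x\<in>H l. cinner (e l k) (a l x) = cinner y x" for l k
  proof (rule riesz_representation[OF sub closed_H])
    show "cmod (cinner (e l k) (a l x)) \<le> norm (e l k) * M * norm x" if "x \<in> H l" for x
      using cauchy_schwarz[of "e l k" "a l x"] mult_left_mono[OF bdd_byD[OF M(2) that], of "norm (e l k)"]
      by (simp add: mult.assoc)
  qed (simp_all add: lin cinner_add_right cinner_scaleC_right)
  then obtain y where y: "\<And>l k. y l k \<in> H l" "\<And>l k x. x \<in> H l \<Longrightarrow> cinner (e l k) (a l x) = cinner (y l k) x"
    by metis
  define F where "F = {l. \<not> bounded_by (H l) (a l) \<epsilon>}"
  have F: "finite F"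
    using a \<open>\<epsilon> > 0\<close> by (auto simp: F_def c0sum_iff)
  define I where "I = Sigma F (\<lambda>l. {..<N l})"
  define g where "g = (\<lambda>(l, k). (l, e l k, y l k))"
  have sum: "(\<Sum>i\<in>I. E (g i) l x) = (if l \<in> F then partial_proj (e l) (N l) (a l x) else 0)" if x: "x \<in> H l" for l x
  proof -
    have "(\<Sum>i\<in>I. E (g i) l x) = (\<Sum>l'\<in>F. \<Sum>k<N l'. E (g (l', k)) l x)"
      unfolding I_def using F by (subst sum.Sigma) auto
    also have "\<dots> = (\<Sum>l'\<in>F. if l = l' then partial_proj (e l) (N l) (a l x) else 0)"
      using x by (intro sum.cong) (auto simp: g_def partial_proj_def y(2))
    also have "\<dots> = (if l \<in> F then partial_proj (e l) (N l) (a l x) else 0)"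
      using F by simp
    finally show ?thesis .
  qed
  have "bdd_by (\<lambda>l x. a l x - elem_sum I g l x) \<epsilon>"
  proof (rule bdd_byI)
    fix l x assume x: "x \<in> H l"
    show "norm (a l x - (\<Sum>i\<in>I. E (g i) l x)) \<le> \<epsilon> * norm x"
      using bounded_byD[OF e(3) x] x by (auto simp: sum F_def bounded_by_def)
  qed
  moreover have "elem_family a I g"
    unfolding elem_family_def
  proof (intro conjI ballI allI impI)
    show "finite I"
      using F by (auto simp: I_def)
    fix i l u w assume "i \<in> I" "g i = (l, u, w)"
    then obtain k where "u = e l k" "w = y l k"
      by (auto simp: g_def split: prod.splits)
    then show "u \<in> a l ` H l" "w \<in> H l" "\<And>x. x \<in> H l \<Longrightarrow> a l x = 0 \<Longrightarrow> cinner w x = 0"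
      using e(2) y by (auto simp flip: y(2))
  qed
  ultimately show ?thesis
    by blast
qed

section \<open>Approximate units of finite rank projections\<close>

definition proj_op :: "('i \<Rightarrow> nat \<Rightarrow> 'h) \<Rightarrow> ('i \<Rightarrow> nat) \<Rightarrow> 'i \<Rightarrow> 'h \<Rightarrow> 'h" where
  "proj_op e n = (\<lambda>l x. if x \<in> H l then partial_proj (e l) (n l) x else 0)"

lemma proj_op_mem:
  assumes "\<And>l k. e l k \<in> H l" "finite {l. n l \<noteq> 0}"
  shows "proj_op e n \<in> A"
proof (rule c0sum_finite_support)
  show "compact_op_on (H l) (proj_op e n l)" for l
  proof -
    have "proj_op e n l = (\<lambda>x. \<Sum>k<n l. if x \<in> H l then scaleC (cinner (e l k) x) (e l k) else 0)"
      by (auto simp: proj_op_def partial_proj_def)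
    moreover have "compact_op_on (H l) \<dots>"
      using cauchy_schwarz by (intro compact_op_on_sum compact_op_on_rank_one[where M = "norm (e l _)"] sub assms(1))
        (auto simp: cinner_add_right cinner_scaleC_right)
    ultimately show ?thesis
      by simp
  qed
qed (use assms(2) in \<open>auto simp: proj_op_def\<close>)

text \<open>Each \<open>d\<close> is close to a finite sum of rank one operators, and the projection
  onto the span of all vectors \<open>u\<close> and \<open>y\<close> in these sums fixes the sums
  from both sides: on the left because it fixes \<open>u\<close>, on the right because it is
  self-adjoint and fixes \<open>y\<close>.\<close>

lemma approximate_unit:
  assumes D: "finite D" "D \<subseteq> A" and "\<epsilon> > 0"
  obtains e n where "\<forall>l. weak_orthonormal (e l)" "\<forall>l k. e l k \<in> H l" "proj_op e n \<in> A"
    "\<forall>d\<in>D. bdd_by (\<lambda>l x. proj_op e n l (d l x) - d l x) \<epsilon>"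
    "\<forall>d\<in>D. bdd_by (\<lambda>l x. d l (proj_op e n l x) - d l x) \<epsilon>"
proof -
  have "\<forall>d\<in>D. \<exists>I g. elem_family d I g \<and> bdd_by (\<lambda>l x. d l x - elem_sum I g l x) \<epsilon>"
    using c0sum_approx \<open>\<epsilon> > 0\<close> D(2) by blast
  then obtain I g where I: "\<forall>d\<in>D. elem_family d (I d) (g d) \<and> bdd_by (\<lambda>l x. d l x - elem_sum (I d) (g d) l x) \<epsilon>"
    unfolding bchoice_iff by (elim exE) (rule that)
  have fam: "elem_family d (I d) (g d)" and Ibd: "bdd_by (\<lambda>l x. d l x - elem_sum (I d) (g d) l x) \<epsilon>"
    and DA: "d \<in> A" if "d \<in> D" for d
    using I that D(2) by auto
  define G where "G = (\<Union>d\<in>D. g d ` I d)"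
  have G1: "finite G"
    using D(1) elem_family_finite[OF fam] by (simp add: G_def)
  have G2: "u \<in> H l \<and> y \<in> H l" if "(l, u, y) \<in> G" for l u y
  proof -
    obtain d i where "d \<in> D" "i \<in> I d" "(l, u, y) = g d i"
      using \<open>(l, u, y) \<in> G\<close> unfolding G_def by blast
    then show ?thesis
      using elem_familyD(2,4)[OF fam, of d i l u y] DA by simp
  qed
  note G = G1 G2
  define V where "V l = {v. \<exists>w. (l, v, w) \<in> G \<or> (l, w, v) \<in> G}" for l
  have V: "V l \<subseteq> H l" "finite (V l)" "V l \<noteq> {} \<Longrightarrow> l \<in> fst ` G" for l
  proof -
    show "V l \<subseteq> H l" "V l \<noteq> {} \<Longrightarrow> l \<in> fst ` G"
      using G(2) by (force simp: V_def)+
    have "V l \<subseteq> (fst \<circ> snd) ` G \<union> (snd \<circ> snd) ` G"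
      by (force simp: V_def)
    then show "finite (V l)"
      using G(1) by (meson finite_UnI finite_imageI finite_subset)
  qed
  \<comment> \<open>Blocks without vectors get \<open>n = 0\<close>, which keeps the support of the
    projection finite.\<close>
  have "\<forall>l. \<exists>e n. weak_orthonormal e \<and> (\<forall>k. e k \<in> H l) \<and> (V l = {} \<longrightarrow> n = 0) \<and> (\<forall>v\<in>V l. partial_proj e n v = v)"
  proof
    fix l
    obtain vs where vs: "set vs = V l"
      using finite_list[OF V(2)] by blast
    define s where "s k = (if k < length vs then vs ! k else 0)" for k
    have s: "s k \<in> H l" for k
      using V(1)[of l] vs csubspaceD(1)[OF sub[of l]] nth_mem[of k vs] by (auto simp: s_def)
    have "partial_proj (gram_schmidt s) (length vs) v = v" if v: "v \<in> V l" for v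
    proof -
      obtain k where "k < length vs" "v = vs ! k"
        using v vs by (metis in_set_conv_nth)
      then show ?thesis
        using partial_proj_gram_schmidt[of k "length vs" s] by (simp add: s_def)
    qed
    then show "\<exists>e n. weak_orthonormal e \<and> (\<forall>k. e k \<in> H l) \<and> (V l = {} \<longrightarrow> n = 0) \<and> (\<forall>v\<in>V l. partial_proj e n v = v)"
      using weak_orthonormal_gram_schmidt[of s] gram_schmidt_mem[OF sub s] vs
      by (intro exI[of _ "gram_schmidt s"] exI[of _ "length vs"]) auto
  qed
  then obtain e n where en: "\<forall>l. weak_orthonormal (e l) \<and> (\<forall>k. e l k \<in> H l) \<and> (V l = {} \<longrightarrow> n l = 0) \<and>
      (\<forall>v\<in>V l. partial_proj (e l) (n l) v = v)"
    unfolding choice_iff by (elim exE) (rule that)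
  note en = spec[OF en]
  note e = en[THEN conjunct1] en[THEN conjunct2, THEN conjunct1, THEN spec]
    en[THEN conjunct2, THEN conjunct2, THEN conjunct1, THEN mp]
    en[THEN conjunct2, THEN conjunct2, THEN conjunct2, THEN bspec]
  let ?p = "proj_op e n"
  have p: "?p l x = partial_proj (e l) (n l) x" "?p l x \<in> H l" if "x \<in> H l" for l x
    using that partial_proj_mem[OF sub e(2)] by (simp_all add: proj_op_def)
  have "{l. n l \<noteq> 0} \<subseteq> fst ` G"
  proof
    fix l assume "l \<in> {l. n l \<noteq> 0}"
    then have "V l \<noteq> {}"
      using e(3)[of l] by auto
    then show "l \<in> fst ` G"
      by (rule V(3))
  qed
  then have "finite {l. n l \<noteq> 0}"
    using G(1) finite_subset by blast
  then have pA: "?p \<in> A"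
    by (intro proj_op_mem e(2))
  define d' where "d' d l x = (\<Sum>i\<in>I d. E (g d i) l x)" for d l x
  have E: "partial_proj (e l) (n l) (E (g d i) l x) = E (g d i) l x \<and> E (g d i) l (?p l x) = E (g d i) l x"
    if "d \<in> D" "i \<in> I d" "x \<in> H l" for d i l x
  proof -
    obtain l' u y where g: "g d i = (l', u, y)"
      by (cases "g d i") auto
    then have "(l', u, y) \<in> G"
      using that by (force simp: G_def)
    then have "u \<in> V l'" "y \<in> V l'"
      by (auto simp: V_def)
    then have P: "partial_proj (e l') (n l') u = u" "partial_proj (e l') (n l') y = y"
      using e(4) by auto
    then have "cinner y (partial_proj (e l') (n l') x) = cinner y x"
      using cinner_partial_proj_commute[OF e(1), of l' "n l'" y x] by simp
    moreover have "partial_proj (e l) (n l) 0 = 0"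
      by (simp add: partial_proj_def)
    ultimately show ?thesis
      using that(3) P p[OF that(3)] by (auto simp: g partial_proj_scaleC)
  qed
  have pd': "partial_proj (e l) (n l) (d' d l x) = d' d l x" "d' d l (?p l x) = d' d l x"
    if "d \<in> D" "x \<in> H l" for d l x
  proof -
    have "partial_proj (e l) (n l) (sum f J) = (\<Sum>j\<in>J. partial_proj (e l) (n l) (f j))" for f :: "'i \<times> nat \<Rightarrow> 'h" and J
      by (induction J rule: infinite_finite_induct) (auto simp: partial_proj_add partial_proj_def[of _ _ 0])
    then show "partial_proj (e l) (n l) (d' d l x) = d' d l x" "d' d l (?p l x) = d' d l x"
      unfolding d'_def using E[OF that(1) _ that(2)] by (auto intro!: sum.cong)
  qed
  have near: "norm (d l x - d' d l x) \<le> \<epsilon> * norm x" if "d \<in> D" "x \<in> H l" for d l x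
    using bdd_byD[OF Ibd[OF that(1)] that(2)] by (simp add: d'_def)
  show thesis
  proof (rule that[of e n])
    show "\<forall>l. weak_orthonormal (e l)" "\<forall>l k. e l k \<in> H l" "?p \<in> A"
      using e(1,2) pA by auto
    show "\<forall>d\<in>D. bdd_by (\<lambda>l x. ?p l (d l x) - d l x) \<epsilon>"
    proof (intro ballI)
      fix d assume d: "d \<in> D"
      show "bdd_by (\<lambda>l x. ?p l (d l x) - d l x) \<epsilon>"
      proof (rule bdd_byI)
        fix l x assume x: "x \<in> H l"
        let ?w = "d l x - d' d l x"
        \<comment> \<open>The approximating sum is fixed by \<open>?p\<close> and drops out,
          leaving, up to sign, the complementary projection of the error \<open>?w\<close>.\<close>
        have "?p l (d l x) - d l x = partial_proj (e l) (n l) ?w - ?w"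
          using pd'(1)[OF d x] p(1)[OF c0sum_mem[OF DA[OF d] x]] by (simp add: partial_proj_diff)
        then have "norm (?p l (d l x) - d l x) \<le> norm ?w"
          using norm_minus_partial_proj_le[OF e(1), of ?w l "n l"] by (simp only: norm_minus_commute)
        then show "norm (?p l (d l x) - d l x) \<le> \<epsilon> * norm x"
          using near[OF d x] by linarith
      qed
    qed
    show "\<forall>d\<in>D. bdd_by (\<lambda>l x. d l (?p l x) - d l x) \<epsilon>"
    proof (intro ballI)
      fix d assume d: "d \<in> D"
      show "bdd_by (\<lambda>l x. d l (?p l x) - d l x) \<epsilon>"
      proof (rule bdd_byI)
        fix l x assume x: "x \<in> H l"
        \<comment> \<open>The approximating sum annihilates \<open>?z\<close>, so \<open>d\<close>
          acts on it only through the error, and \<open>norm ?z \<le> norm x\<close>.\<close>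
        let ?z = "?p l x - x"
        have z: "?z \<in> H l"
          using p(2)[OF x] x csubspaceD(4)[OF sub] by blast
        have "d' d l ?z = d' d l (?p l x) - d' d l x"
        proof -
          have "d' d l \<in> {T. clinear_on (H l) T}"
          proof -
            have "elem_sum (I d) (g d) \<in> A"
              by (rule elem_sum_mem[OF fam[OF d] DA[OF d]])
            then show ?thesis
              using c0sum_linear[of "d' d" l] by (simp add: d'_def[abs_def])
          qed
          then show ?thesis
            using clinear_onD(3)[OF sub _ p(2)[OF x] x] by blast
        qed
        then have "d' d l ?z = 0"
          using pd'(2)[OF d x] by simp
        then have "norm (d l ?z) \<le> \<epsilon> * norm ?z"
          using near[OF d z] by simp
        also have "\<dots> \<le> \<epsilon> * norm x"
          using norm_minus_partial_proj_le[OF e(1), of x l "n l"] \<open>\<epsilon> > 0\<close> p(1)[OF x]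
          by (simp add: norm_minus_commute)
        finally show "norm (d l (?p l x) - d l x) \<le> \<epsilon> * norm x"
          using clinear_onD(3)[OF sub c0sum_linear[OF DA[OF d]] p(2)[OF x] x] by simp
      qed
    qed
  qed
qed

end

subsection \<open>Zero products\<close>

text \<open>The bound is phrased through \<open>bdd_by\<close>, so that it can be verified and used
  with any convenient constant instead of \<open>c0norm\<close>. Besides the given map, auxiliary
  maps such as \<open>a \<mapsto> x * \<phi> a\<close> are instances, which makes them comparable on
  rank one operators.\<close>

locale bounded_block_map = hilbert_blocks H for H :: "'i \<Rightarrow> 'h::chilbert set" +
  fixes \<phi> :: "('i \<Rightarrow> 'h \<Rightarrow> 'h) \<Rightarrow> 'b::cbanach_algebra" and K :: real
  assumes phi_add: "a \<in> A \<Longrightarrow> b \<in> A \<Longrightarrow> \<phi> (\<lambda>l x. a l x + b l x) = \<phi> a + \<phi> b"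
    and phi_scale: "a \<in> A \<Longrightarrow> \<phi> (c0scale z a) = scaleC z (\<phi> a)"
    and K_nonneg: "0 \<le> K"
    and phi_bound: "a \<in> A \<Longrightarrow> 0 \<le> M \<Longrightarrow> bdd_by a M \<Longrightarrow> norm (\<phi> a) \<le> K * M"
begin

lemma phi_zero: "\<phi> (\<lambda>l x. 0) = 0"
  using phi_scale[OF c0sum_zero, of 0] by (simp add: c0scale_def)

lemma phi_diff:
  assumes "a \<in> A" "b \<in> A"
  shows "\<phi> (\<lambda>l x. a l x - b l x) = \<phi> a - \<phi> b"
  using phi_add[OF assms(1) c0sum_scale[OF assms(2), of "-1"]] phi_scale[OF assms(2), of "-1"]
  by (simp add: c0scale_def scaleC_minus_one)

lemma phi_sum_elem:
  assumes "finite I" "\<And>i. i \<in> I \<Longrightarrow> case g i of (l, u, y) \<Rightarrow> u \<in> H l"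
  shows "\<phi> (elem_sum I g) = (\<Sum>i\<in>I. \<phi> (E (g i)))"
  using assms
proof (induction I rule: finite_induct)
  case (insert i I)
  obtain l u y where g: "g i = (l, u, y)"
    by (cases "g i") auto
  then have "E (g i) \<in> A"
    using insert.prems[of i] elem_op_mem[of u l y] by simp
  then show ?case
    using phi_add[of "E (g i)" "elem_sum I g"] c0sum_sum_elem[of I g] insert by simp
qed (simp add: phi_zero)

lemma phi_tendsto:
  assumes "a \<in> A" "\<And>n. s n \<in> A" "\<And>n. bdd_by (\<lambda>l x. a l x - s n l x) (\<epsilon> n)" "\<And>n. 0 \<le> \<epsilon> n" "\<epsilon> \<longlonglongrightarrow> 0"
  shows "(\<lambda>n. \<phi> (s n)) \<longlonglongrightarrow> \<phi> a"
proof (rule LIM_zero_cancel, rule Lim_null_comparison)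
  show "(\<lambda>n. K * \<epsilon> n) \<longlonglongrightarrow> 0"
    by (rule tendsto_mult_right_zero[OF assms(5)])
  have "norm (\<phi> (s n) - \<phi> a) \<le> K * \<epsilon> n" for n
    using phi_bound[OF c0sum_diff[OF assms(1,2)] assms(4,3)] phi_diff[OF assms(1,2)]
    by (simp add: norm_minus_commute)
  then show "eventually (\<lambda>n. norm (\<phi> (s n) - \<phi> a) \<le> K * \<epsilon> n) sequentially"
    by simp
qed

lemma elem_sums_tendsto:
  assumes a: "a \<in> A"
  obtains I g where "\<forall>n. elem_family a (I n) (g n)"
    "\<forall>n. bdd_by (\<lambda>l x. a l x - elem_sum (I n) (g n) l x) (1 / real (Suc n))"
    "(\<lambda>n. \<Sum>i\<in>I n. \<phi> (E (g n i))) \<longlonglongrightarrow> \<phi> a"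
proof -
  have "\<forall>n. \<exists>I g. elem_family a I g \<and> bdd_by (\<lambda>l x. a l x - elem_sum I g l x) (1 / real (Suc n))"
    by (intro allI c0sum_approx[OF a]) simp
  then obtain I g where Ig: "\<forall>n. elem_family a (I n) (g n) \<and> bdd_by (\<lambda>l x. a l x - elem_sum (I n) (g n) l x) (1 / real (Suc n))"
    unfolding choice_iff by (elim exE) (rule that)
  note fam = spec[OF Ig, THEN conjunct1] and bd = spec[OF Ig, THEN conjunct2]
  have lim: "(\<lambda>n. 1 / real (Suc n)) \<longlonglongrightarrow> 0"
    using LIMSEQ_inverse_real_of_nat by (simp add: inverse_eq_divide)
  have "(\<lambda>n. \<phi> (elem_sum (I n) (g n))) \<longlonglongrightarrow> \<phi> a"
    by (rule phi_tendsto[OF a elem_sum_mem[OF fam a] bd _ lim]) simp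
  moreover have "\<phi> (elem_sum (I n) (g n)) = (\<Sum>i\<in>I n. \<phi> (E (g n i)))" for n
    by (rule phi_sum_elem[OF elem_family_finite[OF fam] elem_family_case[OF fam a]])
  ultimately have "(\<lambda>n. \<Sum>i\<in>I n. \<phi> (E (g n i))) \<longlonglongrightarrow> \<phi> a"
    by simp
  then show thesis
    by (rule that[OF allI[OF fam] allI[OF bd]])
qed

text \<open>In finite rank approximations of \<open>a\<close> and \<open>b\<close> every pair of
  summands falls under \<open>elems\<close>: within one block, a vector \<open>u'\<close> in the
  range of \<open>b\<close> is killed by \<open>a\<close>, hence orthogonal to \<open>y\<close>. All
  products of approximants are therefore 0, and multiplication is continuous.\<close>

lemma zero_product_from_elems:
  assumes elems: "\<And>l u y l' u' y'. u \<in> H l \<Longrightarrow> u' \<in> H l' \<Longrightarrow> l \<noteq> l' \<or> cinner y u' = 0 \<Longrightarrow>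
      \<phi> (E (l, u, y)) * \<phi> (E (l', u', y')) = 0"
    and a: "a \<in> A" and b: "b \<in> A" and ab: "c0mult a b = (\<lambda>l x. 0)"
  shows "\<phi> a * \<phi> b = 0"
proof -
  obtain I g where I: "\<forall>n. elem_family a (I n) (g n)" "(\<lambda>n. \<Sum>i\<in>I n. \<phi> (E (g n i))) \<longlonglongrightarrow> \<phi> a"
    by (rule elem_sums_tendsto[OF a]) (rule that)
  obtain J h where J: "\<forall>n. elem_family b (J n) (h n)" "(\<lambda>n. \<Sum>i\<in>J n. \<phi> (E (h n i))) \<longlonglongrightarrow> \<phi> b"
    by (rule elem_sums_tendsto[OF b]) (rule that)
  have "\<phi> (E (g n i)) * \<phi> (E (h n j)) = 0" if i: "i \<in> I n" and j: "j \<in> J n" for n i j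
  proof -
    obtain l u y where g: "g n i = (l, u, y)"
      by (cases "g n i") auto
    obtain l' u' y' where h: "h n j = (l', u', y')"
      by (cases "h n j") auto
    note gp = elem_familyD(4,3)[OF spec[OF I(1)] i g]
    note hp = elem_familyD(4,1)[OF spec[OF J(1)] j h]
    have "cinner y u' = 0" if "l = l'"
    proof -
      obtain x where "u' = b l x"
        using hp(2) \<open>l = l'\<close> by blast
      then have "a l u' = 0"
        using fun_cong[OF fun_cong[OF ab, of l], of x] by (simp add: c0mult_def)
      then show ?thesis
        using gp(2) hp(1)[OF b] \<open>l = l'\<close> by blast
    qed
    then show ?thesis
      unfolding g h using elems[OF gp(1)[OF a] hp(1)[OF b]] by blast
  qed
  then have "(\<Sum>i\<in>I n. \<phi> (E (g n i))) * (\<Sum>i\<in>J n. \<phi> (E (h n i))) = 0" for n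
    unfolding sum_product by simp
  then show ?thesis
    using tendsto_mult[OF I(2) J(2)] LIMSEQ_unique[OF _ tendsto_const] by fastforce
qed

lemma elem_op_0: "E (l, 0, y) = (\<lambda>l x. 0)"
  by (intro ext) simp

text \<open>Only the four perturbations with each of \<open>u\<close>, \<open>u'\<close> kept or
  replaced by 0 are evaluated. All give the same value \<open>t\<close>, so the wanted product is
  the alternating sum \<open>t - t - t + t\<close>.\<close>

lemma elem_product_zero:
  assumes c: "c \<in> A" and rank: "\<And>l. cdim (c l ` H l) + 2 \<le> cdim (H l)"
    and t: "\<And>a b. a \<in> A \<Longrightarrow> b \<in> A \<Longrightarrow> c0mult a b = c \<Longrightarrow> \<phi> a * \<phi> b = t"
    and u: "u \<in> H l" "u' \<in> H l'" and orth: "l \<noteq> l' \<or> cinner y u' = 0"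
  shows "\<phi> (E (l, u, y)) * \<phi> (E (l', u', y')) = 0"
proof -
  \<comment> \<open>Off the two blocks concerned the prescribed vectors are 0, so one form of the
    factorization serves every block.\<close>
  define z where "z k = (if k = l' then u' else 0)" for k
  define w where "w k = (if k = l then y else 0)" for k
  let ?Q = "\<lambda>k a b. compact_op_on (H k) a \<and> compact_op_on (H k) b \<and> a \<circ> b = c k \<and> a (z k) = 0 \<and> (\<forall>x. cinner (w k) (b x) = 0) \<and>
    bounded_by (H k) a (sqrt (opnorm_on (H k) (c k))) \<and> bounded_by (H k) b (sqrt (2 * opnorm_on (H k) (c k)))"
  have "\<forall>k. \<exists>a b. ?Q k a b"
  proof
    fix k
    show "\<exists>a b. ?Q k a b"
      by (rule compact_factorization[OF sub closed_H c0sum_compact[OF c] rank, where z = "z k" and y = "w k"]) blast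
  qed
  then obtain a b where ab: "\<forall>k. ?Q k (a k) (b k)"
    unfolding choice_iff by (elim exE) (rule that)
  have comp: "compact_op_on (H k) (a k)" "compact_op_on (H k) (b k)" and ab_c: "a k \<circ> b k = c k" and az: "a k (z k) = 0"
    and wb: "cinner (w k) (b k x) = 0" and bda: "bounded_by (H k) (a k) (sqrt (opnorm_on (H k) (c k)))"
    and bdb: "bounded_by (H k) (b k) (sqrt (2 * opnorm_on (H k) (c k)))" for k x
    using ab by blast+
  \<comment> \<open>The threshold \<open>\<epsilon>\<^sup>2 / 2\<close> absorbs the factor 2 under
    the square root in the bound for \<open>b\<close>.\<close>
  have op: "opnorm_on (H k) (c k) \<le> \<epsilon>\<^sup>2 / 2" if "bounded_by (H k) (c k) (\<epsilon>\<^sup>2 / 2)" for k \<epsilon>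
    by (rule opnorm_le[OF sub that]) simp
  have nn: "0 \<le> opnorm_on (H k) (c k)" for k
    by (rule opnorm_nonneg[OF sub c0sum_compact[OF c]])
  have fin: "finite {k. \<not> bounded_by (H k) (c k) (\<epsilon>\<^sup>2 / 2)}" if "\<epsilon> > 0" for \<epsilon>
    using c that unfolding c0sum_iff by simp
  have A: "a \<in> A" "b \<in> A"
    unfolding c0sum_iff
  proof (safe intro!: comp)
    fix \<epsilon> :: real assume "\<epsilon> > 0"
    have "bounded_by (H k) (a k) \<epsilon>" if "bounded_by (H k) (c k) (\<epsilon>\<^sup>2 / 2)" for k
    proof (rule bounded_by_mono[OF bda])
      have "opnorm_on (H k) (c k) \<le> \<epsilon>\<^sup>2"
        using op[OF that] zero_le_power2[of \<epsilon>] by linarith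
      then show "sqrt (opnorm_on (H k) (c k)) \<le> \<epsilon>"
        using \<open>\<epsilon> > 0\<close> by (intro real_le_lsqrt) (auto simp: nn)
    qed
    then show "finite {k. \<not> bounded_by (H k) (a k) \<epsilon>}"
      by (intro finite_subset[OF _ fin[OF \<open>\<epsilon> > 0\<close>]]) blast
    have "bounded_by (H k) (b k) \<epsilon>" if "bounded_by (H k) (c k) (\<epsilon>\<^sup>2 / 2)" for k
    proof (rule bounded_by_mono[OF bdb])
      show "sqrt (2 * opnorm_on (H k) (c k)) \<le> \<epsilon>"
        using \<open>\<epsilon> > 0\<close> op[OF that] by (intro real_le_lsqrt) (auto simp: nn)
    qed
    then show "finite {k. \<not> bounded_by (H k) (b k) \<epsilon>}"
      by (intro finite_subset[OF _ fin[OF \<open>\<epsilon> > 0\<close>]]) blast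
  qed
  have prod: "(\<phi> a + \<phi> (E (l, v, y))) * (\<phi> b + \<phi> (E (l', v', y'))) = t"
    if v: "v \<in> {u, 0}" "v' \<in> {u', 0}" for v v'
  proof -
    have vH: "v \<in> H l" "v' \<in> H l'"
      using v u csubspaceD(1)[OF sub] by auto
    have "c0mult (\<lambda>k x. a k x + E (l, v, y) k x) (\<lambda>k x. b k x + E (l', v', y') k x) = c"
    proof (intro ext)
      fix k x
      let ?e = "E (l', v', y') k x"
      have bH: "b k x \<in> H k" "?e \<in> H k"
        using compact_op_onD(2,3)[OF comp(2), of x k] vH(2) csubspaceD(1,3)[OF sub] by (cases "x \<in> H k"; auto)+
      have "a k v' = 0" if "k = l'"
        using az[of k] v(2) that c0sum_at_0[OF A(1)] by (auto simp: z_def)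
      then have "a k ?e = 0"
        using clinear_onD(1,4)[OF sub c0sum_linear[OF A(1)]] vH(2) by auto
      then have "a k (b k x + ?e) = c k x"
        using clinear_onD(2)[OF sub c0sum_linear[OF A(1)] bH] fun_cong[OF ab_c[of k], of x] by simp
      moreover have "cinner y (b k x + ?e) = 0" if "k = l"
        using wb[of k x] that v(2) orth by (auto simp: w_def cinner_add_right cinner_scaleC_right)
      then have "E (l, v, y) k (b k x + ?e) = 0"
        by auto
      ultimately show "c0mult (\<lambda>k x. a k x + E (l, v, y) k x) (\<lambda>k x. b k x + E (l', v', y') k x) k x = c k x"
        by (simp add: c0mult_def)
    qed
    then have "\<phi> (\<lambda>k x. a k x + E (l, v, y) k x) * \<phi> (\<lambda>k x. b k x + E (l', v', y') k x) = t"
      by (intro t c0sum_add A elem_op_mem vH)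
    then show ?thesis
      by (simp add: phi_add A elem_op_mem vH del: elem_op_apply)
  qed
  have "\<phi> a * \<phi> b = t" "\<phi> a * (\<phi> b + \<phi> (E (l', u', y'))) = t" "(\<phi> a + \<phi> (E (l, u, y))) * \<phi> b = t"
    "(\<phi> a + \<phi> (E (l, u, y))) * (\<phi> b + \<phi> (E (l', u', y'))) = t"
    using prod[of 0 0] prod[of 0 u'] prod[of u 0] prod[of u u'] by (simp_all add: elem_op_0 phi_zero)
  then show ?thesis
    by (simp add: algebra_simps)
qed

end

subsection \<open>Multipliers in the bidual\<close>

lemma cdualD:
  assumes "f \<in> cdual"
  shows "f (x + y) = f x + f y" "f (scaleC a x) = a * f x" "f (x - y) = f x - f y" "f 0 = 0"
proof -
  show add: "f (x + y) = f x + f y" and sc: "f (scaleC a x) = a * f x" for x y a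
    using assms by (auto simp: cdual_def)
  show "f (x - y) = f x - f y"
    using add[of "x - y" y] by (simp add: eq_diff_eq)
  show "f 0 = 0"
    using add[of 0 0] by simp
qed

lemma cdualI:
  assumes "\<And>x y. f (x + y) = f x + f y" "\<And>a x. f (scaleC a x) = a * f x" "\<And>x. cmod (f x) \<le> K * norm x"
  shows "f \<in> cdual"
  using assms unfolding cdual_def by blast

lemma dual_norm_bound:
  assumes "f \<in> cdual"
  shows "cmod (f x) \<le> dual_norm f * norm x" "0 \<le> dual_norm f"
proof -
  obtain K where K: "\<And>x. cmod (f x) \<le> K * norm x"
    using assms by (auto simp: cdual_def)
  have "cmod (f x) \<le> \<bar>K\<bar>" if "norm x \<le> 1" for x
    using K[of x] mult_mono[of K "\<bar>K\<bar>" "norm x" 1] that abs_ge_self[of K] by auto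
  then have bdd: "bdd_above ((\<lambda>x. cmod (f x)) ` cball 0 1)"
    unfolding bdd_above_def by (intro exI[of _ "\<bar>K\<bar>"]) auto
  show "0 \<le> dual_norm f"
    unfolding dual_norm_def using cdualD(4)[OF assms] by (intro cSUP_upper2[OF bdd, of 0]) auto
  show "cmod (f x) \<le> dual_norm f * norm x"
  proof (cases "x = 0")
    case False
    have "cmod (f ((1 / norm x) *\<^sub>R x)) \<le> dual_norm f"
      unfolding dual_norm_def using False by (intro cSUP_upper bdd) auto
    then show ?thesis
      using False by (simp add: scaleR_scaleC cdualD[OF assms] norm_mult norm_divide field_simps)
  qed (simp add: cdualD[OF assms])
qed

lemma dual_norm_le:
  assumes "\<And>x. cmod (f x) \<le> M * norm x" "0 \<le> M"
  shows "dual_norm f \<le> M"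
  unfolding dual_norm_def
proof (rule cSUP_least)
  show "cmod (f x) \<le> M" if "x \<in> cball 0 1" for x
    using assms(1)[of x] mult_left_mono[of "norm x" 1 M] assms(2) that by auto
qed auto

lemma cdual_mult_right:
  fixes f :: "'b::cnormed_algebra \<Rightarrow> complex"
  assumes "f \<in> cdual"
  shows "(\<lambda>a. f (a * b)) \<in> cdual"
proof (rule cdualI)
  show "cmod (f (x * b)) \<le> dual_norm f * norm b * norm x" for x
    using dual_norm_bound(1)[OF assms, of "x * b"] mult_left_mono[OF norm_mult_ineq[of x b] dual_norm_bound(2)[OF assms]]
    by (simp add: mult_ac)
qed (simp_all add: distrib_right scaleC_mult_left cdualD[OF assms])

lemma cdual_mult_left:
  fixes f :: "'b::cnormed_algebra \<Rightarrow> complex"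
  assumes "f \<in> cdual"
  shows "(\<lambda>a. f (b * a)) \<in> cdual"
proof (rule cdualI)
  show "cmod (f (b * x)) \<le> dual_norm f * norm b * norm x" for x
    using dual_norm_bound(1)[OF assms, of "b * x"] mult_left_mono[OF norm_mult_ineq[of b x] dual_norm_bound(2)[OF assms]]
    by (simp add: mult_ac)
qed (simp_all add: distrib_left scaleC_mult_right cdualD[OF assms])

lemma cdual_add: "f \<in> cdual \<Longrightarrow> g \<in> cdual \<Longrightarrow> (\<lambda>x. f x + g x) \<in> cdual"
  using dual_norm_bound(1)[of f] dual_norm_bound(1)[of g]
  by (intro cdualI[where K = "dual_norm f + dual_norm g"])
    (auto simp: cdualD algebra_simps intro: order_trans[OF norm_triangle_ineq add_mono])

lemma cdual_scale: "f \<in> cdual \<Longrightarrow> (\<lambda>x. a * f x) \<in> cdual"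
  using mult_left_mono[OF dual_norm_bound(1)[of f] norm_ge_zero[of a]]
  by (intro cdualI[where K = "cmod a * dual_norm f"]) (auto simp: cdualD distrib_left norm_mult mult_ac)

lemma cdual_diff: "f \<in> cdual \<Longrightarrow> g \<in> cdual \<Longrightarrow> (\<lambda>x. f x - g x) \<in> cdual"
  using cdual_add[of f "\<lambda>x. (-1) * g x"] cdual_scale[of g "-1"] by simp

lemma compact_product:
  fixes C :: "'x \<Rightarrow> 'y::topological_space set"
  assumes "\<And>i. compact (C i)"
  shows "compact (PiE UNIV C)"
proof -
  have "compactin (product_topology (\<lambda>i. euclidean) UNIV) (PiE UNIV C)"
    using assms by (simp add: compactin_PiE)
  then show ?thesis
    by (simp add: euclidean_product_topology)
qed

text \<open>Tychonoff's theorem provides a weak-* cluster point of the net of approximants \<open>x\<close>.\<close>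
lemma bidual_element_of_multiplier:
  fixes S :: "'b::cnormed_algebra \<Rightarrow> 'b"
  assumes approx: "\<And>D \<epsilon>. finite D \<Longrightarrow> \<epsilon> > 0 \<Longrightarrow>
      \<exists>x. norm x \<le> K \<and> (\<forall>b\<in>D. norm (x * b - S b) \<le> \<epsilon> \<and> norm (b * x - S b) \<le> \<epsilon>)"
  shows "\<exists>h\<in>cbidual. \<forall>f\<in>cdual. \<forall>b. h (\<lambda>a. f (a * b)) = f (S b) \<and> h (\<lambda>a. f (b * a)) = f (S b)"
proof -
  \<comment> \<open>Off \<open>cdual\<close> the value is pinned to 0, matching the convention of
    \<open>cbidual\<close>; on \<open>cdual\<close> it lies in a compact disc.\<close>
  define U :: "(('b \<Rightarrow> complex) \<Rightarrow> complex) set" where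
    "U = PiE UNIV (\<lambda>f. if f \<in> cdual then cball 0 (K * dual_norm f) else {0})"
  define L :: "(('b \<Rightarrow> complex) \<Rightarrow> complex) set" where
    "L = (\<Inter>f\<in>cdual. \<Inter>g\<in>cdual. {h. h (\<lambda>x. f x + g x) = h f + h g}) \<inter> (\<Inter>f\<in>cdual. \<Inter>a. {h. h (\<lambda>x. a * f x) = a * h f})"
  define J where "J = {(f :: 'b \<Rightarrow> complex, b :: 'b, \<epsilon> :: real). f \<in> cdual \<and> \<epsilon> > 0}"
  define C where "C = (\<lambda>(f :: 'b \<Rightarrow> complex, b, \<epsilon> :: real). {h. cmod (h (\<lambda>a. f (a * b)) - f (S b)) \<le> \<epsilon>} \<inter>
     {h. cmod (h (\<lambda>a. f (b * a)) - f (S b)) \<le> \<epsilon>})"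
  have coord: "continuous_on UNIV (\<lambda>h :: ('b \<Rightarrow> complex) \<Rightarrow> complex. h f)" for f
    by (rule continuous_on_product_coordinates)
  have "compact U"
    unfolding U_def by (rule compact_product) simp
  moreover have "closed L"
    unfolding L_def by (intro closed_Int closed_INT ballI closed_Collect_eq continuous_intros coord)
  ultimately have UL: "compact (U \<inter> L)"
    by (rule compact_Int_closed)
  have "U \<inter> L \<inter> (\<Inter>j\<in>J. C j) \<noteq> {}"
  proof (rule compact_imp_fip_image[OF UL])
    show "closed (C j)" for j
      unfolding C_def by (cases j) (auto intro!: closed_Int closed_Collect_le continuous_intros coord)
    fix J' assume J': "finite J'" "J' \<subseteq> J"
    define D where "D = (\<lambda>(f, b, \<epsilon>). b) ` J'"
    \<comment> \<open>Small enough for all finitely many constraints at once; the 1 covers the empty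
      family, and \<open>dual_norm f + 1\<close> avoids a zero denominator.\<close>
    define \<delta> where "\<delta> = Min (insert 1 ((\<lambda>(f, b, \<epsilon>). \<epsilon> / (dual_norm f + 1)) ` J'))"
    have "\<delta> > 0"
      unfolding \<delta>_def using J'
      by (subst Min_gr_iff) (auto simp: J_def intro!: divide_pos_pos add_nonneg_pos dual_norm_bound(2) dest!: subsetD)
    then obtain x where x: "norm x \<le> K" "\<forall>b\<in>D. norm (x * b - S b) \<le> \<delta> \<and> norm (b * x - S b) \<le> \<delta>"
      using approx[of D \<delta>] J'(1) unfolding D_def by blast
    have "cmod (f x) \<le> K * dual_norm f" if "f \<in> cdual" for f
      using mult_left_mono[OF x(1) dual_norm_bound(2)[OF that]] dual_norm_bound(1)[OF that, of x]
      by (simp add: mult.commute)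
    then have "bembed x \<in> U"
      by (auto simp: U_def bembed_def PiE_UNIV_domain)
    moreover have "bembed x \<in> L"
      by (auto simp: L_def bembed_def cdual_add cdual_scale)
    moreover have "bembed x \<in> C (f, b, \<epsilon>)" if j: "(f, b, \<epsilon>) \<in> J'" for f b \<epsilon>
    proof -
      have f: "f \<in> cdual"
        using j J'(2) by (auto simp: J_def)
      have "\<delta> \<le> \<epsilon> / (dual_norm f + 1)"
        unfolding \<delta>_def using j J'(1) imageI[OF j, of "\<lambda>(f, b, \<epsilon>). \<epsilon> / (dual_norm f + 1)"] by (intro Min_le) auto
      then have \<delta>: "(dual_norm f + 1) * \<delta> \<le> \<epsilon>"
        using dual_norm_bound(2)[OF f] by (simp add: field_simps)
      have "b \<in> D"
        using j by (force simp: D_def)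
      then have "norm (x * b - S b) \<le> \<delta>" "norm (b * x - S b) \<le> \<delta>"
        using x(2) by auto
      moreover have "cmod (f w) \<le> \<epsilon>" if "norm w \<le> \<delta>" for w
      proof -
        have "cmod (f w) \<le> dual_norm f * norm w"
          by (rule dual_norm_bound[OF f])
        also have "\<dots> \<le> (dual_norm f + 1) * \<delta>"
          using that dual_norm_bound(2)[OF f] \<open>\<delta> > 0\<close> by (intro mult_mono) auto
        finally show ?thesis
          using \<delta> by linarith
      qed
      ultimately have "cmod (f (x * b) - f (S b)) \<le> \<epsilon>" "cmod (f (b * x) - f (S b)) \<le> \<epsilon>"
        by (simp_all flip: cdualD(3)[OF f])
      then show ?thesis
        by (simp add: C_def bembed_def cdual_mult_left[OF f] cdual_mult_right[OF f])
    qed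
    ultimately show "U \<inter> L \<inter> (\<Inter>j\<in>J'. C j) \<noteq> {}"
      by fast
  qed
  then obtain h where h: "h \<in> U" "h \<in> L" "\<And>j. j \<in> J \<Longrightarrow> h \<in> C j"
    by blast
  have "h \<in> cbidual"
    using h(1,2) unfolding cbidual_def U_def L_def by (auto simp: PiE_UNIV_domain Pi_iff split: if_splits)
  moreover have "h (\<lambda>a. f (a * b)) = f (S b) \<and> h (\<lambda>a. f (b * a)) = f (S b)" if f: "f \<in> cdual" for f b
  proof -
    have "cmod (h (\<lambda>a. f (a * b)) - f (S b)) \<le> 0 + \<epsilon>" "cmod (h (\<lambda>a. f (b * a)) - f (S b)) \<le> 0 + \<epsilon>"
      if "\<epsilon> > 0" for \<epsilon>
      using h(3)[of "(f, b, \<epsilon>)"] f that by (simp_all add: J_def C_def)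
    from this[THEN field_le_epsilon] show ?thesis
      by simp
  qed
  ultimately show ?thesis
    by blast
qed

lemma cbidualE:
  assumes "F \<in> cbidual"
  obtains M where "0 \<le> M" "\<And>f. f \<in> cdual \<Longrightarrow> cmod (F f) \<le> M * dual_norm f"
proof -
  have "\<exists>M. \<forall>f\<in>cdual. cmod (F f) \<le> M * dual_norm f"
    using assms by (simp add: cbidual_def)
  then obtain M where M: "\<And>f. f \<in> cdual \<Longrightarrow> cmod (F f) \<le> M * dual_norm f"
    by blast
  have "cmod (F f) \<le> \<bar>M\<bar> * dual_norm f" if "f \<in> cdual" for f
    using M[OF that] mult_right_mono[OF abs_ge_self[of M] dual_norm_bound(2)[OF that]] by linarith
  then show thesis
    by (rule that[of "\<bar>M\<bar>", rotated]) simp_all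
qed

lemma cbidualD:
  assumes "F \<in> cbidual" "f \<in> cdual"
  shows "g \<in> cdual \<Longrightarrow> F (\<lambda>x. f x + g x) = F f + F g" "F (\<lambda>x. a * f x) = a * F f"
    "g \<in> cdual \<Longrightarrow> F (\<lambda>x. f x - g x) = F f - F g"
proof -
  have add: "F (\<lambda>x. f x + g x) = F f + F g" if "f \<in> cdual" "g \<in> cdual" for f g
    using assms(1) that by (simp add: cbidual_def)
  have sc: "F (\<lambda>x. a * f x) = a * F f" if "f \<in> cdual" for f a
    using assms(1) that by (simp add: cbidual_def)
  show "F (\<lambda>x. a * f x) = a * F f"
    by (rule sc[OF assms(2)])
  show "F (\<lambda>x. f x + g x) = F f + F g" if "g \<in> cdual"
    by (rule add[OF assms(2) that])
  show "F (\<lambda>x. f x - g x) = F f - F g" if "g \<in> cdual"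
    using add[OF assms(2) cdual_scale[OF that, of "-1"]] sc[OF that, of "-1"] by simp
qed

lemma bidual_module_bound:
  fixes F :: "('b::cnormed_algebra \<Rightarrow> complex) \<Rightarrow> complex"
  assumes F: "F \<in> cbidual" and f: "f \<in> cdual"
    and M: "0 \<le> M" "\<And>f. f \<in> cdual \<Longrightarrow> cmod (F f) \<le> M * dual_norm f"
  shows "(\<lambda>a. F (\<lambda>b. f (a * b))) \<in> cdual" "dual_norm (\<lambda>a. F (\<lambda>b. f (a * b))) \<le> M * dual_norm f"
proof -
  have bd: "cmod (F (\<lambda>b. f (a * b))) \<le> M * dual_norm f * norm a" for a
  proof -
    have "cmod (f (a * x)) \<le> dual_norm f * norm a * norm x" for x
      using dual_norm_bound(1)[OF f, of "a * x"] mult_left_mono[OF norm_mult_ineq[of a x] dual_norm_bound(2)[OF f]]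
      by (simp add: mult_ac)
    then have "dual_norm (\<lambda>b. f (a * b)) \<le> dual_norm f * norm a"
      by (rule dual_norm_le) (simp add: dual_norm_bound(2)[OF f])
    then show ?thesis
      using M(2)[OF cdual_mult_left[OF f], of a] mult_left_mono[OF _ M(1)] by (simp add: mult.assoc) (meson order_trans)
  qed
  show "dual_norm (\<lambda>a. F (\<lambda>b. f (a * b))) \<le> M * dual_norm f"
    using bd by (rule dual_norm_le) (simp add: M(1) dual_norm_bound(2)[OF f])
  show "(\<lambda>a. F (\<lambda>b. f (a * b))) \<in> cdual"
  proof (rule cdualI[OF _ _ bd])
    show "F (\<lambda>b. f ((x + y) * b)) = F (\<lambda>b. f (x * b)) + F (\<lambda>b. f (y * b))" for x y
      using cbidualD(1)[OF F cdual_mult_left[OF f] cdual_mult_left[OF f]] by (simp add: distrib_right cdualD[OF f])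
    show "F (\<lambda>b. f (scaleC a x * b)) = a * F (\<lambda>b. f (x * b))" for a x
      using cbidualD(2)[OF F cdual_mult_left[OF f]] by (simp add: scaleC_mult_left cdualD[OF f])
  qed
qed

text \<open>The commutator \<open>P\<close> of \<open>h\<close> and \<open>m\<close> is bounded on
  \<open>cdual\<close>. On the functional \<open>x \<mapsto> f (b * x)\<close> it vanishes: by
  \<open>hS\<close> and \<open>S b * a = b * S a\<close> both orders reduce to \<open>m\<close>
  applied to \<open>c \<mapsto> f (S b * c)\<close>. By \<open>essential\<close> such functionals
  approximate \<open>f\<close> in norm.\<close>

lemma central_multiplier_in_center:
  fixes S :: "'b::cnormed_algebra \<Rightarrow> 'b"
  assumes h: "h \<in> cbidual"
    and hS: "\<And>f b. f \<in> cdual \<Longrightarrow> h (\<lambda>a. f (a * b)) = f (S b)" "\<And>f b. f \<in> cdual \<Longrightarrow> h (\<lambda>a. f (b * a)) = f (S b)"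
    and S: "\<And>a b. S b * a = b * S a"
    and essential: "\<And>(f :: 'b \<Rightarrow> complex) \<epsilon>. f \<in> cdual \<Longrightarrow> \<epsilon> > 0 \<Longrightarrow> \<exists>b. \<forall>x. cmod (f x - f (b * x)) \<le> \<epsilon> * norm x"
  shows "h \<in> center_multiplier_algebra" "arens_mult h (bembed b) = bembed (S b)"
proof -
  obtain N where N: "0 \<le> N" "\<And>f. f \<in> cdual \<Longrightarrow> cmod (h f) \<le> N * dual_norm f"
    using cbidualE[OF h] by blast
  have left: "arens_mult h (bembed b) = bembed (S b)" for b
    by (auto simp: arens_mult_def bembed_def cdual_mult_left hS)
  have hdual: "(\<lambda>a. h (\<lambda>b. f (a * b))) \<in> cdual" if "f \<in> cdual" for f
    by (rule bidual_module_bound[OF h that N])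
  have right: "arens_mult (bembed b) h = bembed (S b)" for b
    using hdual by (intro ext) (simp add: arens_mult_def bembed_def hS)
  have "h \<in> multiplier_algebra"
    using h left right by (simp add: multiplier_algebra_def)
  moreover have "arens_mult h m = arens_mult m h" if "m \<in> multiplier_algebra" for m
  proof
    fix f
    have m: "m \<in> cbidual"
      using that by (simp add: multiplier_algebra_def)
    obtain M where M: "0 \<le> M" "\<And>f. f \<in> cdual \<Longrightarrow> cmod (m f) \<le> M * dual_norm f"
      using cbidualE[OF m] by blast
    note mdual = bidual_module_bound[OF m _ M] and hdual = bidual_module_bound[OF h _ N]
    define P where "P f = h (\<lambda>a. m (\<lambda>b. f (a * b))) - m (\<lambda>a. h (\<lambda>b. f (a * b)))" for f
    show "arens_mult h m f = arens_mult m h f"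
    proof (cases "f \<in> cdual")
      case f: True
      have Pbd: "cmod (P g) \<le> 2 * (M * N) * dual_norm g" if g: "g \<in> cdual" for g
      proof -
        have "cmod (h (\<lambda>a. m (\<lambda>b. g (a * b)))) \<le> N * (M * dual_norm g)"
          using N(2)[OF mdual(1)[OF g]] mult_left_mono[OF mdual(2)[OF g] N(1)] by linarith
        moreover have "cmod (m (\<lambda>a. h (\<lambda>b. g (a * b)))) \<le> M * (N * dual_norm g)"
          using M(2)[OF hdual(1)[OF g]] mult_left_mono[OF hdual(2)[OF g] M(1)] by linarith
        ultimately show ?thesis
          using norm_triangle_ineq4[of "h (\<lambda>a. m (\<lambda>b. g (a * b)))" "m (\<lambda>a. h (\<lambda>b. g (a * b)))"]
          by (simp add: P_def algebra_simps)
      qed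
      have "P f = 0"
      proof -
        have "cmod (P f) \<le> 2 * (M * N) * \<epsilon>" if "\<epsilon> > 0" for \<epsilon>
        proof -
          obtain b where b: "\<And>x. cmod (f x - f (b * x)) \<le> \<epsilon> * norm x"
            using essential[OF f \<open>\<epsilon> > 0\<close>] by blast
          define g where "g x = f (b * x)" for x
          have g: "g \<in> cdual"
            using cdual_mult_left[OF f, of b] by (simp add: g_def[abs_def])
          have "h (\<lambda>a. m (\<lambda>c. g (a * c))) = h (\<lambda>a. m (\<lambda>c. f ((b * a) * c)))"
            by (simp add: g_def mult.assoc)
          also have "\<dots> = m (\<lambda>c. f (S b * c))"
            using hS(2)[OF mdual(1)[OF f], of b] by simp
          also have "\<dots> = m (\<lambda>a. h (\<lambda>c. g (a * c)))"
            by (simp only: hS(2)[OF g]) (simp add: S g_def)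
          finally have Pg: "P g = 0"
            by (simp add: P_def)
          have fg: "(\<lambda>x. f x - g x) \<in> cdual"
            by (rule cdual_diff[OF f g])
          have "P (\<lambda>x. f x - g x) = P f - P g"
            unfolding P_def
            using cbidualD(3)[OF m cdual_mult_left[OF f] cdual_mult_left[OF g]]
              cbidualD(3)[OF h cdual_mult_left[OF f] cdual_mult_left[OF g]]
              cbidualD(3)[OF h mdual(1)[OF f] mdual(1)[OF g]] cbidualD(3)[OF m hdual(1)[OF f] hdual(1)[OF g]]
            by simp
          moreover have "dual_norm (\<lambda>x. f x - g x) \<le> \<epsilon>"
            using b \<open>\<epsilon> > 0\<close> by (intro dual_norm_le) (simp_all add: g_def)
          then have "2 * (M * N) * dual_norm (\<lambda>x. f x - g x) \<le> 2 * (M * N) * \<epsilon>"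
            using M(1) N(1) by (intro mult_left_mono) auto
          ultimately show ?thesis
            using Pbd[OF fg] Pg by simp
        qed
        then have "cmod (P f) \<le> 0 + \<epsilon>" if "\<epsilon> > 0" for \<epsilon>
        proof -
          \<comment> \<open>Adding 1 keeps the quotient positive and defined when
            \<open>M * N = 0\<close>.\<close>
          have "2 * (M * N) * (\<epsilon> / (2 * (M * N) + 1)) \<le> \<epsilon>"
            using \<open>\<epsilon> > 0\<close> mult_nonneg_nonneg[OF M(1) N(1)] by (simp add: pos_divide_le_eq distrib_left mult.commute)
          moreover have "\<epsilon> / (2 * (M * N) + 1) > 0"
            using \<open>\<epsilon> > 0\<close> M(1) N(1) by (intro divide_pos_pos add_nonneg_pos) auto
          ultimately show ?thesis
            using \<open>\<And>\<epsilon>. \<epsilon> > 0 \<Longrightarrow> cmod (P f) \<le> 2 * (M * N) * \<epsilon>\<close>[of "\<epsilon> / (2 * (M * N) + 1)"] by linarith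
        qed
        then have "cmod (P f) \<le> 0"
          by (rule field_le_epsilon)
        then show ?thesis
          by simp
      qed
      then show ?thesis
        using f by (simp add: arens_mult_def P_def)
    qed (simp add: arens_mult_def)
  qed
  ultimately show "h \<in> center_multiplier_algebra"
    by (simp add: center_multiplier_algebra_def)
  show "arens_mult h (bembed b) = bembed (S b)"
    by (rule left)
qed

subsection \<open>Sesquilinear forms, sequences and functionals\<close>

text \<open>For \<open>p\<close>, \<open>q\<close> orthogonal to \<open>v\<close>, the vector
  \<open>p + v\<close> is orthogonal to \<open>q\<close> minus \<open>cinner p q\<close> times
  \<open>v\<close>, and expanding \<open>B\<close> there compares \<open>B p q\<close> with
  \<open>B v v\<close>. General arguments split into a multiple of \<open>v\<close> and an
  orthogonal part.\<close>

lemma sesquilinear_vanishing_on_orthogonal: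
  fixes B :: "'h::cinner_space \<Rightarrow> 'h \<Rightarrow> 'b::cvector"
  assumes S: "csubspace S" and v: "v \<in> S" "norm v = 1"
    and add: "\<And>x y z. x \<in> S \<Longrightarrow> y \<in> S \<Longrightarrow> z \<in> S \<Longrightarrow> B (x + y) z = B x z + B y z"
      "\<And>x y z. x \<in> S \<Longrightarrow> y \<in> S \<Longrightarrow> z \<in> S \<Longrightarrow> B x (y + z) = B x y + B x z"
    and sc: "\<And>a x y. x \<in> S \<Longrightarrow> y \<in> S \<Longrightarrow> B (scaleC a x) y = scaleC (cnj a) (B x y)"
      "\<And>a x y. x \<in> S \<Longrightarrow> y \<in> S \<Longrightarrow> B x (scaleC a y) = scaleC a (B x y)"
    and orth: "\<And>x y. x \<in> S \<Longrightarrow> y \<in> S \<Longrightarrow> cinner x y = 0 \<Longrightarrow> B x y = 0"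
    and x: "x \<in> S" and y: "y \<in> S"
  shows "B x y = scaleC (cinner x y) (B v v)"
proof -
  note SD = csubspaceD[OF S]
  have vv: "cinner v v = 1"
    using v(2) by (simp add: cinner_self)
  have perp: "B p q = scaleC (cinner p q) (B v v)" if p: "p \<in> S" "cinner v p = 0" and q: "q \<in> S" "cinner v q = 0" for p q
  proof -
    have pv: "cinner p v = 0"
      using p(2) by (subst cinner_swap_eq_0)
    define s where "s = scaleC (- cinner p q) v"
    have s: "s \<in> S"
      using v(1) SD(3) by (simp add: s_def)
    have "cinner (p + v) (q + s) = 0"
      by (simp add: s_def cinner_add_left cinner_add_right cinner_scaleC_right pv q(2) vv)
    then have "B (p + v) (q + s) = 0"
      using p q v(1) s SD(2) by (intro orth) auto
    moreover have "B (p + v) (q + s) = B p q + B p s + (B v q + B v s)"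
      using p q v(1) s SD(2) by (simp add: add)
    moreover have "B p s = 0" "B v q = 0"
      using p q v(1) s pv by (auto intro!: orth simp: s_def cinner_scaleC_right)
    moreover have "B v s = - scaleC (cinner p q) (B v v)"
      using sc(2)[OF v(1) v(1), of "- cinner p q"] by (simp add: s_def scaleC_minus_left)
    ultimately show ?thesis
      by simp
  qed
  define x0 where "x0 = x - scaleC (cinner v x) v"
  define y0 where "y0 = y - scaleC (cinner v y) v"
  let ?x1 = "scaleC (cinner v x) v" and ?y1 = "scaleC (cinner v y) v"
  have mem: "?x1 \<in> S" "?y1 \<in> S" "x0 \<in> S" "y0 \<in> S"
    using x y v(1) SD(3,4) by (auto simp: x0_def y0_def)
  have o: "cinner v x0 = 0" "cinner v y0 = 0"
    by (simp_all add: x0_def y0_def cinner_diff_right cinner_scaleC_right vv)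
  then have o': "cinner x0 v = 0"
    by (subst cinner_swap_eq_0)
  have xy: "?x1 + x0 = x" "?y1 + y0 = y"
    by (simp_all add: x0_def y0_def)
  have "B (?x1 + x0) (?y1 + y0) = B ?x1 ?y1 + B ?x1 y0 + (B x0 ?y1 + B x0 y0)"
    using mem SD(2) by (simp add: add)
  also have "B ?x1 y0 = 0"
    using mem o by (intro orth) (auto simp: cinner_scaleC_left)
  also have "B x0 ?y1 = 0"
    using mem o' by (intro orth) (auto simp: cinner_scaleC_right)
  also have "B ?x1 ?y1 = scaleC (cnj (cinner v x) * cinner v y) (B v v)"
    using v(1) mem by (simp add: sc mult.commute)
  also have "B x0 y0 = scaleC (cinner x0 y0) (B v v)"
    by (rule perp[OF mem(3) o(1) mem(4) o(2)])
  finally have "B (?x1 + x0) (?y1 + y0) = scaleC (cnj (cinner v x) * cinner v y + cinner x0 y0) (B v v)"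
    by (simp add: scaleC_add_left)
  moreover have "cinner (?x1 + x0) (?y1 + y0) = cnj (cinner v x) * cinner v y + cinner x0 y0"
    by (simp add: cinner_add_left cinner_add_right cinner_scaleC_left cinner_scaleC_right o o' vv)
  ultimately show ?thesis
    by (simp only: xy)
qed

text \<open>If \<open>m (x + y) = m x\<close>, additivity transfers the multiplier to
  \<open>y\<close>. Otherwise the same identity makes \<open>g x\<close> a multiple of
  \<open>g y\<close>, and injectivity of \<open>g\<close> makes \<open>x\<close> a multiple of
  \<open>y\<close>. The map \<open>\<sigma>\<close> covers linear and conjugate-linear dependence
  with one proof.\<close>

lemma pointwise_multiple_is_multiple:
  fixes f g :: "'h::cvector \<Rightarrow> 'b::cvector"
  assumes S: "csubspace S"
    and f: "\<And>x y. x \<in> S \<Longrightarrow> y \<in> S \<Longrightarrow> f (x + y) = f x + f y" "\<And>a x. x \<in> S \<Longrightarrow> f (scaleC a x) = scaleC (\<sigma> a) (f x)"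
    and g: "\<And>x y. x \<in> S \<Longrightarrow> y \<in> S \<Longrightarrow> g (x + y) = g x + g y" "\<And>a x. x \<in> S \<Longrightarrow> g (scaleC a x) = scaleC (\<sigma> a) (g x)"
    and inj: "\<And>x. x \<in> S \<Longrightarrow> g x = 0 \<Longrightarrow> x = 0" and \<sigma>: "surj \<sigma>" "\<sigma> (-1) = -1"
    and m: "\<And>x. x \<in> S \<Longrightarrow> f x = scaleC (m x) (g x)"
    and x: "x \<in> S" "x \<noteq> 0" and y: "y \<in> S" "y \<noteq> 0"
  shows "m x = m y"
proof (cases "m (x + y) = m x")
  case True
  have "scaleC (m (x + y)) (g x + g y) = scaleC (m x) (g x) + scaleC (m y) (g y)"
    using m[of "x + y"] m[OF x(1)] m[OF y(1)] x y csubspaceD(2)[OF S] by (simp add: f g)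
  then have "scaleC (m x - m y) (g y) = 0"
    by (simp add: True scaleC_add_right scaleC_diff_left)
  then show ?thesis
    using inj[OF y(1)] y(2) by (auto simp: scaleC_eq_0_iff)
next
  case False
  define c where "c = (m y - m (x + y)) / (m (x + y) - m x)"
  have "scaleC (m (x + y)) (g x + g y) = scaleC (m x) (g x) + scaleC (m y) (g y)"
    using m[of "x + y"] m[OF x(1)] m[OF y(1)] x y csubspaceD(2)[OF S] by (simp add: f g)
  then have "scaleC (m (x + y) - m x) (g x) = scaleC (m y - m (x + y)) (g y)"
    by (simp add: scaleC_add_right scaleC_diff_left algebra_simps)
  then have "scaleC (inverse (m (x + y) - m x)) (scaleC (m (x + y) - m x) (g x)) =
      scaleC (inverse (m (x + y) - m x)) (scaleC (m y - m (x + y)) (g y))"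
    by simp
  then have gx: "g x = scaleC c (g y)"
    using False by (simp add: c_def divide_inverse mult.commute)
  obtain a where a: "\<sigma> a = c"
    using \<sigma>(1) by (metis surjD)
  have ay: "scaleC a y \<in> S"
    using y(1) csubspaceD(3)[OF S] by blast
  define w where "w = scaleC (-1) (scaleC a y)"
  have w: "w \<in> S"
    unfolding w_def by (rule csubspaceD(3)[OF S ay])
  have "g w = scaleC (\<sigma> (-1)) (g (scaleC a y))"
    unfolding w_def by (rule g(2)[OF ay])
  also have "g (scaleC a y) = g x"
    using g(2)[OF y(1), of a] by (simp add: a gx)
  finally have "g (x + w) = 0"
    by (simp add: g(1)[OF x(1) w] \<sigma>(2) scaleC_minus_one)
  then have "x + w = 0"
    by (rule inj[OF csubspaceD(2)[OF S x(1) w]])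
  then have xa: "x = scaleC a y"
    by (simp add: w_def scaleC_minus_one del: scaleC_scaleC)
  have "scaleC (m x) (g x) = scaleC c (f y)"
    using m[OF x(1)] y(1) by (simp add: xa f(2) a)
  also have "\<dots> = scaleC (m y) (g x)"
    by (simp add: m[OF y(1)] gx mult.commute)
  finally have "scaleC (m x - m y) (g x) = 0"
    by (simp add: scaleC_diff_left)
  then show ?thesis
    using inj[OF x(1)] x(2) by (auto simp: scaleC_eq_0_iff)
qed

text \<open>Without a uniform positive lower bound, values below any threshold occur outside every
  finite set, since finitely many positive values have a positive minimum. Hence each term can avoid
  its predecessors.\<close>

lemma injective_sequence_below:
  fixes f :: "'i \<Rightarrow> real"
  assumes pos: "\<And>l. f l > 0" and "\<not> (\<exists>\<delta>>0. \<forall>l. \<delta> \<le> f l)" and g: "\<And>n. g n > 0"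
  shows "\<exists>s :: nat \<Rightarrow> 'i. inj s \<and> (\<forall>n. f (s n) < g n)"
proof -
  have step: "\<exists>l. l \<notin> T \<and> f l < \<epsilon>" if "finite T" "\<epsilon> > 0" for T \<epsilon>
  proof (rule ccontr)
    assume none: "\<not> ?thesis"
    let ?\<delta> = "Min (insert \<epsilon> (f ` T))"
    have "?\<delta> > 0"
      using that pos by simp
    moreover have "?\<delta> \<le> f l" for l
    proof (cases "l \<in> T")
      case False
      then have "\<epsilon> \<le> f l"
        using none by force
      then show ?thesis
        using that by (intro Min.coboundedI[THEN order_trans]) auto
    qed (use that in simp)
    ultimately show False
      using assms(2) by blast
  qed
  define P where "P s n r \<longleftrightarrow> r \<notin> s ` {..<n} \<and> f r < g n" for s :: "nat \<Rightarrow> 'i" and n r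
  have "\<exists>s. \<forall>n. P s n (s n)"
  proof (rule dependent_wellorder_choice)
    fix r and s s' :: "nat \<Rightarrow> 'i" and n :: nat
    assume "\<And>j. j < n \<Longrightarrow> s j = s' j"
    then have "s ` {..<n} = s' ` {..<n}"
      by auto
    then show "P s n r = P s' n r"
      by (simp only: P_def)
  next
    fix n and s :: "nat \<Rightarrow> 'i"
    show "\<exists>r. P s n r"
      unfolding P_def by (rule step) (simp_all add: g)
  qed
  then obtain s where s: "\<And>n. P s n (s n)"
    by blast
  have "s m \<noteq> s n" if "m < n" for m n
    using s[of n] that unfolding P_def by (metis imageI lessThan_iff)
  then have "inj s"
    by (metis injI linorder_neqE_nat)
  then show ?thesis
    using s by (auto simp: P_def)
qed

lemma exists_aligning_phase: "\<exists>\<omega>. cmod \<omega> = 1 \<and> cmod (z + \<omega> * w) = cmod z + cmod w"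
proof (cases "z = 0 \<or> w = 0")
  case True
  then show ?thesis
    by (intro exI[of _ 1]) auto
next
  case False
  let ?\<omega> = "(z / of_real (cmod z)) * (cnj w / of_real (cmod w))"
  have "cnj w * w = of_real (cmod w) * of_real (cmod w)"
    by (metis complex_norm_square mult.commute power2_eq_square of_real_mult of_real_power)
  then have "?\<omega> * w = (z / of_real (cmod z)) * of_real (cmod w)"
    using False by (simp add: field_simps)
  then have "z + ?\<omega> * w = (z / of_real (cmod z)) * of_real (cmod z + cmod w)"
    using False by (simp add: distrib_left)
  then have "cmod (z + ?\<omega> * w) = cmod z + cmod w"
    using False by (simp only: norm_mult norm_divide norm_of_real) simp
  moreover have "cmod ?\<omega> = 1"
    using False by (simp add: norm_mult norm_divide)
  ultimately show ?thesis
    by blast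
qed

context hilbert_blocks
begin

text \<open>Finite sums of rank one operators are dense and both maps are continuous; one
  approximating sequence serves both.\<close>

lemma block_map_eqI:
  assumes "bounded_block_map H f K" "bounded_block_map H g L"
    and eq: "\<And>l u y. u \<in> H l \<Longrightarrow> y \<in> H l \<Longrightarrow> f (E (l, u, y)) = g (E (l, u, y))" and a: "a \<in> A"
  shows "f a = g a"
proof -
  interpret f: bounded_block_map H f K
    by fact
  interpret g: bounded_block_map H g L
    by fact
  obtain I t where I: "\<forall>n. elem_family a (I n) (t n)"
    "\<forall>n. bdd_by (\<lambda>l x. a l x - elem_sum (I n) (t n) l x) (1 / real (Suc n))"
    "(\<lambda>n. \<Sum>i\<in>I n. f (E (t n i))) \<longlonglongrightarrow> f a"
    by (rule f.elem_sums_tendsto[OF a]) (rule that)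
  note fam = spec[OF I(1)]
  have fg: "f (E (t n i)) = g (E (t n i))" if "i \<in> I n" for n i
    using elem_familyD(2,4)[OF fam that] eq a by (cases "t n i") auto
  have lim: "(\<lambda>n. 1 / real (Suc n)) \<longlonglongrightarrow> 0"
    using LIMSEQ_inverse_real_of_nat by (simp add: inverse_eq_divide)
  have "(\<lambda>n. g (elem_sum (I n) (t n))) \<longlonglongrightarrow> g a"
    by (rule g.phi_tendsto[OF a elem_sum_mem[OF fam a] spec[OF I(2)] _ lim]) simp
  moreover have "g (elem_sum (I n) (t n)) = (\<Sum>i\<in>I n. f (E (t n i)))" for n
    using g.phi_sum_elem[OF elem_family_finite[OF fam] elem_family_case[OF fam a]] fg by simp
  ultimately show ?thesis
    using LIMSEQ_unique[OF I(3)] by simp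
qed

text \<open>A perturbation argument. If the projection \<open>p\<close> almost fixes an almost
  norming \<open>a0\<close>, then adding \<open>t\<close> times a normalized
  \<open>r = a - p a\<close> to \<open>p a0\<close> keeps the norm below
  \<open>sqrt (1 + t\<^sup>2)\<close>, because the two ranges are orthogonal, while a suitable phase
  raises \<open>G\<close> linearly in \<open>t\<close>. Hence \<open>G r\<close> is small, with the
  same \<open>p\<close> for all \<open>a\<close>.\<close>

lemma functional_left_approx:
  assumes add: "\<And>a b. a \<in> A \<Longrightarrow> b \<in> A \<Longrightarrow> G (\<lambda>l x. a l x + b l x) = G a + G b"
    and sc: "\<And>z a. a \<in> A \<Longrightarrow> G (c0scale z a) = z * G a"
    and bd: "\<And>a M. a \<in> A \<Longrightarrow> 0 \<le> M \<Longrightarrow> bdd_by a M \<Longrightarrow> cmod (G a) \<le> N0 * M" and "0 \<le> N0" and "\<epsilon> > 0"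
  obtains p where "p \<in> A" "bdd_by p 1"
    "\<And>a M. a \<in> A \<Longrightarrow> 0 < M \<Longrightarrow> bdd_by a M \<Longrightarrow> cmod (G a - G (c0mult p a)) \<le> \<epsilon> * M"
proof -
  let ?U = "{a \<in> A. bdd_by a 1}"
  define N where "N = (SUP a\<in>?U. cmod (G a))"
  have G0: "G (\<lambda>l x. 0) = 0"
    using sc[OF c0sum_zero, of 0] by (simp add: c0scale_def)
  have zero: "(\<lambda>l x. 0) \<in> ?U"
    using c0sum_zero by (simp add: bdd_by_def bounded_by_def)
  have bdd: "bdd_above ((\<lambda>a. cmod (G a)) ` ?U)"
    unfolding bdd_above_def using bd[of _ 1] by (intro exI[of _ N0]) auto
  have N0: "0 \<le> N"
    unfolding N_def using zero by (intro cSUP_upper2[OF bdd zero]) (simp add: G0)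
  have scale_mem: "c0scale z a \<in> ?U" if "a \<in> A" "bdd_by a M" "cmod z * M \<le> 1" for a M z
  proof -
    have "bdd_by (c0scale z a) (cmod z * M)"
      unfolding c0scale_eq_diag by (rule bdd_by_diag[OF that(2)]) simp
    then show ?thesis
      using that c0sum_scale bounded_by_mono unfolding bdd_by_def by blast
  qed
  have N: "cmod (G a) \<le> N * M" if "a \<in> A" "bdd_by a M" "0 < M" for a M
  proof -
    have "cmod (G (c0scale (of_real (1 / M)) a)) \<le> N"
      unfolding N_def using that by (intro cSUP_upper bdd scale_mem[where M = M]) (auto simp: norm_divide)
    then show ?thesis
      using that by (simp add: sc norm_mult norm_divide field_simps)
  qed
  \<comment> \<open>The two errors are balanced: after division by \<open>t\<close>, the near
    maximum leaves \<open>2 * \<eta> / t = \<epsilon> / 2\<close> and the second order term leaves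
    \<open>N * t / 2 \<le> \<epsilon> / 2\<close>.\<close>
  define t where "t = \<epsilon> / (N + 1)"
  define \<eta> where "\<eta> = \<epsilon> * t / 4"
  have t: "t > 0" and \<eta>: "\<eta> > 0"
    using \<open>\<epsilon> > 0\<close> N0 by (simp_all add: t_def \<eta>_def)
  have "\<exists>a\<in>?U. N - \<eta> < cmod (G a)"
    using less_cSUP_iff[OF _ bdd, of "N - \<eta>"] zero \<eta> unfolding N_def by fastforce
  then obtain a0 where a0: "a0 \<in> A" "bdd_by a0 1" "N - \<eta> < cmod (G a0)"
    by blast
  have a0': "finite {a0}" "{a0} \<subseteq> A" "\<eta> / (N0 + 1) > 0"
    using a0(1) \<eta> \<open>0 \<le> N0\<close> by auto
  obtain e n where en: "\<forall>l. weak_orthonormal (e l)" "\<forall>l k. e l k \<in> H l" "proj_op e n \<in> A"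
      "\<forall>d\<in>{a0}. bdd_by (\<lambda>l x. proj_op e n l (d l x) - d l x) (\<eta> / (N0 + 1))"
    by (rule approximate_unit[OF a0']) (rule that)
  note e = spec[OF en(1)] spec[OF spec[OF en(2)]] en(3,4)
  let ?p = "proj_op e n"
  have p: "?p l x = partial_proj (e l) (n l) x" if "x \<in> H l" for l x
    using that by (simp add: proj_op_def)
  have p1: "bdd_by ?p 1"
    using norm_partial_proj_le[OF e(1)] by (intro bdd_byI) (simp add: p)
  have G_diff: "G (\<lambda>l x. a l x - b l x) = G a - G b" if "a \<in> A" "b \<in> A" for a b
    using add[OF that(1) c0sum_scale[OF that(2), of "-1"]] sc[OF that(2), of "-1"] by (simp add: c0scale_def scaleC_minus_one)
  have pa0: "c0mult ?p a0 \<in> A"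
    by (rule c0sum_mult[OF e(3) a0(1)])
  have "bdd_by (\<lambda>l x. c0mult ?p a0 l x - a0 l x) (\<eta> / (N0 + 1))"
    using e(4) by (simp add: c0mult_def)
  then have "cmod (G (\<lambda>l x. c0mult ?p a0 l x - a0 l x)) \<le> N0 * (\<eta> / (N0 + 1))"
    using \<eta> \<open>0 \<le> N0\<close> by (intro bd c0sum_diff pa0 a0(1)) auto
  then have "cmod (G (c0mult ?p a0) - G a0) \<le> N0 * (\<eta> / (N0 + 1))"
    by (simp only: G_diff[OF pa0 a0(1)])
  also have "\<dots> \<le> \<eta>"
    using \<eta> \<open>0 \<le> N0\<close> by (simp add: field_simps)
  finally have Gpa0: "N - 2 * \<eta> \<le> cmod (G (c0mult ?p a0))"
    using a0(3) norm_triangle_ineq2[of "G a0" "G (c0mult ?p a0)"] by (simp add: norm_minus_commute)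
  show thesis
  proof (rule that[OF e(3) p1])
    fix a M assume a: "a \<in> A" "(0::real) < M" "bdd_by a M"
    define r where "r = (\<lambda>l x. a l x - c0mult ?p a l x)"
    have pa: "c0mult ?p a \<in> A"
      by (rule c0sum_mult[OF e(3) a(1)])
    have r: "r \<in> A"
      unfolding r_def by (rule c0sum_diff[OF a(1) pa])
    \<comment> \<open>The phase rules out cancellation between the two values of \<open>G\<close>;
      dividing by \<open>M\<close> normalizes \<open>r\<close>.\<close>
    obtain \<omega> where \<omega>: "cmod \<omega> = 1" "cmod (G (c0mult ?p a0) + \<omega> * (of_real (t / M) * G r)) = cmod (G (c0mult ?p a0)) + cmod (of_real (t / M) * G r)"
      using exists_aligning_phase by blast
    define q where "q = (\<lambda>l x. c0mult ?p a0 l x + c0scale (\<omega> * of_real (t / M)) r l x)"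
    have q: "q \<in> A"
      unfolding q_def by (intro c0sum_add pa0 c0sum_scale r)
    have "bdd_by q (sqrt (1 + t\<^sup>2))"
    proof (rule bdd_byI)
      fix l x assume x: "x \<in> H l"
      let ?P = "partial_proj (e l) (n l)"
      let ?w = "a l x - ?P (a l x)"
      have H: "a0 l x \<in> H l" "a l x \<in> H l"
        using c0sum_mem a0(1) a(1) x by blast+
      have ql: "q l x = ?P (a0 l x) + scaleC (\<omega> * of_real (t / M)) ?w"
        using H by (simp add: q_def r_def c0mult_def c0scale_def p)
      have "cinner (?P (a0 l x)) (scaleC (\<omega> * of_real (t / M)) ?w) = 0"
        using cinner_partial_proj_orthogonal[OF e(1)] by (simp add: cinner_scaleC_right)
      then have "(norm (q l x))\<^sup>2 = (norm (?P (a0 l x)))\<^sup>2 + (norm (scaleC (\<omega> * of_real (t / M)) ?w))\<^sup>2"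
        unfolding ql by (rule norm_add_sq_orthogonal)
      also have "\<dots> \<le> (norm x)\<^sup>2 + (t * norm x)\<^sup>2"
      proof (intro add_mono power_mono norm_ge_zero)
        show "norm (?P (a0 l x)) \<le> norm x"
          using norm_partial_proj_le[OF e(1), of l "n l" "a0 l x"] bdd_byD[OF a0(2) x] by linarith
        have "norm ?w \<le> M * norm x"
          using norm_minus_partial_proj_le[OF e(1), of "a l x" l "n l"] bdd_byD[OF a(3) x] by linarith
        then show "norm (scaleC (\<omega> * of_real (t / M)) ?w) \<le> t * norm x"
          using a(2) t \<omega>(1) by (simp add: norm_scaleC norm_mult norm_divide field_simps)
      qed
      also have "\<dots> = (sqrt (1 + t\<^sup>2) * norm x)\<^sup>2"
        by (simp add: power_mult_distrib algebra_simps)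
      finally show "norm (q l x) \<le> sqrt (1 + t\<^sup>2) * norm x"
        by (rule power2_le_imp_le) simp
    qed
    then have "cmod (G q) \<le> N * sqrt (1 + t\<^sup>2)"
      by (rule N[OF q]) (simp add: add_pos_nonneg)
    also have "sqrt (1 + t\<^sup>2) \<le> 1 + t\<^sup>2 / 2"
      using t by (intro real_le_lsqrt) (auto simp: power2_eq_square algebra_simps)
    finally have "cmod (G q) \<le> N * (1 + t\<^sup>2 / 2)"
      using N0 by (meson mult_left_mono order_trans)
    moreover have "G q = G (c0mult ?p a0) + \<omega> * (of_real (t / M) * G r)"
      unfolding q_def by (simp add: add[OF pa0 c0sum_scale[OF r]] sc[OF r])
    ultimately have "cmod (G (c0mult ?p a0)) + t / M * cmod (G r) \<le> N + N * (t\<^sup>2 / 2)"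
      using \<omega>(2) t a(2) by (simp add: norm_mult norm_divide distrib_left)
    then have "N - 2 * \<eta> + t / M * cmod (G r) \<le> N + N * (t\<^sup>2 / 2)"
      using Gpa0 by linarith
    then have "t * (cmod (G r) / M) \<le> t * (\<epsilon> / 2 + N * t / 2)"
      by (simp add: \<eta>_def power2_eq_square algebra_simps)
    then have "cmod (G r) / M \<le> \<epsilon> / 2 + N * t / 2"
      using t by (simp only: mult_le_cancel_left_pos)
    also have "N * t \<le> \<epsilon>"
      using N0 \<open>\<epsilon> > 0\<close> by (simp add: t_def field_simps)
    finally have "cmod (G r) \<le> \<epsilon> * M"
      using a(2) by (simp add: field_simps)
    then show "cmod (G a - G (c0mult ?p a)) \<le> \<epsilon> * M"
      by (simp add: r_def G_diff[OF a(1) pa])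
  qed
qed

end

subsection \<open>Zero product preserving bijections\<close>

text \<open>\<open>v l\<close> is a reference unit vector in each block, and \<open>st\<close> is a
  parameter because the involution is not part of the algebra's type class.\<close>

locale zero_product_bijection = bounded_block_map H \<phi> K
  for H :: "'i \<Rightarrow> 'h::chilbert set" and \<phi> :: "('i \<Rightarrow> 'h \<Rightarrow> 'h) \<Rightarrow> 'b::cbanach_algebra" and K +
  fixes v :: "'i \<Rightarrow> 'h" and st :: "'b \<Rightarrow> 'b"
  assumes elem_zero: "u \<in> H l \<Longrightarrow> u' \<in> H l' \<Longrightarrow> l \<noteq> l' \<or> cinner y u' = 0 \<Longrightarrow>
      \<phi> (E (l, u, y)) * \<phi> (E (l', u', y')) = 0"
    and v: "v l \<in> H l" "norm (v l) = 1"
    and bij: "bij_betw \<phi> A UNIV"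
    and cstar: "is_cstar_involution st"
begin

lemma st: "st (st x) = x" "st (x * y) = st y * st x" "norm (st x * x) = (norm x)\<^sup>2"
  using cstar by (auto simp: is_cstar_involution_def)

lemma st_0: "st 0 = 0"
  using st(3)[of "st 0"] st(1)[of 0] by simp

lemma norm_st: "norm (st x) = norm x"
proof -
  have "norm x \<le> norm (st x)" for x
  proof (cases "x = 0")
    case False
    have "norm x * norm x \<le> norm (st x) * norm x"
      using st(3)[of x] norm_mult_ineq[of "st x" x] by (simp add: power2_eq_square)
    then show ?thesis
      using False by simp
  qed (simp add: st_0)
  from this[of x] this[of "st x"] show ?thesis
    by (simp add: st(1))
qed

text \<open>The C*-identity at \<open>st x\<close> reads
  \<open>norm (x * st x) = (norm (st x))\<^sup>2\<close>, so testing with \<open>y = st x\<close>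
  suffices.\<close>

lemma faithful_left:
  fixes x :: 'b
  assumes "\<And>y. x * y = 0"
  shows "x = 0"
proof -
  have "st x = 0"
    using st(3)[of "st x"] assms by (simp add: st(1))
  then show ?thesis
    using st(1)[of x] st_0 by simp
qed

lemma faithful_right:
  fixes x :: 'b
  assumes "\<And>y. y * x = 0"
  shows "x = 0"
  using st(3)[of x] assms by simp

lemma surj: "\<exists>a\<in>A. x = \<phi> a"
  using bij by (auto simp: bij_betw_def)

lemma inj: "a \<in> A \<Longrightarrow> b \<in> A \<Longrightarrow> \<phi> a = \<phi> b \<Longrightarrow> a = b"
  using bij by (auto simp: bij_betw_def inj_on_def)

section \<open>Images of rank one operators and their products\<close>

definition F :: "'i \<Rightarrow> 'h \<Rightarrow> 'h \<Rightarrow> 'b" where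
  "F l u y = \<phi> (E (l, u, y))"

lemma F_add_left: "u \<in> H l \<Longrightarrow> u' \<in> H l \<Longrightarrow> F l (u + u') y = F l u y + F l u' y"
proof -
  assume u: "u \<in> H l" "u' \<in> H l"
  have "E (l, u + u', y) = (\<lambda>k x. E (l, u, y) k x + E (l, u', y) k x)"
    by (intro ext) (simp add: scaleC_add_right)
  then show ?thesis
    unfolding F_def using phi_add[OF elem_op_mem[OF u(1)] elem_op_mem[OF u(2)]] by simp
qed

lemma F_add_right: "u \<in> H l \<Longrightarrow> F l u (y + y') = F l u y + F l u y'"
proof -
  assume u: "u \<in> H l"
  have "E (l, u, y + y') = (\<lambda>k x. E (l, u, y) k x + E (l, u, y') k x)"
    by (intro ext) (simp add: cinner_add_left scaleC_add_left)
  then show ?thesis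
    unfolding F_def using phi_add[OF elem_op_mem[OF u] elem_op_mem[OF u]] by simp
qed

lemma F_scale_left: "u \<in> H l \<Longrightarrow> F l (scaleC a u) y = scaleC a (F l u y)"
proof -
  assume u: "u \<in> H l"
  have "E (l, scaleC a u, y) = c0scale a (E (l, u, y))"
    by (intro ext) (simp add: c0scale_def mult.commute)
  then show ?thesis
    unfolding F_def using phi_scale[OF elem_op_mem[OF u]] by simp
qed

lemma F_scale_right: "u \<in> H l \<Longrightarrow> F l u (scaleC a y) = scaleC (cnj a) (F l u y)"
proof -
  assume u: "u \<in> H l"
  have "E (l, u, scaleC a y) = c0scale (cnj a) (E (l, u, y))"
    by (intro ext) (simp add: c0scale_def cinner_scaleC_left)
  then show ?thesis
    unfolding F_def using phi_scale[OF elem_op_mem[OF u]] by simp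
qed

lemma F_0: "F l 0 y = 0" "F l u 0 = 0"
proof -
  have "E (l, u, 0) = (\<lambda>l x. 0)"
    by (intro ext) simp
  then show "F l 0 y = 0" "F l u 0 = 0"
    by (simp_all only: F_def elem_op_0 phi_zero)
qed

lemma norm_F: "u \<in> H l \<Longrightarrow> norm (F l u y) \<le> K * (norm u * norm y)"
  unfolding F_def by (intro phi_bound elem_op_mem bdd_by_elem_op) auto

lemma F_eq_0D:
  assumes "u \<in> H l" "y \<in> H l" "F l u y = 0"
  shows "u = 0 \<or> y = 0"
proof -
  have "E (l, u, y) = (\<lambda>l x. 0)"
    using assms by (intro inj elem_op_mem c0sum_zero) (simp_all add: F_def phi_zero)
  from fun_cong[OF fun_cong[OF this, of l], of y] show ?thesis
    using assms(2) by (auto simp: scaleC_eq_0_iff cinner_self)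
qed

lemma F_other_block: "u \<in> H l \<Longrightarrow> u' \<in> H l' \<Longrightarrow> l \<noteq> l' \<Longrightarrow> F l u y * F l' u' y' = 0"
  unfolding F_def by (rule elem_zero) auto

text \<open>The product of \<open>F l u z\<close> and \<open>F l u' y\<close> stripped of the inner
  product of \<open>z\<close> and \<open>u'\<close>; taking \<open>v l\<close> for both normalizes
  that inner product to 1.\<close>

definition X :: "'i \<Rightarrow> 'h \<Rightarrow> 'h \<Rightarrow> 'b" where
  "X l u y = F l u (v l) * F l (v l) y"

text \<open>The product is sesquilinear in the inner pair \<open>y\<close>, \<open>u'\<close> and
  vanishes on orthogonal pairs.\<close>

lemma F_mult:
  assumes "u \<in> H l" "y \<in> H l" "u' \<in> H l"
  shows "F l u y * F l u' y' = scaleC (cinner y u') (X l u y')"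
  unfolding X_def
proof (rule sesquilinear_vanishing_on_orthogonal[OF sub v, where B = "\<lambda>y u'. F l u y * F l u' y'"])
  show "F l u x * F l z y' = 0" if "x \<in> H l" "z \<in> H l" "cinner x z = 0" for x z
    unfolding F_def by (rule elem_zero) (use assms that in auto)
qed (use assms in \<open>simp_all add: F_add_left F_add_right F_scale_left F_scale_right distrib_left distrib_right
      scaleC_mult_left scaleC_mult_right\<close>)

lemma X_add_left: "u \<in> H l \<Longrightarrow> u' \<in> H l \<Longrightarrow> X l (u + u') y = X l u y + X l u' y"
  by (simp add: X_def F_add_left distrib_right)

lemma X_lin:
  assumes "u \<in> H l"
  shows "X l (scaleC a u) y = scaleC a (X l u y)"
    "X l u (y + y') = X l u y + X l u y'" "X l u (scaleC a y) = scaleC (cnj a) (X l u y)"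
  using assms v by (simp_all add: X_def F_add_left F_add_right F_scale_left F_scale_right distrib_left distrib_right
      scaleC_mult_left scaleC_mult_right)

lemma norm_X:
  assumes "u \<in> H l"
  shows "norm (X l u y) \<le> K * K * (norm u * norm y)"
proof -
  have "norm (X l u y) \<le> norm (F l u (v l)) * norm (F l (v l) y)"
    unfolding X_def by (rule norm_mult_ineq)
  also have "\<dots> \<le> (K * (norm u * norm (v l))) * (K * (norm (v l) * norm y))"
    using norm_F[OF assms] norm_F[OF v(1)] K_nonneg by (intro mult_mono) auto
  finally show ?thesis
    using v(2) by (simp add: mult_ac)
qed

lemma block_map_zero: "bounded_block_map H (\<lambda>a. 0 :: 'b) 0"
  by unfold_locales simp_all

lemma block_map_mult_left: "bounded_block_map H (\<lambda>a. x * \<phi> a) (norm x * K)"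
proof unfold_locales
  show "norm (x * \<phi> a) \<le> norm x * K * M" if "a \<in> A" "0 \<le> M" "bdd_by a M" for a M
    using norm_mult_ineq[of x "\<phi> a"] mult_left_mono[OF phi_bound[OF that] norm_ge_zero[of x]]
    by (simp add: mult.assoc)
qed (simp_all add: phi_add phi_scale distrib_left scaleC_mult_right K_nonneg)

lemma block_map_mult_right: "bounded_block_map H (\<lambda>a. \<phi> a * x) (norm x * K)"
proof unfold_locales
  show "norm (\<phi> a * x) \<le> norm x * K * M" if "a \<in> A" "0 \<le> M" "bdd_by a M" for a M
    using norm_mult_ineq[of "\<phi> a" x] mult_right_mono[OF phi_bound[OF that] norm_ge_zero[of x]]
    by (simp add: mult_ac)
qed (simp_all add: phi_add phi_scale distrib_right scaleC_mult_left K_nonneg)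

text \<open>Products with \<open>x\<close> are bounded linear in the other factor, so vanishing on
  rank one images extends to the range of \<open>\<phi>\<close>, which is everything; faithfulness
  concludes.\<close>

lemma annihilator_left:
  assumes "\<And>l u y. u \<in> H l \<Longrightarrow> y \<in> H l \<Longrightarrow> x * F l u y = 0"
  shows "x = 0"
proof (rule faithful_left)
  fix y
  obtain a where a: "a \<in> A" "y = \<phi> a"
    using surj by blast
  show "x * y = 0"
    using block_map_eqI[OF block_map_mult_left[of x] block_map_zero _ a(1)] assms a(2) by (simp add: F_def)
qed

lemma annihilator_right:
  assumes "\<And>l u y. u \<in> H l \<Longrightarrow> y \<in> H l \<Longrightarrow> F l u y * x = 0"
  shows "x = 0"
proof (rule faithful_right)
  fix y
  obtain a where a: "a \<in> A" "y = \<phi> a"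
    using surj by blast
  show "y * x = 0"
    using block_map_eqI[OF block_map_mult_right[of x] block_map_zero _ a(1)] assms a(2) by (simp add: F_def)
qed

text \<open>Under the assumption, \<open>F l u (v l)\<close> times any rank one image is 0, by
  \<open>F_mult\<close> in the same block and by orthogonality of blocks otherwise. Annihilators are
  trivial, and \<open>\<phi>\<close> is injective.\<close>

lemma X_zero_left:
  assumes "u \<in> H l" "\<And>y. y \<in> H l \<Longrightarrow> X l u y = 0"
  shows "u = 0"
proof -
  have "F l u (v l) = 0"
  proof (rule annihilator_left)
    fix l' u' y' assume uy: "u' \<in> H l'" "y' \<in> H l'"
    show "F l u (v l) * F l' u' y' = 0"
      using F_mult[OF assms(1) v(1), of u' y'] F_other_block[OF assms(1) uy(1)] assms(2) uy by (cases "l = l'") auto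
  qed
  then show ?thesis
    using F_eq_0D[OF assms(1) v(1)] v(2)[of l] by auto
qed

lemma X_zero_right:
  assumes "y \<in> H l" "\<And>u. u \<in> H l \<Longrightarrow> X l u y = 0"
  shows "y = 0"
proof -
  have "F l (v l) y = 0"
  proof (rule annihilator_right)
    fix l' u' y' assume uy: "u' \<in> H l'" "y' \<in> H l'"
    show "F l' u' y' * F l (v l) y = 0"
      using F_mult[of u' l y' "v l" y] F_other_block[of u' l' "v l" l] v(1)[of l] assms(2) uy by (cases "l = l'") auto
  qed
  then show ?thesis
    using F_eq_0D[OF v(1) assms(1)] v(2)[of l] by auto
qed

text \<open>Both sides are bounded linear in \<open>a\<close>, so rank one operators suffice, where
  \<open>F_mult\<close> and the orthogonality of blocks apply.\<close>

lemma phi_mult_F: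
  assumes u: "u \<in> H l" and a: "a \<in> A"
  shows "\<phi> a * F l u y = X l (a l u) y"
proof -
  have bm: "bounded_block_map H (\<lambda>a. X l (a l u) y) (K * K * (norm u * norm y))"
  proof unfold_locales
    show "norm (X l (a l u) y) \<le> K * K * (norm u * norm y) * M" if "a \<in> A" "0 \<le> M" "bdd_by a M" for a M
    proof -
      have "norm (X l (a l u) y) \<le> K * K * (norm (a l u) * norm y)"
        by (rule norm_X[OF c0sum_mem[OF that(1) u]])
      also have "\<dots> \<le> K * K * ((M * norm u) * norm y)"
        using bdd_byD[OF that(3) u] K_nonneg by (intro mult_left_mono mult_right_mono) auto
      finally show ?thesis
        by (simp add: mult_ac)
    qed
  qed (simp_all add: X_lin X_add_left c0sum_mem u c0scale_def K_nonneg)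
  show ?thesis
  proof (rule block_map_eqI[OF block_map_mult_right bm _ a])
    fix l' u' y' assume uy: "u' \<in> H l'" "y' \<in> H l'"
    show "\<phi> (E (l', u', y')) * F l u y = X l (E (l', u', y') l u) y"
    proof (cases "l = l'")
      case True
      then show ?thesis
        using F_mult[of u' l y' u y] X_lin(1)[of u' l] u uy by (simp add: F_def)
    next
      case False
      then show ?thesis
        using F_other_block[OF uy(1) u, of y' y] by (simp add: F_def[of l'] X_def F_0)
    qed
  qed
qed

lemma X_mult_F:
  assumes "u \<in> H l" "y \<in> H l" "u' \<in> H l"
  shows "X l u y * F l u' y' = scaleC (cinner y u') (F l u (v l) * X l (v l) y')"
  using F_mult[OF v(1) assms(2,3), of y'] by (simp add: X_def mult.assoc scaleC_mult_right)

text \<open>The preimage \<open>d\<close> of \<open>X l u y\<close> is read off from products with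
  rank one images: they force \<open>d\<close> to vanish in other blocks and on the orthogonal
  complement of \<open>y\<close>, so \<open>d\<close> is a rank one operator with second vector
  \<open>y\<close>.\<close>

lemma X_is_elem:
  assumes u: "u \<in> H l" and y: "y \<in> H l"
  shows "\<exists>w\<in>H l. X l u y = F l w y"
proof (cases "y = 0")
  case True
  then show ?thesis
    using u by (intro bexI[of _ u]) (simp_all add: X_def F_0)
next
  case False
  obtain d where d: "d \<in> A" "X l u y = \<phi> d"
    using surj by blast
  have d0: "d l' x = 0" if x: "x \<in> H l'" and c: "l' \<noteq> l \<or> cinner y x = 0" for l' x
  proof (rule X_zero_left)
    show "d l' x \<in> H l'"
      by (rule c0sum_mem[OF d(1) x])
    fix z assume "z \<in> H l'"
    have "X l' (d l' x) z = X l u y * F l' x z"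
      using phi_mult_F[OF x d(1)] d(2) by simp
    also have "\<dots> = 0"
    proof (cases "l' = l")
      case True
      then show ?thesis
        using X_mult_F[OF u y, of x z] c x by simp
    next
      case False
      then show ?thesis
        using F_other_block[OF v(1) x, of l "y" z] by (simp add: X_def mult.assoc)
    qed
    finally show "X l' (d l' x) z = 0" .
  qed
  define w where "w = scaleC (1 / cinner y y) (d l y)"
  have w: "w \<in> H l"
    unfolding w_def by (intro csubspaceD(3)[OF sub] c0sum_mem[OF d(1) y])
  have "d = E (l, w, y)"
  proof (rule c0sum_eqI[OF d(1) elem_op_mem[OF w]])
    fix l' x assume x: "x \<in> H l'"
    show "d l' x = E (l, w, y) l' x"
    proof (cases "l' = l")
      case True
      define x1 where "x1 = scaleC (cinner y x / cinner y y) y"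
      define x0 where "x0 = x - x1"
      have mem: "x1 \<in> H l" "x0 \<in> H l"
        using x y True csubspaceD(3,4)[OF sub] by (auto simp: x0_def x1_def)
      have "cinner y x0 = 0"
        using False by (simp add: x0_def x1_def cinner_diff_right cinner_scaleC_right cinner_self)
      then have "d l x0 = 0"
        using d0[OF mem(2)] by blast
      moreover have "d l x = d l x1 + d l x0"
        using clinear_onD(2)[OF sub c0sum_linear[OF d(1)] mem] by (simp add: x0_def)
      moreover have "d l x1 = scaleC (cinner y x) w"
        using clinear_onD(4)[OF sub c0sum_linear[OF d(1)] y] by (simp add: x1_def w_def)
      ultimately show ?thesis
        using True x by simp
    qed (use d0 x in simp)
  qed
  then show ?thesis
    using d(2) w by (auto simp: F_def)
qed

text \<open>\<open>X_is_elem\<close> preserves the second vector; the first is found by multiplying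
  from the left. If \<open>z\<close> is orthogonal to \<open>u\<close>, then
  \<open>F l u1 z * X l u y\<close> is 0, but it also equals \<open>cinner z w\<close> times the
  nonzero \<open>X l u1 y\<close>. So \<open>w\<close> is orthogonal to everything orthogonal to
  \<open>u\<close>.\<close>

lemma X_pointwise_multiple:
  assumes u: "u \<in> H l" and y: "y \<in> H l"
  shows "\<exists>m. X l u y = scaleC m (F l u y)"
proof (cases "u = 0 \<or> y = 0")
  case True
  then show ?thesis
    by (auto simp: X_def F_0)
next
  case False
  obtain w where w: "w \<in> H l" "X l u y = F l w y"
    using X_is_elem[OF u y] by blast
  obtain u1 where u1: "u1 \<in> H l" "X l u1 y \<noteq> 0"
    using X_zero_right[OF y] False by blast
  have orth: "cinner z w = 0" if z: "z \<in> H l" "cinner z u = 0" for z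
  proof -
    have "scaleC (cinner z w) (X l u1 y) = F l u1 z * X l u y"
      using F_mult[OF u1(1) z(1) w(1)] w(2) by simp
    also have "\<dots> = 0"
      using F_mult[OF u1(1) z(1) u, of "v l"] z(2) by (simp add: X_def mult.assoc[symmetric])
    finally show ?thesis
      using u1(2) by (simp add: scaleC_eq_0_iff)
  qed
  define m where "m = cinner u w / cinner u u"
  define z where "z = w - scaleC m u"
  have z: "z \<in> H l"
    using u w(1) csubspaceD(3,4)[OF sub] by (simp add: z_def)
  have "cinner u z = 0"
    using False by (simp add: z_def m_def cinner_diff_right cinner_scaleC_right cinner_self)
  then have zu: "cinner z u = 0"
    by (subst cinner_swap_eq_0)
  have "cinner z z = cinner z w - m * cinner z u"
    by (simp add: z_def[of] cinner_diff_right cinner_scaleC_right)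
  then have "z = 0"
    using orth[OF z zu] zu by (simp add: cinner_self)
  then show ?thesis
    using w(2) F_scale_left[OF u, of m y] by (auto simp: z_def)
qed

text \<open>The multiplier is made constant in one variable at a time: in \<open>y\<close> for fixed
  \<open>u\<close>, where the dependence is conjugate-linear, and in \<open>u\<close> for
  \<open>y = v l\<close>.\<close>

lemma X_scalar: "\<exists>m. \<forall>u\<in>H l. \<forall>y\<in>H l. X l u y = scaleC m (F l u y)"
proof -
  have "\<forall>u. \<forall>y. \<exists>m. u \<in> H l \<longrightarrow> y \<in> H l \<longrightarrow> X l u y = scaleC m (F l u y)"
    using X_pointwise_multiple by blast
  then obtain m where m: "\<And>u y. u \<in> H l \<Longrightarrow> y \<in> H l \<Longrightarrow> X l u y = scaleC (m u y) (F l u y)"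
    by metis
  have surj_cnj: "surj cnj"
    by (metis complex_cnj_cnj surjI)
  have v0: "v l \<noteq> 0"
    using v(2)[of l] by auto
  have inj_right: "x = 0" if "u \<in> H l" "u \<noteq> 0" "x \<in> H l" "F l u x = 0" for u x
    using F_eq_0D that by blast
  have inj_left: "x = 0" if "x \<in> H l" "F l x (v l) = 0" for x
    using F_eq_0D[OF that(1) v(1) that(2)] v0 by blast
  have 1: "m u y = m u (v l)" if u: "u \<in> H l" "u \<noteq> 0" and y: "y \<in> H l" "y \<noteq> 0" for u y
    by (rule pointwise_multiple_is_multiple[OF sub, where f = "X l u" and g = "F l u" and \<sigma> = cnj,
          OF X_lin(2,3)[OF u(1)] F_add_right[OF u(1)] F_scale_right[OF u(1)] inj_right[OF u] surj_cnj _ m[OF u(1)] y v(1) v0])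
      simp_all
  have 2: "m u (v l) = m (v l) (v l)" if "u \<in> H l" "u \<noteq> 0" for u
    by (rule pointwise_multiple_is_multiple[OF sub, where f = "\<lambda>u. X l u (v l)" and g = "\<lambda>u. F l u (v l)" and \<sigma> = "\<lambda>a. a"
          and m = "\<lambda>u. m u (v l)"])
      (use that v v0 m inj_left in \<open>auto simp: X_lin X_add_left F_add_left F_scale_left\<close>)
  have "X l u y = scaleC (m (v l) (v l)) (F l u y)" if "u \<in> H l" "y \<in> H l" for u y
    using m[OF that] 1[OF that(1) _ that(2)] 2[OF that(1)] by (cases "u = 0 \<or> y = 0") (auto simp: X_def F_0)
  then show ?thesis
    by blast
qed

section \<open>The block scalars \<mu> and the twisted product formula\<close>

definition \<mu> :: "'i \<Rightarrow> complex" where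
  "\<mu> l = (SOME m. \<forall>u\<in>H l. \<forall>y\<in>H l. X l u y = scaleC m (F l u y))"

lemma X_eq: "u \<in> H l \<Longrightarrow> y \<in> H l \<Longrightarrow> X l u y = scaleC (\<mu> l) (F l u y)"
  using someI_ex[OF X_scalar[of l]] by (simp add: \<mu>_def)

lemma F_mult_F:
  assumes "u \<in> H l" "y \<in> H l" "u' \<in> H l" "y' \<in> H l"
  shows "F l u y * F l u' y' = scaleC (\<mu> l * cinner y u') (F l u y')"
  using F_mult[OF assms(1-3)] X_eq[OF assms(1,4)] by (simp add: mult.commute)

lemma phi_mult_F_eq:
  assumes "u \<in> H l" "y \<in> H l" "a \<in> A"
  shows "\<phi> a * F l u y = scaleC (\<mu> l) (F l (a l u) y)"
  using phi_mult_F[OF assms(1,3)] X_eq[OF c0sum_mem[OF assms(3,1)] assms(2)] by simp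

lemma mu_nonzero: "\<mu> l \<noteq> 0"
proof
  assume "\<mu> l = 0"
  then have "X l (v l) y = 0" if "y \<in> H l" for y
    using X_eq[OF v(1) that] by simp
  then have "v l = 0"
    by (rule X_zero_left[OF v(1)])
  then show False
    using v(2)[of l] by simp
qed

lemma F_vv_nonzero: "F l (v l) (v l) \<noteq> 0"
  using F_eq_0D[OF v(1) v(1), of l] v(2)[of l] by (metis norm_zero zero_neq_one)

lemma F_vv_square: "F l (v l) (v l) * F l (v l) (v l) = scaleC (\<mu> l) (F l (v l) (v l))"
  using F_mult_F[OF v(1) v(1) v(1) v(1), of l] v(2)[of l] by (simp add: cinner_self)

text \<open>\<open>F l (v l) (v l)\<close> is \<mu> times a nonzero idempotent, and its norm is at
  most \<open>K\<close>.\<close>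

lemma cmod_mu_le: "cmod (\<mu> l) \<le> K"
proof -
  let ?f = "F l (v l) (v l)"
  have "cmod (\<mu> l) * norm ?f \<le> norm ?f * norm ?f"
    using norm_mult_ineq[of ?f ?f] by (simp add: F_vv_square norm_scaleC)
  then have "cmod (\<mu> l) \<le> norm ?f"
    using F_vv_nonzero[of l] by simp
  also have "\<dots> \<le> K"
    using norm_F[OF v(1), of l "v l"] v(2)[of l] by simp
  finally show ?thesis .
qed

lemma diag_mem: "a \<in> A \<Longrightarrow> diag \<mu> a \<in> A"
  by (rule c0sum_diag[OF _ cmod_mu_le])

text \<open>For fixed \<open>a\<close> both sides are bounded linear in \<open>b\<close>, the right
  one because \<mu> is bounded; for rank one \<open>b\<close> the formula is
  \<open>phi_mult_F_eq\<close>.\<close>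

lemma phi_mult:
  assumes a: "a \<in> A" and b: "b \<in> A"
  shows "\<phi> a * \<phi> b = \<phi> (diag \<mu> (c0mult a b))"
proof -
  obtain N where N: "0 \<le> N" "bdd_by a N"
    using c0sum_bounded[OF a] .
  have mem: "diag \<mu> (c0mult a b) \<in> A" if "b \<in> A" for b
    by (rule diag_mem[OF c0sum_mult[OF a that]])
  have bm: "bounded_block_map H (\<lambda>b. \<phi> (diag \<mu> (c0mult a b))) (K * (K * N))"
  proof unfold_locales
    fix b c assume bc: "b \<in> A" "c \<in> A"
    have "diag \<mu> (c0mult a (\<lambda>l x. b l x + c l x)) = (\<lambda>l x. diag \<mu> (c0mult a b) l x + diag \<mu> (c0mult a c) l x)"
    proof (rule c0sum_eqI)
      fix l x assume "x \<in> H l"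
      then show "diag \<mu> (c0mult a (\<lambda>l x. b l x + c l x)) l x = diag \<mu> (c0mult a b) l x + diag \<mu> (c0mult a c) l x"
        using clinear_onD(2)[OF sub c0sum_linear[OF a]] c0sum_mem bc by (simp add: c0mult_def scaleC_add_right)
    qed (intro mem c0sum_add bc)+
    then show "\<phi> (diag \<mu> (c0mult a (\<lambda>l x. b l x + c l x))) = \<phi> (diag \<mu> (c0mult a b)) + \<phi> (diag \<mu> (c0mult a c))"
      using phi_add[OF mem[OF bc(1)] mem[OF bc(2)]] by simp
  next
    fix z b assume b: "b \<in> A"
    have "diag \<mu> (c0mult a (c0scale z b)) = c0scale z (diag \<mu> (c0mult a b))"
    proof (rule c0sum_eqI)
      fix l x assume "x \<in> H l"
      then show "diag \<mu> (c0mult a (c0scale z b)) l x = c0scale z (diag \<mu> (c0mult a b)) l x"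
        using clinear_onD(4)[OF sub c0sum_linear[OF a]] c0sum_mem b by (simp add: c0mult_def c0scale_def mult.commute)
    qed (intro mem c0sum_scale b)+
    then show "\<phi> (diag \<mu> (c0mult a (c0scale z b))) = scaleC z (\<phi> (diag \<mu> (c0mult a b)))"
      using phi_scale[OF mem[OF b]] by simp
  next
    show "0 \<le> K * (K * N)"
      using K_nonneg N(1) by simp
    fix b M assume b: "b \<in> A" "0 \<le> M" "bdd_by b M"
    have "bdd_by (c0mult a b) (N * M)"
      unfolding bdd_by_def c0mult_def
    proof
      show "bounded_by (H l) (a l \<circ> b l) (N * M)" for l
        using N b c0sum_mem[OF b(1)] by (intro bounded_by_comp) (auto simp: bdd_by_def)
    qed
    then have "bdd_by (diag \<mu> (c0mult a b)) (K * (N * M))"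
      by (rule bdd_by_diag[OF _ cmod_mu_le])
    then have "norm (\<phi> (diag \<mu> (c0mult a b))) \<le> K * (K * (N * M))"
      using K_nonneg N(1) b(2) by (intro phi_bound mem b(1)) auto
    then show "norm (\<phi> (diag \<mu> (c0mult a b))) \<le> K * (K * N) * M"
      by (simp add: mult.assoc)
  qed
  show ?thesis
  proof (rule block_map_eqI[OF block_map_mult_left bm _ b])
    fix l u y assume uy: "u \<in> H l" "y \<in> H l"
    have "diag \<mu> (c0mult a (E (l, u, y))) = c0scale (\<mu> l) (E (l, a l u, y))"
      using clinear_onD(4)[OF sub c0sum_linear[OF a] uy(1)] c0sum_at_0[OF a]
      by (intro ext) (simp add: c0mult_def c0scale_def)
    then show "\<phi> a * \<phi> (E (l, u, y)) = \<phi> (diag \<mu> (c0mult a (E (l, u, y))))"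
      using phi_mult_F_eq[OF uy a] phi_scale[OF elem_op_mem[OF c0sum_mem[OF a uy(1)]]] by (simp add: F_def)
  qed
qed

end

subsection \<open>The central factor\<close>

context zero_product_bijection
begin

lemma F_vv_mult_other: "l \<noteq> l' \<Longrightarrow> F l (v l) (v l) * F l' (v l') (v l') = 0"
  by (rule F_other_block[OF v(1) v(1)])

lemma summable_half: "summable (\<lambda>n. (1 / 2 :: real) ^ n)"
  by (rule summable_geometric) simp

text \<open>Sliding hump: otherwise \<open>\<Sum> F l (v l) (v l)\<close> would converge along an injective sequence of
  blocks, although its preimage under \<open>\<phi>\<close> has norm at least 1 on each of these blocks.\<close>
lemma norm_F_vv_lower_bound: "\<exists>\<delta>>0. \<forall>l. \<delta> \<le> norm (F l (v l) (v l))"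
proof (rule ccontr)
  assume "\<not> ?thesis"
  then obtain s :: "nat \<Rightarrow> 'i" where s: "inj s" "\<And>n. norm (F (s n) (v (s n)) (v (s n))) < (1 / 2) ^ n"
    using injective_sequence_below[of "\<lambda>l. norm (F l (v l) (v l))" "\<lambda>n. (1 / 2) ^ n"] F_vv_nonzero by auto
  define f where "f n = F (s n) (v (s n)) (v (s n))" for n
  have summable: "summable f"
    by (rule summable_comparison_test[OF _ summable_half]) (use s(2) in \<open>auto simp: f_def less_imp_le\<close>)
  obtain d where d: "d \<in> A" "suminf f = \<phi> d"
    using surj by blast
  \<comment> \<open>Multiplying the sum by \<open>f m\<close> isolates its \<open>m\<close>-th term,
    and in the comparison with \<open>phi_mult_F_eq\<close> the nonzero factor \<mu>
    cancels.\<close>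
  have fixed: "d (s m) (v (s m)) = v (s m)" for m
  proof -
    let ?l = "s m"
    have "f n * f m = (if n = m then f m * f m else 0)" for n
      using F_vv_mult_other[of "s n" "s m"] inj_eq[OF s(1)] by (auto simp: f_def)
    moreover have "suminf f * f m = (\<Sum>n. f n * f m)"
      by (rule bounded_linear.suminf[OF bounded_linear_mult_left summable])
    ultimately have "suminf f * f m = (\<Sum>n. if n = m then f m * f m else 0)"
      by simp
    also have "\<dots> = f m * f m"
      using sums_unique[OF sums_single[of m "\<lambda>_. f m * f m"]] by metis
    also have "\<dots> = scaleC (\<mu> ?l) (f m)"
      unfolding f_def by (rule F_vv_square)
    finally have "scaleC (\<mu> ?l) (F ?l (d ?l (v ?l)) (v ?l)) = scaleC (\<mu> ?l) (F ?l (v ?l) (v ?l))"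
      using phi_mult_F_eq[OF v(1) v(1) d(1), of ?l] by (simp add: f_def d(2))
    then have "scaleC (\<mu> ?l) (F ?l (d ?l (v ?l)) (v ?l) - F ?l (v ?l) (v ?l)) = 0"
      by (simp add: scaleC_diff_right)
    then have eq: "F ?l (d ?l (v ?l)) (v ?l) = F ?l (v ?l) (v ?l)"
      using mu_nonzero[of ?l] by (simp add: scaleC_eq_0_iff)
    have dv: "d ?l (v ?l) \<in> H ?l"
      by (rule c0sum_mem[OF d(1) v(1)])
    then have "d ?l (v ?l) - v ?l \<in> H ?l"
      by (rule csubspaceD(4)[OF sub _ v(1)])
    moreover have "F ?l (d ?l (v ?l) - v ?l) (v ?l) = 0"
      using F_add_left[OF \<open>d ?l (v ?l) - v ?l \<in> H ?l\<close> v(1), of "v ?l"] eq by simp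
    moreover have "v ?l \<noteq> 0"
      using v(2)[of ?l] by auto
    ultimately show ?thesis
      using F_eq_0D[OF _ v(1)] by fastforce
  qed
  have "\<not> bounded_by (H (s m)) (d (s m)) (1 / 2)" for m
  proof
    assume "bounded_by (H (s m)) (d (s m)) (1 / 2)"
    from bounded_byD[OF this v(1)] show False
      by (simp add: fixed v(2))
  qed
  then have "range s \<subseteq> {l. \<not> bounded_by (H l) (d l) (1 / 2)}"
    by blast
  moreover have "finite {l. \<not> bounded_by (H l) (d l) (1 / 2)}"
    using d(1) unfolding c0sum_iff by simp
  ultimately show False
    using s(1) by (meson finite_subset range_inj_infinite)
qed

text \<open>The involution need not respect the blocks a priori. But \<open>?p * x * ?q = 0\<close>
  for every \<open>x\<close>, because products stay within blocks, and with \<open>x = st ?p\<close>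
  this expression occurs inside \<open>st ?w * ?w\<close> for \<open>?w = st ?p * ?q\<close>. The
  C*-identity gives \<open>?w = 0\<close>.\<close>

lemma st_F_vv_orthogonal:
  assumes "l \<noteq> l'"
  shows "st (F l (v l) (v l)) * F l' (v l') (v l') = 0"
proof -
  let ?p = "F l (v l) (v l)" and ?q = "F l' (v l') (v l')"
  have zero: "?p * x * ?q = 0" for x
  proof -
    obtain a where a: "a \<in> A" "x = \<phi> a"
      using surj by blast
    let ?d = "diag \<mu> (c0mult (E (l, v l, v l)) a)"
    have d: "?d \<in> A"
      by (intro diag_mem c0sum_mult elem_op_mem v(1) a(1))
    have "?p * x = \<phi> ?d"
      unfolding F_def a(2) by (rule phi_mult[OF elem_op_mem[OF v(1)] a(1)])
    then have "?p * x * ?q = scaleC (\<mu> l') (F l' (?d l' (v l')) (v l'))"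
      using phi_mult_F_eq[OF v(1) v(1) d] by simp
    also have "?d l' (v l') = 0"
      using assms by (simp add: c0mult_def)
    finally show ?thesis
      by (simp add: F_0)
  qed
  let ?w = "st ?p * ?q"
  have "st ?w * ?w = st ?q * (?p * st ?p * ?q)"
    by (simp add: st(1,2) mult.assoc)
  then have "(norm ?w)\<^sup>2 = 0"
    using st(3)[of ?w] zero[of "st ?p"] by simp
  then show ?thesis
    by simp
qed

text \<open>Second sliding hump. The C*-identity enters through
  \<open>norm (st x * x) = (norm x)\<^sup>2\<close> for \<open>x = F l (v l) (v l)\<close>.\<close>
lemma mu_lower_bound: "\<exists>\<delta>>0. \<forall>l. \<delta> \<le> cmod (\<mu> l)"
proof (rule ccontr)
  assume "\<not> ?thesis"
  \<comment> \<open>The rate 1/4 beats the weights \<open>(1 / 2) ^ n\<close> of the series below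
    and leaves a surplus factor \<open>(1 / 2) ^ m\<close> that tends to 0.\<close>
  then obtain s :: "nat \<Rightarrow> 'i" where s: "inj s" "\<And>n. cmod (\<mu> (s n)) < (1 / 4) ^ n"
    using injective_sequence_below[of "\<lambda>l. cmod (\<mu> l)" "\<lambda>n. (1 / 4) ^ n"] mu_nonzero by auto
  obtain \<delta> where \<delta>: "\<delta> > 0" "\<And>l. \<delta> \<le> norm (F l (v l) (v l))"
    using norm_F_vv_lower_bound by blast
  define p where "p n = F (s n) (v (s n)) (v (s n))" for n
  \<comment> \<open>With \<open>st (p m)\<close> in place of \<open>p m\<close>, the product with
    \<open>p m\<close> does not shrink with \<mu>: \<open>f m * p m\<close> has norm
    \<open>(1 / 2) ^ m * norm (p m)\<close>.\<close>
  define f where "f n = ((1 / 2) ^ n / norm (p n)) *\<^sub>R st (p n)" for n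
  have p: "p n \<noteq> 0" for n
    by (simp add: p_def F_vv_nonzero)
  have "norm (f n) = (1 / 2) ^ n" for n
    using p by (simp add: f_def norm_st)
  then have summable: "summable f"
    by (intro summable_comparison_test[OF _ summable_half]) auto
  obtain d where d: "d \<in> A" "suminf f = \<phi> d"
    using surj by blast
  obtain M where M: "0 \<le> M" "bdd_by d M"
    using c0sum_bounded[OF d(1)] .
  have "\<delta> \<le> K * M * (1 / 2) ^ m" for m
  proof -
    let ?l = "s m"
    have "f n * p m = (if n = m then f m * p m else 0)" for n
      using st_F_vv_orthogonal[of "s n" "s m"] inj_eq[OF s(1)] by (auto simp: f_def p_def)
    moreover have "suminf f * p m = (\<Sum>n. f n * p m)"
      by (rule bounded_linear.suminf[OF bounded_linear_mult_left summable])
    ultimately have "suminf f * p m = (\<Sum>n. if n = m then f m * p m else 0)"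
      by simp
    also have "\<dots> = f m * p m"
      using sums_unique[OF sums_single[of m "\<lambda>_. f m * p m"]] by metis
    finally have "norm (\<phi> d * p m) = (1 / 2) ^ m * norm (p m)"
      using p[of m] st(3)[of "p m"] by (simp add: d(2) f_def power2_eq_square)
    then have "(1 / 2) ^ m * norm (p m) = cmod (\<mu> ?l) * norm (F ?l (d ?l (v ?l)) (v ?l))"
      using phi_mult_F_eq[OF v(1) v(1) d(1), of ?l] by (simp add: p_def norm_scaleC)
    also have "norm (F ?l (d ?l (v ?l)) (v ?l)) \<le> K * M"
      using norm_F[OF c0sum_mem[OF d(1) v(1)], of ?l "v ?l"] mult_left_mono[OF bdd_byD[OF M(2) v(1), of ?l] K_nonneg]
      by (simp add: v(2))
    then have "cmod (\<mu> ?l) * norm (F ?l (d ?l (v ?l)) (v ?l)) \<le> (1 / 4) ^ m * (K * M)"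
      using s(2)[of m] by (intro mult_mono) auto
    also have "(1 / 4 :: real) ^ m = (1 / 2) ^ m * (1 / 2) ^ m"
      by (simp flip: power_mult_distrib)
    finally have "(1 / 2) ^ m * norm (p m) \<le> (1 / 2) ^ m * (K * M * (1 / 2) ^ m)"
      by (simp add: mult_ac)
    then have "norm (p m) \<le> K * M * (1 / 2) ^ m"
      by (simp only: mult_le_cancel_left_pos zero_less_power zero_less_divide_iff zero_less_one zero_less_numeral simp_thms)
    then show ?thesis
      using \<delta>(2)[of ?l] by (simp add: p_def)
  qed
  moreover have "(\<lambda>m. K * M * (1 / 2) ^ m) \<longlonglongrightarrow> 0"
    by (intro tendsto_mult_right_zero LIMSEQ_power_zero) simp
  ultimately have "\<delta> \<le> 0"
    by (intro LIMSEQ_le_const) auto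
  then show False
    using \<delta>(1) by simp
qed

text \<open>The constant \<open>K\<^sup>2 / \<delta> ^ 3\<close> found below collects one factor
  \<mu> from each of the products \<open>F l u u * F l u u\<close>, \<open>F l u w * F l w u\<close>
  and \<open>\<phi> a * F l u u\<close>, where \<open>w = a l u\<close>, and a factor
  \<open>K\<close> from each of two applications of \<open>norm_F\<close>.\<close>

lemma phi_bounded_below: "\<exists>C\<ge>0. \<forall>a\<in>A. bdd_by a (C * norm (\<phi> a))"
proof -
  obtain \<delta> where \<delta>: "\<delta> > 0" "\<And>l. \<delta> \<le> cmod (\<mu> l)"
    using mu_lower_bound by blast
  have bound: "norm (a l u) \<le> K\<^sup>2 / \<delta> ^ 3 * norm (\<phi> a) * norm u" if a: "a \<in> A" and u: "u \<in> H l" for a l u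
  proof (cases "u = 0 \<or> a l u = 0")
    case True
    then have "a l u = 0"
      using c0sum_at_0[OF a] by auto
    then show ?thesis
      using \<delta>(1) by simp
  next
    case False
    define w where "w = a l u"
    have w: "w \<in> H l" "w \<noteq> 0" "u \<noteq> 0"
      using False c0sum_mem[OF a u] by (auto simp: w_def)
    let ?m = "cmod (\<mu> l)"
    have Fuu: "F l u u \<noteq> 0"
      using F_eq_0D[OF u u] w(3) by blast
    have "?m * (norm u)\<^sup>2 * norm (F l u u) = norm (F l u u * F l u u)"
      using F_mult_F[OF u u u u] by (simp add: norm_scaleC norm_mult norm_power cinner_self)
    also have "\<dots> \<le> norm (F l u u) * norm (F l u u)"
      by (rule norm_mult_ineq)
    finally have 1: "?m * (norm u)\<^sup>2 \<le> norm (F l u u)"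
      using Fuu by simp
    have "?m * (norm w)\<^sup>2 * (?m * (norm u)\<^sup>2) \<le> ?m * (norm w)\<^sup>2 * norm (F l u u)"
      using 1 by (intro mult_left_mono) auto
    also have "\<dots> = norm (F l u w * F l w u)"
      using F_mult_F[OF u w(1) w(1) u] by (simp add: norm_scaleC norm_mult norm_power cinner_self)
    also have "\<dots> \<le> norm (F l u w) * norm (F l w u)"
      by (rule norm_mult_ineq)
    also have "\<dots> \<le> K * (norm u * norm w) * norm (F l w u)"
      by (intro mult_right_mono norm_F u) simp
    finally have "(norm u * norm w) * (?m\<^sup>2 * (norm w * norm u)) \<le> (norm u * norm w) * (K * norm (F l w u))"
      by (simp add: power2_eq_square mult_ac)
    then have 2: "?m\<^sup>2 * (norm w * norm u) \<le> K * norm (F l w u)"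
      using w by (simp add: mult_le_cancel_left_pos)
    have "?m * norm (F l w u) = norm (\<phi> a * F l u u)"
      using phi_mult_F_eq[OF u u a] by (simp add: norm_scaleC w_def)
    also have "\<dots> \<le> norm (\<phi> a) * norm (F l u u)"
      by (rule norm_mult_ineq)
    also have "\<dots> \<le> norm (\<phi> a) * (K * (norm u * norm u))"
      by (intro mult_left_mono norm_F u) simp
    finally have 3: "?m * norm (F l w u) \<le> norm (\<phi> a) * (K * (norm u * norm u))" .
    have "\<delta> ^ 3 * norm w * norm u \<le> ?m ^ 3 * norm w * norm u"
      using \<delta> by (intro mult_right_mono power_mono) (auto simp: less_imp_le)
    also have "\<dots> = ?m * (?m\<^sup>2 * (norm w * norm u))"
      by (simp add: power2_eq_square power3_eq_cube mult_ac)
    also have "\<dots> \<le> ?m * (K * norm (F l w u))"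
      using 2 by (intro mult_left_mono) auto
    also have "\<dots> \<le> K * (norm (\<phi> a) * (K * (norm u * norm u)))"
      using mult_left_mono[OF 3 K_nonneg] by (simp add: mult_ac)
    finally have "norm u * (\<delta> ^ 3 * norm w) \<le> norm u * (K\<^sup>2 * norm (\<phi> a) * norm u)"
      by (simp add: power2_eq_square mult_ac)
    then have "\<delta> ^ 3 * norm w \<le> K\<^sup>2 * norm (\<phi> a) * norm u"
      using w(3) by (simp add: mult_le_cancel_left_pos)
    then show ?thesis
      using \<delta>(1) by (simp add: w_def field_simps)
  qed
  have "\<forall>a\<in>A. bdd_by a (K\<^sup>2 / \<delta> ^ 3 * norm (\<phi> a))"
    by (intro ballI bdd_byI bound)
  moreover have "0 \<le> K\<^sup>2 / \<delta> ^ 3"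
    using \<delta>(1) by simp
  ultimately show ?thesis
    by blast
qed

text \<open>Multiplication by the future \<open>h\<close>: along an approximate unit
  \<open>p\<close>, the products \<open>\<phi> p * x\<close> tend to \<open>S x\<close>.\<close>

definition S :: "'b \<Rightarrow> 'b" where
  "S x = \<phi> (diag \<mu> (inv_into A \<phi> x))"

lemma S_phi: "a \<in> A \<Longrightarrow> S (\<phi> a) = \<phi> (diag \<mu> a)"
  using bij by (simp add: S_def bij_betw_def inv_into_f_f)

text \<open>Block scalars can be moved from one factor of \<open>c0mult\<close> to the
  other.\<close>

lemma S_central: "S x * y = x * S y"
proof -
  obtain a b where a: "a \<in> A" "x = \<phi> a" and b: "b \<in> A" "y = \<phi> b"
    using surj by metis
  have "diag \<mu> (c0mult (diag \<mu> a) b) = diag \<mu> (c0mult a (diag \<mu> b))"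
  proof (rule c0sum_eqI)
    fix l x assume x: "x \<in> H l"
    show "diag \<mu> (c0mult (diag \<mu> a) b) l x = diag \<mu> (c0mult a (diag \<mu> b)) l x"
      using clinear_onD(4)[OF sub c0sum_linear[OF a(1)] c0sum_mem[OF b(1) x]] by (simp add: c0mult_def)
  qed (intro diag_mem c0sum_mult a(1) b(1))+
  then show ?thesis
    by (simp add: a b S_phi phi_mult diag_mem)
qed

text \<open>Take \<open>x = \<phi> p\<close> with \<open>p\<close> from the approximate unit: by
  \<open>phi_mult\<close>, \<open>x * \<phi> d\<close> is the image of
  \<open>diag \<mu> (c0mult p d)\<close>, which is close to \<open>diag \<mu> d\<close>, and
  likewise on the right. Projections have norm at most 1, whence the uniform bound
  \<open>K\<close>.\<close>

lemma S_approximants: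
  assumes "finite D" "\<epsilon> > 0"
  shows "\<exists>x. norm x \<le> K \<and> (\<forall>b\<in>D. norm (x * b - S b) \<le> \<epsilon> \<and> norm (b * x - S b) \<le> \<epsilon>)"
proof -
  define D' where "D' = inv_into A \<phi> ` D"
  have \<psi>: "inv_into A \<phi> x \<in> A" "\<phi> (inv_into A \<phi> x) = x" for x
    using bij by (auto simp: bij_betw_def inv_into_into f_inv_into_f)
  \<comment> \<open>One factor \<open>K\<close> bounds \<open>\<phi>\<close>, the other bounds
    \<mu>.\<close>
  define \<eta> where "\<eta> = \<epsilon> / (K * K + 1)"
  have K1: "K * K + 1 > 0"
    using K_nonneg by (simp add: add_nonneg_pos)
  have D': "finite D'" "D' \<subseteq> A" "\<eta> > 0"
    using assms \<psi>(1) K1 by (auto simp: D'_def \<eta>_def)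
  obtain e n where e: "\<forall>l. weak_orthonormal (e l)" "\<forall>l k. e l k \<in> H l" "proj_op e n \<in> A"
    "\<forall>d\<in>D'. bdd_by (\<lambda>l x. proj_op e n l (d l x) - d l x) \<eta>"
    "\<forall>d\<in>D'. bdd_by (\<lambda>l x. d l (proj_op e n l x) - d l x) \<eta>"
    by (rule approximate_unit[OF D']) (rule that)
  let ?p = "proj_op e n"
  have "bdd_by ?p 1"
    using norm_partial_proj_le[OF spec[OF e(1)]] by (intro bdd_byI) (simp add: proj_op_def)
  then have "norm (\<phi> ?p) \<le> K"
    using phi_bound[OF e(3), of 1] by simp
  have close: "norm (\<phi> (diag \<mu> c) - \<phi> (diag \<mu> d)) \<le> \<epsilon>"
    if c: "c \<in> A" and d: "d \<in> A" and cd: "bdd_by (\<lambda>l x. c l x - d l x) \<eta>" for c d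
  proof -
    have "diag \<mu> (\<lambda>l x. c l x - d l x) = (\<lambda>l x. diag \<mu> c l x - diag \<mu> d l x)"
      by (intro ext) (simp add: scaleC_diff_right)
    then have "\<phi> (diag \<mu> c) - \<phi> (diag \<mu> d) = \<phi> (diag \<mu> (\<lambda>l x. c l x - d l x))"
      using phi_diff[OF diag_mem[OF c] diag_mem[OF d]] by simp
    also have "norm \<dots> \<le> K * (K * \<eta>)"
      using K_nonneg D'(3) by (intro phi_bound diag_mem c0sum_diff c d bdd_by_diag[OF cd cmod_mu_le]) simp
    also have "\<dots> \<le> \<epsilon>"
      using K1 assms(2) by (simp add: \<eta>_def field_simps)
    finally show ?thesis .
  qed
  have "norm (\<phi> ?p * b - S b) \<le> \<epsilon> \<and> norm (b * \<phi> ?p - S b) \<le> \<epsilon>" if "b \<in> D" for b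
  proof -
    define d where "d = inv_into A \<phi> b"
    have d: "d \<in> A" "\<phi> d = b" "d \<in> D'"
      using \<psi> that by (auto simp: d_def D'_def)
    have "norm (\<phi> (diag \<mu> (c0mult ?p d)) - \<phi> (diag \<mu> d)) \<le> \<epsilon>"
      using e(4) d(3) by (intro close c0sum_mult e(3) d(1)) (simp add: c0mult_def)
    moreover have "norm (\<phi> (diag \<mu> (c0mult d ?p)) - \<phi> (diag \<mu> d)) \<le> \<epsilon>"
      using e(5) d(3) by (intro close c0sum_mult e(3) d(1)) (simp add: c0mult_def)
    ultimately show ?thesis
      using phi_mult[OF e(3) d(1)] phi_mult[OF d(1) e(3)] S_phi[OF d(1)] d(2) by simp
  qed
  then show ?thesis
    using \<open>norm (\<phi> ?p) \<le> K\<close> by blast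
qed

lemma diag_inverse_mem: "a \<in> A \<Longrightarrow> diag (\<lambda>l. 1 / \<mu> l) a \<in> A"
proof -
  assume a: "a \<in> A"
  obtain \<delta> where \<delta>: "\<delta> > 0" "\<And>l. \<delta> \<le> cmod (\<mu> l)"
    using mu_lower_bound by blast
  show ?thesis
  proof (rule c0sum_diag[OF a])
    show "cmod (1 / \<mu> l) \<le> 1 / \<delta>" for l
      using \<delta> by (simp add: norm_divide frac_le)
  qed
qed

text \<open>The functional is pulled back along \<open>\<phi>\<close> and approximated there by left
  multiplication with some \<open>p\<close>. Dividing \<open>p\<close> by \<mu> corrects for the
  twist, so that \<open>b * \<phi> a = \<phi> (c0mult p a)\<close>, and
  \<open>phi_bounded_below\<close> turns bounds on \<open>a\<close> into bounds on
  \<open>norm x\<close>.\<close>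

lemma dual_essential:
  assumes f: "f \<in> cdual" and "\<epsilon> > 0"
  shows "\<exists>b. \<forall>x::'b. cmod (f x - f (b * x)) \<le> \<epsilon> * norm x"
proof -
  obtain C where C: "C \<ge> 0" "\<And>a. a \<in> A \<Longrightarrow> bdd_by a (C * norm (\<phi> a))"
    using phi_bounded_below by blast
  define \<eta> where "\<eta> = \<epsilon> / (C + 1)"
  have \<eta>: "\<eta> > 0"
    using \<open>\<epsilon> > 0\<close> C(1) by (simp add: \<eta>_def)
  obtain p where p: "p \<in> A" "\<And>a M. a \<in> A \<Longrightarrow> 0 < M \<Longrightarrow> bdd_by a M \<Longrightarrow> cmod (f (\<phi> a) - f (\<phi> (c0mult p a))) \<le> \<eta> * M"
  proof (rule functional_left_approx[where G = "\<lambda>a. f (\<phi> a)" and \<epsilon> = \<eta> and ?N0.0 = "dual_norm f * K"])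
    show "cmod (f (\<phi> a)) \<le> dual_norm f * K * M" if "a \<in> A" "0 \<le> M" "bdd_by a M" for a M
      using dual_norm_bound(1)[OF f, of "\<phi> a"] mult_left_mono[OF phi_bound[OF that] dual_norm_bound(2)[OF f]]
      by (simp add: mult.assoc)
    show "0 \<le> dual_norm f * K"
      using dual_norm_bound(2)[OF f] K_nonneg by simp
  qed (use \<eta> in \<open>simp_all add: phi_add phi_scale cdualD[OF f]\<close>)
  define b where "b = \<phi> (diag (\<lambda>l. 1 / \<mu> l) p)"
  have b: "b * \<phi> a = \<phi> (c0mult p a)" if "a \<in> A" for a
  proof -
    have "diag \<mu> (c0mult (diag (\<lambda>l. 1 / \<mu> l) p) a) = c0mult p a"
      using mu_nonzero by (intro ext) (simp add: c0mult_def)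
    then show ?thesis
      using phi_mult[OF diag_inverse_mem[OF p(1)] that] by (simp add: b_def)
  qed
  have "cmod (f x - f (b * x)) \<le> \<epsilon> * norm x" for x
  proof (cases "x = 0")
    case False
    obtain a where a: "a \<in> A" "x = \<phi> a"
      using surj by blast
    have "C * norm (\<phi> a) \<le> (C + 1) * norm x"
      by (simp add: a(2) distrib_right)
    then have "bdd_by a ((C + 1) * norm x)"
      using C(2)[OF a(1)] bounded_by_mono unfolding bdd_by_def by blast
    then have "cmod (f x - f (b * x)) \<le> \<eta> * ((C + 1) * norm x)"
      using p(2)[OF a(1)] False C(1) b[OF a(1)] by (simp add: a(2) add_nonneg_pos)
    then show ?thesis
      using C(1) by (simp add: \<eta>_def)
  qed (simp add: cdualD[OF f])
  then show ?thesis
    by blast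
qed

text \<open>A product of two images under \<open>\<phi>\<close> carries one factor \<mu>, while
  \<open>\<rho>\<close> divides each argument by \<mu>; one factor 1/\<mu> remains, as
  multiplicativity demands. On the range \<open>h\<close> acts as \<open>S\<close>, and
  \<open>S (\<rho> a) = \<phi> a\<close>.\<close>

theorem central_factorization:
  "\<exists>h\<in>center_multiplier_algebra. \<exists>\<rho>. bij_betw \<rho> A UNIV \<and> c0linear H \<rho> \<and>
    (\<forall>a\<in>A. \<forall>b\<in>A. \<rho> (c0mult a b) = \<rho> a * \<rho> b) \<and> (\<forall>a\<in>A. bembed (\<phi> a) = arens_mult h (bembed (\<rho> a)))"
proof -
  obtain h where h: "h \<in> cbidual"
    "\<forall>f\<in>cdual. \<forall>b. h (\<lambda>a. f (a * b)) = f (S b) \<and> h (\<lambda>a. f (b * a)) = f (S b)"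
    using bidual_element_of_multiplier[of K S] S_approximants by blast
  have hS: "h (\<lambda>a. f (a * b)) = f (S b)" "h (\<lambda>a. f (b * a)) = f (S b)" if "f \<in> cdual" for f b
    using h(2) that by auto
  have center: "h \<in> center_multiplier_algebra"
    by (rule central_multiplier_in_center[OF h(1) hS S_central dual_essential])
  have hmult: "arens_mult h (bembed b) = bembed (S b)" for b
    by (rule central_multiplier_in_center[OF h(1) hS S_central dual_essential])
  let ?i = "\<lambda>l. 1 / \<mu> l"
  define \<rho> where "\<rho> a = \<phi> (diag ?i a)" for a
  have inv: "diag \<mu> (diag ?i a) = a" "diag ?i (diag \<mu> a) = a" for a
    using mu_nonzero by (auto simp: diag_def)
  have "bij_betw (diag ?i) A A"
    by (rule bij_betw_byWitness[where f' = "diag \<mu>"]) (auto simp: inv diag_mem diag_inverse_mem)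
  then have "bij_betw (\<phi> \<circ> diag ?i) A UNIV"
    using bij by (rule bij_betw_trans)
  then have "bij_betw \<rho> A UNIV"
    by (simp add: \<rho>_def[abs_def] comp_def)
  moreover have "c0linear H \<rho>"
    unfolding c0linear_def
  proof (intro conjI ballI allI)
    fix a b assume ab: "a \<in> A" "b \<in> A"
    have "diag ?i (\<lambda>l x. a l x + b l x) = (\<lambda>l x. diag ?i a l x + diag ?i b l x)"
      by (intro ext) (simp add: scaleC_add_right)
    then show "\<rho> (\<lambda>l x. a l x + b l x) = \<rho> a + \<rho> b"
      using phi_add[OF diag_inverse_mem[OF ab(1)] diag_inverse_mem[OF ab(2)]] by (simp add: \<rho>_def)
  next
    fix z a assume a: "a \<in> A"
    have "diag ?i (c0scale z a) = c0scale z (diag ?i a)"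
      by (intro ext) (simp add: c0scale_def)
    then show "\<rho> (c0scale z a) = scaleC z (\<rho> a)"
      using phi_scale[OF diag_inverse_mem[OF a]] by (simp add: \<rho>_def)
  qed
  moreover have "\<rho> (c0mult a b) = \<rho> a * \<rho> b" if ab: "a \<in> A" "b \<in> A" for a b
  proof -
    have "diag \<mu> (c0mult (diag ?i a) (diag ?i b)) = diag ?i (c0mult a b)"
    proof (rule c0sum_eqI)
      fix l x assume x: "x \<in> H l"
      show "diag \<mu> (c0mult (diag ?i a) (diag ?i b)) l x = diag ?i (c0mult a b) l x"
        using clinear_onD(4)[OF sub c0sum_linear[OF ab(1)] c0sum_mem[OF ab(2) x]] mu_nonzero[of l]
        by (simp add: c0mult_def)
    qed (intro diag_mem diag_inverse_mem c0sum_mult ab)+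
    then show ?thesis
      using phi_mult[OF diag_inverse_mem[OF ab(1)] diag_inverse_mem[OF ab(2)]] by (simp add: \<rho>_def)
  qed
  moreover have "bembed (\<phi> a) = arens_mult h (bembed (\<rho> a))" if "a \<in> A" for a
  proof -
    have "S (\<rho> a) = \<phi> a"
      using S_phi[OF diag_inverse_mem[OF that]] by (simp add: \<rho>_def inv(1))
    then show ?thesis
      by (simp add: hmult)
  qed
  ultimately show ?thesis
    by (intro bexI[OF _ center] exI[of _ \<rho>]) simp
qed

end

theorem mainTheorem17:
  fixes H :: "'i \<Rightarrow> 'h::chilbert set"
    and \<phi> :: "('i \<Rightarrow> 'h \<Rightarrow> 'h) \<Rightarrow> 'b::cbanach_algebra"
    and c :: "'i \<Rightarrow> 'h \<Rightarrow> 'h"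
  assumes H: "\<forall>l. csubspace (H l) \<and> closed (H l)"
    and c: "c \<in> c0sum H"
    and rank: "\<forall>l. cdim (c l ` H l) + 2 \<le> cdim (H l)"
    and lin: "c0linear H \<phi>"
    and bdd: "c0bounded H \<phi>"
    and pp: "has_product_property_at H \<phi> c"
  shows "(\<forall>a\<in>c0sum H. \<forall>b\<in>c0sum H. c0mult a b = (\<lambda>l x. 0) \<longrightarrow> \<phi> a * \<phi> b = 0)
       \<and> (\<forall>st::'b \<Rightarrow> 'b. is_cstar_involution st \<and> bij_betw \<phi> (c0sum H) UNIV \<longrightarrow>
            (\<exists>h \<in> (center_multiplier_algebra :: (('b \<Rightarrow> complex) \<Rightarrow> complex) set).
             \<exists>\<rho>. bij_betw \<rho> (c0sum H) (UNIV :: 'b set) \<and> c0linear H \<rho> \<and>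
                 (\<forall>a\<in>c0sum H. \<forall>b\<in>c0sum H. \<rho> (c0mult a b) = \<rho> a * \<rho> b) \<and>
                 (\<forall>a\<in>c0sum H. bembed (\<phi> a) = arens_mult h (bembed (\<rho> a)))))"
proof -
  interpret hilbert_blocks H
    using H by unfold_locales auto
  obtain K where K: "\<And>a. a \<in> A \<Longrightarrow> norm (\<phi> a) \<le> K * c0norm H a"
    using bdd by (auto simp: c0bounded_def)
  \<comment> \<open>The constant obtained from \<open>c0bounded\<close> may be negative.\<close>
  interpret bounded_block_map H \<phi> "\<bar>K\<bar>"
  proof unfold_locales
    fix a M assume a: "a \<in> A" "0 \<le> M" "bdd_by a M"
    have "norm (\<phi> a) \<le> \<bar>K\<bar> * c0norm H a"
      using K[OF a(1)] mult_right_mono[OF abs_ge_self[of K] c0norm_nonneg[OF a(1)]] by linarith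
    also have "\<dots> \<le> \<bar>K\<bar> * M"
      by (intro mult_left_mono c0norm_le a(2,3)) simp
    finally show "norm (\<phi> a) \<le> \<bar>K\<bar> * M" .
  qed (use lin in \<open>auto simp: c0linear_def\<close>)
  obtain T where T: "\<And>a b. a \<in> A \<Longrightarrow> b \<in> A \<Longrightarrow> c0mult a b = c \<Longrightarrow> \<phi> a * \<phi> b = T c"
    using pp unfolding has_product_property_at_def by metis
  have elem: "\<phi> (E (l, u, y)) * \<phi> (E (l', u', y')) = 0"
    if "u \<in> H l" "u' \<in> H l'" "l \<noteq> l' \<or> cinner y u' = 0" for l u y l' u' y'
    by (rule elem_product_zero[OF c spec[OF rank] T that])
  \<comment> \<open>The two spare dimensions also guarantee that no block is zero, so reference
    vectors exist.\<close>
  have unit: "\<exists>v\<in>H l. norm v = 1" for l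
  proof -
    have "enat (card ({} :: 'h set) + 1) \<le> 2"
      by (simp add: numeral_eq_enat one_enat_def)
    also have "\<dots> \<le> cdim (c l ` H l) + 2"
      by (metis add.commute le_iff_add)
    also have "\<dots> \<le> cdim (H l)"
      using rank by blast
    finally show ?thesis
      using exists_unit_orthogonal[OF sub finite.emptyI] by blast
  qed
  then obtain v where v: "\<And>l. v l \<in> H l" "\<And>l. norm (v l) = 1"
    by metis
  show ?thesis
  proof (intro conjI ballI allI impI)
    show "\<phi> a * \<phi> b = 0" if "a \<in> A" "b \<in> A" "c0mult a b = (\<lambda>l x. 0)" for a b
      by (rule zero_product_from_elems[OF elem that])
    fix st :: "'b \<Rightarrow> 'b"
    assume st: "is_cstar_involution st \<and> bij_betw \<phi> A UNIV"
    interpret zero_product_bijection H \<phi> "\<bar>K\<bar>" v st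
      using elem v st by unfold_locales auto
    show "\<exists>h \<in> (center_multiplier_algebra :: (('b \<Rightarrow> complex) \<Rightarrow> complex) set).
             \<exists>\<rho>. bij_betw \<rho> A (UNIV :: 'b set) \<and> c0linear H \<rho> \<and>
                 (\<forall>a\<in>A. \<forall>b\<in>A. \<rho> (c0mult a b) = \<rho> a * \<rho> b) \<and>
                 (\<forall>a\<in>A. bembed (\<phi> a) = arens_mult h (bembed (\<rho> a)))"
      by (rule central_factorization)
  qed
qed

end
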